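(* Let $\theta=(\alpha,\beta,\gamma,\delta)\in\mathbb{R}^4$ with $\gamma\ge|\delta|$ and $\beta>0$, and let $\{\varepsilon_t\}_{t\in\mathbb{Z}}$ be i.i.d. real random variables. Assume: (1) (stationarity of EGARCH) $E\log\bigl|\alpha+\gamma|\varepsilon_0|+\delta\varepsilon_0\bigr|<\infty$ and $\beta<1$; (2) (regularity) the distribution of $\varepsilon_0$ is absolutely continuous with respect to Lebesgue measure on $\mathbb{R}$ with continuous density $g$, $E\varepsilon_0=0$, $E\varepsilon_0^2=1$, $g(x)>0$ for all $x\in\mathbb{R}$, and $\sup_{x\in\mathbb{R}}(|x|+1)g(x)<\infty$. Let $\lambda^y_E:=E\log\bigl|\beta-\tfrac12(\gamma|\varepsilon_0|+\delta\varepsilon_0)\bigr|$, and let $H^E(\theta,y,x)=\exp\{\alpha+\beta\log x+(\gamma|y|+\delta y)x^{-1/2}\}$ for $y\in\mathbb{R}$, $x>0$. Let $\{\sigma_t^2\}$ be the strictly stationary EGARCH volatility process, and for a starting point $s^2>0$ let $\hat\sigma_0^2=s^2$ and $\hat\sigma_t^2=H^E(\theta,\sigma_{t-1}\varepsilon_{t-1},\hat\sigma_{t-1}^2)$ for $t\ge1$. i) If $\lambda^y_E>0$, let $\{(\overline{\sigma}_t^2,\hat{\overline{\sigma}}_t^2)\}_{t\ge0}$ be the stationary solution, on an extended probability space, of the system $$\sigma_t^2=H^E(\theta,\sigma_{t-1}\varepsilon_{t-1},\sigma_{t-1}^2),\qquad \hat\sigma_t^2=H^E(\theta,\sigma_{t-1}\varepsilon_{t-1},\hat\sigma_{t-1}^2),\qquad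 t\ge1,$$ satisfying $P(\overline{\sigma}_0^2=\hat{\overline{\sigma}}_0^2)=0$. Then this process is ergodic, and for any $B\in\mathcal{B}(\mathbb{R}^2)$ and any starting point $s^2$, $$n^{-1}\sum_{t=0}^{n-1}I\{(\sigma_t^2,\hat\sigma_t^2)\in B\}\ \xrightarrow{a.s.}\ P\bigl((\overline{\sigma}_0^2,\hat{\overline{\sigma}}_0^2)\in B\bigr),\qquad n\to\infty,$$ where $I\{\cdot\}$ is the indicator function. ii) If $\lambda^y_E<0$, then for any starting point $s^2$ and any $\mu>0$, $$P\bigl(|\sigma_t^2-\hat\sigma_t^2|\ge\mu\bigr)\to0,\qquad t\to\infty.$$
   Context: The EGARCH model is $y_t=\sigma_t\varepsilon_t$, $\log\sigma_t^2=\alpha+\gamma|\varepsilon_{t-1}|+\delta\varepsilon_{t-1}+\beta\log\sigma_{t-1}^2$, $t\in\mathbb{Z}$, with $\sigma_t>0$. Equivalently $\sigma_t^2=H^E(\theta,y_{t-1},\sigma^2_{t-1})$. Under (1) it has a unique strictly stationary solution, and this is the process $\{\sigma_t\}_{t\in\mathbb{Z}}$ (also denoted $\{\overline{\sigma}_t\}$). A stationary solution of the system on an extended probability space means: on an enlargement of the original probability space (for example its product with another probability space, on which the $\varepsilon_t$ are still defined), a strictly stationary process of pairs of positive random variables satisfying both equations of the system for all $t\ge1$, whose first component is the stationary EGARCH volatility $\overline{\sigma}_t^2$ and whose initial pair $(\overline{\sigma}_0^2,\hat{\overline{\sigma}}_0^2)$ is independent of $\{\varepsilon_t,\,t\ge0\}$.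 $\mathcal{B}(\mathbb{R}^2)$ is the Borel $\sigma$-algebra of $\mathbb{R}^2$. *)

theory Defs
  imports "HOL-Probability.Probability"
begin

subsection \<open>Expectation of a logarithm\<close>

text \<open>The logarithm of the modulus with value \<open>-\<infinity>\<close> at 0 (the library's \<open>ln 0\<close> is 0).\<close>

definition log_abs :: "real \<Rightarrow> ereal" where
  "log_abs x = (if x = 0 then -\<infinity> else ereal (ln \<bar>x\<bar>))"

text \<open>Extended expectation \<open>E f\<^sup>+ - E f\<^sup>-\<close>. The function \<open>e2ennreal\<close> maps negative
  values to 0, so the two integrals are those of the positive and the negative part. Since
  \<open>\<infinity> - \<infinity> = \<infinity>\<close> in \<^typ>\<open>ereal\<close>, the value is \<open>< \<infinity>\<close> if and only if
  \<open>E f\<^sup>+ < \<infinity>\<close>.\<close>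

definition ereal_expectation :: "'a measure \<Rightarrow> ('a \<Rightarrow> ereal) \<Rightarrow> ereal" where
  "ereal_expectation M f =
     enn2ereal (\<integral>\<^sup>+\<omega>. e2ennreal (f \<omega>) \<partial>M) - enn2ereal (\<integral>\<^sup>+\<omega>. e2ennreal (- f \<omega>) \<partial>M)"


subsection \<open>Stationary and ergodic processes\<close>

text \<open>The time index ranges over a type, here \<^typ>\<open>nat\<close> or \<^typ>\<open>int\<close>.\<close>

definition strictly_stationary ::
    "'a measure \<Rightarrow> 's measure \<Rightarrow> ('t::plus \<Rightarrow> 'a \<Rightarrow> 's) \<Rightarrow> bool" where
  "strictly_stationary M S X \<longleftrightarrow>
     (\<forall>t. X t \<in> measurable M S) \<and>
     (\<forall>h. distr M (\<Pi>\<^sub>M t\<in>UNIV. S) (\<lambda>\<omega> t. X (t + h) \<omega>)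
        = distr M (\<Pi>\<^sub>M t\<in>UNIV. S) (\<lambda>\<omega> t. X t \<omega>))"

definition ergodic_process ::
    "'a measure \<Rightarrow> 's measure \<Rightarrow> (nat \<Rightarrow> 'a \<Rightarrow> 's) \<Rightarrow> bool" where
  "ergodic_process M S X \<longleftrightarrow>
     strictly_stationary M S X \<and>
     (\<forall>A\<in>sets (\<Pi>\<^sub>M t\<in>UNIV. S).
        {x \<in> space (\<Pi>\<^sub>M t\<in>UNIV. S). (\<lambda>t. x (t + 1)) \<in> A} = A \<longrightarrow>
        measure M {\<omega> \<in> space M. (\<lambda>t. X t \<omega>) \<in> A} \<in> {0, 1})"

definition iid ::
    "'a measure \<Rightarrow> 's measure \<Rightarrow> ('t::zero \<Rightarrow> 'a \<Rightarrow> 's) \<Rightarrow> bool" where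
  "iid M S X \<longleftrightarrow>
     prob_space.indep_vars M (\<lambda>_. S) X UNIV \<and> (\<forall>t. distr M S (X t) = distr M S (X 0))"


subsection \<open>The EGARCH model\<close>

definition HE :: "real \<Rightarrow> real \<Rightarrow> real \<Rightarrow> real \<Rightarrow> real \<Rightarrow> real \<Rightarrow> real" where
  "HE \<alpha> \<beta> \<gamma> \<delta> y x = exp (\<alpha> + \<beta> * ln x + (\<gamma> * \<bar>y\<bar> + \<delta> * y) * x powr (-1/2))"

text \<open>A strictly stationary volatility process \<open>\<sigma>\<close>; the observations are
  \<open>y\<^sub>t = \<sigma>\<^sub>t \<epsilon>\<^sub>t\<close>. For \<open>\<bar>\<beta>\<bar> < 1\<close> at most one process satisfies this, up to null sets: iterate the
  recursion backwards, \<open>\<beta>\<^sup>k log \<sigma>\<^sup>2\<^sub>t\<^sub>-\<^sub>k\<close> tends to 0 in probability by stationarity.\<close>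

definition egarch_stationary ::
    "'a measure \<Rightarrow> real \<Rightarrow> real \<Rightarrow> real \<Rightarrow> real \<Rightarrow>
     (int \<Rightarrow> 'a \<Rightarrow> real) \<Rightarrow> (int \<Rightarrow> 'a \<Rightarrow> real) \<Rightarrow> bool" where
  "egarch_stationary M \<alpha> \<beta> \<gamma> \<delta> \<epsilon> \<sigma> \<longleftrightarrow>
     strictly_stationary M borel \<sigma> \<and>
     (\<forall>t. AE \<omega> in M. \<sigma> t \<omega> > 0 \<and>
        ln ((\<sigma> t \<omega>)\<^sup>2) = \<alpha> + \<gamma> * \<bar>\<epsilon> (t - 1) \<omega>\<bar> + \<delta> * \<epsilon> (t - 1) \<omega> + \<beta> * ln ((\<sigma> (t - 1) \<omega>)\<^sup>2))"

text \<open>The process \<open>\<sigma>hat\<^sup>2\<close>, computed from the observations and the starting point \<open>s2\<close>.\<close>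

primrec sigma_hat_sq ::
    "real \<Rightarrow> real \<Rightarrow> real \<Rightarrow> real \<Rightarrow> (int \<Rightarrow> 'a \<Rightarrow> real) \<Rightarrow> (int \<Rightarrow> 'a \<Rightarrow> real) \<Rightarrow>
     real \<Rightarrow> nat \<Rightarrow> 'a \<Rightarrow> real" where
  "sigma_hat_sq \<alpha> \<beta> \<gamma> \<delta> \<epsilon> \<sigma> s2 0 \<omega> = s2"
| "sigma_hat_sq \<alpha> \<beta> \<gamma> \<delta> \<epsilon> \<sigma> s2 (Suc t) \<omega> =
     HE \<alpha> \<beta> \<gamma> \<delta> (\<sigma> (int t) \<omega> * \<epsilon> (int t) \<omega>) (sigma_hat_sq \<alpha> \<beta> \<gamma> \<delta> \<epsilon> \<sigma> s2 t \<omega>)"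

text \<open>\<open>N\<close> is an enlargement of \<open>M\<close> with measure preserving projection \<open>p\<close>. Random variables
  on \<open>M\<close> live on \<open>N\<close> by composition with \<open>p\<close>.\<close>

definition extended_space :: "'a measure \<Rightarrow> 'b measure \<Rightarrow> ('b \<Rightarrow> 'a) \<Rightarrow> bool" where
  "extended_space M N p \<longleftrightarrow> prob_space N \<and> p \<in> measurable N M \<and> distr N M p = M"

text \<open>\<open>(U t, V t)\<close> stands for the pair of squared volatilities at time \<open>t\<close>, so that the volatility
  entering the observation is \<open>sqrt (U t)\<close>.\<close>

definition stationary_pair_solution ::
    "'a measure \<Rightarrow> real \<Rightarrow> real \<Rightarrow> real \<Rightarrow> real \<Rightarrow> (int \<Rightarrow> 'a \<Rightarrow> real) \<Rightarrow> (int \<Rightarrow> 'a \<Rightarrow> real) \<Rightarrow>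
     'b measure \<Rightarrow> ('b \<Rightarrow> 'a) \<Rightarrow> (nat \<Rightarrow> 'b \<Rightarrow> real) \<Rightarrow> (nat \<Rightarrow> 'b \<Rightarrow> real) \<Rightarrow> bool" where
  "stationary_pair_solution M \<alpha> \<beta> \<gamma> \<delta> \<epsilon> \<sigma> N p U V \<longleftrightarrow>
     extended_space M N p \<and>
     strictly_stationary N borel (\<lambda>t \<omega>. (U t \<omega>, V t \<omega>)) \<and>
     (\<forall>t. AE \<omega> in N. U t \<omega> > 0 \<and> V t \<omega> > 0) \<and>
     (\<forall>t. AE \<omega> in N.
        U (Suc t) \<omega> = HE \<alpha> \<beta> \<gamma> \<delta> (sqrt (U t \<omega>) * \<epsilon> (int t) (p \<omega>)) (U t \<omega>) \<and>
        V (Suc t) \<omega> = HE \<alpha> \<beta> \<gamma> \<delta> (sqrt (U t \<omega>) * \<epsilon> (int t) (p \<omega>)) (V t \<omega>)) \<and>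
     (\<forall>t. AE \<omega> in N. U t \<omega> = (\<sigma> (int t) (p \<omega>))\<^sup>2) \<and>
     prob_space.indep_set N
       (sets (vimage_algebra (space N) (\<lambda>\<omega>. (U 0 \<omega>, V 0 \<omega>)) borel))
       (sets (vimage_algebra (space N) (\<lambda>\<omega> t. \<epsilon> (int t) (p \<omega>))
          (\<Pi>\<^sub>M t\<in>(UNIV :: nat set). borel)))"

end

theory Submission
  imports Defs
begin

text \<open>Put \<open>a\<^sub>t = ln \<sigma>\<^sub>t\<^sup>2\<close>, \<open>d\<^sub>t = ln hat\<sigma>\<^sub>t\<^sup>2 - ln \<sigma>\<^sub>t\<^sup>2\<close> and \<open>w\<^sub>t = \<gamma> \<bar>\<epsilon>\<^sub>t\<bar> + \<delta> \<epsilon>\<^sub>t \<ge> 0\<close>. The two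
  recursions become the Markov chain \<open>a' = \<alpha> + \<beta> a + w\<close>, \<open>d' = \<beta> d - w (1 - exp (- d / 2))\<close>. The second
  component is autonomous, \<open>0\<close> is a fixed point of it, and the derivative there is \<open>\<beta> - w / 2\<close>; so
  \<open>lam\<close> is the Lyapunov exponent of the fixed point, that is, of the diagonal \<open>\<sigma>\<^sup>2 = hat\<sigma>\<^sup>2\<close>.

  Everything rests on one principle about iterated random functions, \<open>zero_one\<close>. For a shift-invariant
  event \<open>A\<close> of path space, the probability \<open>h x\<close> of \<open>A\<close> for the chain started in \<open>x\<close> is a harmonic
  function of \<open>x\<close>, and if \<open>h\<close> is bounded below by a positive constant on an absorbing set, then \<open>h = 1\<close>
  there: given the first \<open>n\<close> shocks, the complement of \<open>A\<close> always keeps conditional probability at most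
  \<open>1 - c\<close>, and it can be approximated by events of the first \<open>n\<close> shocks. A Foster drift condition
  reduces the lower bound to a compact set (\<open>harmonic_lower_bound\<close>), and on a compact set it suffices
  to have it near each point. A local lower bound at \<open>step x w\<close> pulls back to \<open>x\<close> as soon as \<open>w\<close> is in
  the support of the shock (\<open>bounded_below_near_step\<close>), so it is enough to steer to one good point.

  If \<open>lam < 0\<close>, take for \<open>A\<close> the event \<open>d\<^sub>t \<rightarrow> 0\<close>. Near \<open>d = 0\<close> a small power of \<open>\<bar>d\<bar>\<close> contracts in mean, so
  \<open>A\<close> has probability at least one half there. Shocks near \<open>0\<close> drive every \<open>d\<close> towards \<open>0\<close>, and
  \<open>ratio_size\<close>, logarithmic for positive and linear for negative \<open>d\<close>, is a Lyapunov function. Hence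
  \<open>d\<^sub>t \<rightarrow> 0\<close> almost surely, and the stationarity of \<open>\<sigma>\<^sub>t\<^sup>2\<close> turns this into convergence of the difference
  in probability.

  If \<open>lam > 0\<close>, the term \<open>- ln \<bar>d\<bar>\<close> has negative drift near \<open>0\<close>, and together with
  \<open>ratio_size\<close> and a multiple of \<open>\<bar>a\<bar>\<close> it gives a Lyapunov function whose level sets are compact off the
  diagonal. The distribution after two steps from points near
  \<open>(a, 1)\<close> dominates a multiple of Lebesgue measure on a fixed box, and every state with \<open>d \<noteq> 0\<close> can be
  steered to such a point by letting \<open>d\<close> alternate between \<open>1\<close> and \<open>-1\<close>. For any invariant \<open>A\<close>, either
  \<open>A\<close> or its complement has positive mean probability on the box, and so has probability 1 from
  every starting state with \<open>d \<noteq> 0\<close> (\<open>invariant_dichotomy\<close>). Applied to arbitrary \<open>A\<close> this is ergodicity.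
  Applied to the event that the averages of an indicator converge to the stationary probability,
  which has probability 1 under the stationary solution by Birkhoff's theorem, it gives the law of
  large numbers from every starting point, since \<open>ln \<sigma>\<^sub>0\<^sup>2\<close> has no atom and so \<open>d\<^sub>0 \<noteq> 0\<close> almost surely.

  The starting state must be independent of the future shocks. For the observed process this
  holds because \<open>ln \<sigma>\<^sub>0\<^sup>2\<close> is almost surely the sum of the series \<open>\<Sum>\<^sub>j \<beta>\<^sup>j (\<alpha> + w\<^sub>-\<^sub>1\<^sub>-\<^sub>j)\<close> of past shocks
  (\<open>level_eq_past\<close>); for the stationary pair it is part of the definition of a solution.\<close>

section \<open>Iterated random functions and their invariant events\<close>

lemma sets_Collect_tendsto:
  fixes f :: "nat \<Rightarrow> 'a \<Rightarrow> real"
  assumes [measurable]: "\<And>n. f n \<in> borel_measurable L"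
  shows "{x \<in> space L. (\<lambda>n. f n x) \<longlonglongrightarrow> c} \<in> sets L"
proof -
  have "((\<lambda>n. f n x) \<longlonglongrightarrow> c) \<longleftrightarrow> (\<forall>k::nat. \<exists>N. \<forall>n\<ge>N. \<bar>f n x - c\<bar> < inverse (real (Suc k)))" for x
  proof
    assume l: "(\<lambda>n. f n x) \<longlonglongrightarrow> c"
    show "\<forall>k::nat. \<exists>N. \<forall>n\<ge>N. \<bar>f n x - c\<bar> < inverse (real (Suc k))"
      using LIMSEQ_D[OF l, of "inverse (real (Suc k))" for k] by simp
  next
    assume *: "\<forall>k::nat. \<exists>N. \<forall>n\<ge>N. \<bar>f n x - c\<bar> < inverse (real (Suc k))"
    show "(\<lambda>n. f n x) \<longlonglongrightarrow> c"
    proof (rule LIMSEQ_I)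
      fix r :: real assume "0 < r"
      then obtain k where "inverse (real (Suc k)) < r" using reals_Archimedean by blast
      moreover obtain N where "\<forall>n\<ge>N. \<bar>f n x - c\<bar> < inverse (real (Suc k))" using * by blast
      ultimately show "\<exists>no. \<forall>n\<ge>no. norm (f n x - c) < r"
        by (intro exI[of _ N]) (auto intro: less_trans)
    qed
  qed
  then have "{x \<in> space L. (\<lambda>n. f n x) \<longlonglongrightarrow> c}
      = {x \<in> space L. \<forall>k::nat. \<exists>N. \<forall>n\<ge>N. \<bar>f n x - c\<bar> < inverse (real (Suc k))}" by simp
  also have "\<dots> \<in> sets L" by measurable
  finally show ?thesis .
qed

text \<open>The chain \<open>x\<^sub>n\<^sub>+\<^sub>1 = F x\<^sub>n w\<^sub>n\<close> driven by independent shocks with law \<open>W\<close>; the shock sequence is the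
  coordinate process on the product space \<open>S\<close>.\<close>

locale random_recursion = sequence_space W for W :: "'w measure" +
  fixes F :: "'s::topological_space \<Rightarrow> 'w \<Rightarrow> 's"
  assumes F_measurable [measurable]: "(\<lambda>(x, w). F x w) \<in> borel \<Otimes>\<^sub>M W \<rightarrow>\<^sub>M borel"
begin

abbreviation paths :: "(nat \<Rightarrow> 's) measure" where
  "paths \<equiv> \<Pi>\<^sub>M n\<in>(UNIV::nat set). borel"

primrec orbit :: "'s \<Rightarrow> (nat \<Rightarrow> 'w) \<Rightarrow> nat \<Rightarrow> 's" where
  "orbit x w 0 = x"
| "orbit x w (Suc n) = F (orbit x w n) (w n)"

definition avg :: "('s \<Rightarrow> ennreal) \<Rightarrow> 's \<Rightarrow> ennreal" where
  "avg f x = (\<integral>\<^sup>+w. f (F x w) \<partial>W)"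

definition path_prob :: "(nat \<Rightarrow> 's) set \<Rightarrow> 's \<Rightarrow> ennreal" where
  "path_prob A x = emeasure S {w \<in> space S. orbit x w \<in> A}"

lemma orbit_measurable_pair: "(\<lambda>(x, w). orbit x w n) \<in> borel \<Otimes>\<^sub>M S \<rightarrow>\<^sub>M borel"
proof (induction n)
  case (Suc n)
  note [measurable] = Suc
  have "(\<lambda>z. (\<lambda>(x, w). F x w) (orbit (fst z) (snd z) n, snd z n)) \<in> borel \<Otimes>\<^sub>M S \<rightarrow>\<^sub>M borel"
    by (rule measurable_compose[OF _ F_measurable]) (use Suc in \<open>simp add: split_beta'\<close>)
  then show ?case by (simp add: split_beta')
qed simp

lemma orbit_measurable [measurable (raw)]:
  assumes "f \<in> L \<rightarrow>\<^sub>M borel" "g \<in> L \<rightarrow>\<^sub>M S"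
  shows "(\<lambda>z. orbit (f z) (g z) n) \<in> L \<rightarrow>\<^sub>M borel"
  using measurable_compose[OF measurable_Pair[OF assms] orbit_measurable_pair] by simp

lemma orbit_path_measurable [measurable (raw)]:
  assumes "f \<in> L \<rightarrow>\<^sub>M borel" "g \<in> L \<rightarrow>\<^sub>M S"
  shows "(\<lambda>z. orbit (f z) (g z)) \<in> L \<rightarrow>\<^sub>M paths"
proof -
  have "(\<lambda>z. \<lambda>n\<in>UNIV. orbit (f z) (g z) n) \<in> L \<rightarrow>\<^sub>M paths"
    by (intro measurable_restrict orbit_measurable assms)
  then show ?thesis by (simp add: restrict_UNIV)
qed

lemma avg_measurable [measurable]:
  assumes [measurable]: "f \<in> borel_measurable borel"
  shows "avg f \<in> borel_measurable borel"
proof -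
  have "(\<lambda>z. f ((\<lambda>(x, w). F x w) z)) \<in> borel_measurable (borel \<Otimes>\<^sub>M W)"
    by (intro measurable_compose[OF F_measurable]) simp
  then have "(\<lambda>x. \<integral>\<^sup>+w. f (F x w) \<partial>W) \<in> borel_measurable borel"
    by (intro M.borel_measurable_nn_integral) (simp add: split_beta')
  then show ?thesis by (simp add: avg_def[abs_def])
qed

lemma path_prob_eq:
  assumes [measurable]: "A \<in> sets paths"
  shows "path_prob A x = (\<integral>\<^sup>+w. indicator A (orbit x w) \<partial>S)"
proof -
  have "path_prob A x = (\<integral>\<^sup>+w. indicator {w \<in> space S. orbit x w \<in> A} w \<partial>S)"
    unfolding path_prob_def by (subst nn_integral_indicator) auto
  also have "\<dots> = (\<integral>\<^sup>+w. indicator A (orbit x w) \<partial>S)"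
    by (intro nn_integral_cong) (auto simp: indicator_def)
  finally show ?thesis .
qed

lemma path_prob_measurable [measurable]:
  assumes A [measurable]: "A \<in> sets paths"
  shows "path_prob A \<in> borel_measurable borel"
proof -
  have "(\<lambda>x. \<integral>\<^sup>+w. indicator A (orbit x w) \<partial>S) \<in> borel_measurable borel"
    by (intro P.borel_measurable_nn_integral) simp
  then show ?thesis by (simp add: path_prob_eq[OF A, abs_def])
qed

lemma orbit_case_nat: "orbit x (case_nat s w) (Suc n) = orbit (F x s) w n"
  by (induction n) auto

lemma orbit_comb_seq_less: "m \<le> n \<Longrightarrow> orbit x (comb_seq n w w') m = orbit x w m"
  by (induction m) (auto simp: comb_seq_def)

lemma orbit_comb_seq: "orbit x (comb_seq n w w') (k + n) = orbit (orbit x w n) w' k"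
proof (induction k)
  case 0
  then show ?case by (simp add: orbit_comb_seq_less)
next
  case (Suc k)
  then show ?case by (simp add: comb_seq_def)
qed

text \<open>Invariance is needed for all paths, not only almost surely: the same event is used for
  different starting points.\<close>

definition shift_invariant :: "(nat \<Rightarrow> 's) set \<Rightarrow> bool" where
  "shift_invariant A \<longleftrightarrow> (\<forall>y. (\<lambda>n. y (Suc n)) \<in> A \<longleftrightarrow> y \<in> A)"

lemma shift_invariant_add:
  assumes "shift_invariant A"
  shows "(\<lambda>k. y (k + n)) \<in> A \<longleftrightarrow> y \<in> A"
proof (induction n)
  case (Suc n)
  have "(\<lambda>k. y (k + Suc n)) \<in> A \<longleftrightarrow> (\<lambda>k. y (k + n)) \<in> A"
    using assms[unfolded shift_invariant_def, rule_format, of "\<lambda>k. y (k + n)"] by simp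
  with Suc show ?case by simp
qed simp

text \<open>Condition on the first shock; by invariance of \<open>A\<close> the remaining path decides.\<close>

lemma path_prob_harmonic:
  assumes [measurable]: "A \<in> sets paths" and inv: "shift_invariant A"
  shows "avg (path_prob A) = path_prob A"
proof
  fix x
  have "path_prob A x = (\<integral>\<^sup>+w. indicator A (orbit x w) \<partial>distr (W \<Otimes>\<^sub>M S) S (\<lambda>(s, w). case_nat s w))"
    by (simp add: path_prob_eq PiM_iter)
  also have "\<dots> = (\<integral>\<^sup>+z. indicator A (orbit x (case_nat (fst z) (snd z))) \<partial>(W \<Otimes>\<^sub>M S))"
    by (subst nn_integral_distr) (auto simp: split_beta')
  also have "\<dots> = (\<integral>\<^sup>+z. indicator A (orbit (F x (fst z)) (snd z)) \<partial>(W \<Otimes>\<^sub>M S))"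
  proof (intro nn_integral_cong)
    fix z
    have "orbit x (case_nat (fst z) (snd z)) \<in> A \<longleftrightarrow> orbit (F x (fst z)) (snd z) \<in> A"
      using inv[unfolded shift_invariant_def, rule_format, of "orbit x (case_nat (fst z) (snd z))"]
      unfolding orbit_case_nat by blast
    then show "indicator A (orbit x (case_nat (fst z) (snd z))) = (indicator A (orbit (F x (fst z)) (snd z)) :: ennreal)"
      by (auto simp: indicator_def)
  qed
  also have "\<dots> = (\<integral>\<^sup>+s. \<integral>\<^sup>+w. indicator A (orbit (F x s) w) \<partial>S \<partial>W)"
    by (subst P.nn_integral_fst[symmetric]) auto
  also have "\<dots> = avg (path_prob A) x"
    by (simp add: avg_def path_prob_eq)
  finally show "avg (path_prob A) x = path_prob A x" by simp
qed

lemma path_prob_compl: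
  assumes [measurable]: "A \<in> sets paths"
  shows "path_prob A x + path_prob (- A) x = 1"
proof -
  have [measurable]: "- A \<in> sets paths"
    using sets.compl_sets[OF assms] by (simp add: space_PiM PiE_def Compl_eq_Diff_UNIV)
  have "path_prob A x + path_prob (- A) x
      = emeasure S ({w \<in> space S. orbit x w \<in> A} \<union> {w \<in> space S. orbit x w \<in> - A})"
    unfolding path_prob_def by (intro plus_emeasure) auto
  also have "{w \<in> space S. orbit x w \<in> A} \<union> {w \<in> space S. orbit x w \<in> - A} = space S"
    by auto
  finally show ?thesis by (simp add: P.emeasure_space_1)
qed

text \<open>Events of the first \<open>n\<close> shocks. Restricting to sequences in \<open>space S\<close> lets complements be
  taken inside \<open>space S\<close>.\<close>

definition determined_by :: "nat \<Rightarrow> (nat \<Rightarrow> 'w) set \<Rightarrow> bool" where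
  "determined_by n R \<longleftrightarrow> (\<forall>w w'. (\<forall>i<n. w i = w' i) \<longrightarrow> w \<in> space S \<longrightarrow> w' \<in> space S \<longrightarrow> w \<in> R \<longleftrightarrow> w' \<in> R)"

lemma determined_by_mono: "determined_by n R \<Longrightarrow> n \<le> m \<Longrightarrow> determined_by m R"
  unfolding determined_by_def by (meson order_less_le_trans)

definition approximable :: "(nat \<Rightarrow> 'w) set \<Rightarrow> bool" where
  "approximable Q \<longleftrightarrow> (\<forall>e>0. \<exists>n R. R \<in> sets S \<and> determined_by n R \<and> measure S (sym_diff Q R) < e)"

lemma approximable_UN:
  fixes Q :: "nat \<Rightarrow> (nat \<Rightarrow> 'w) set"
  assumes [measurable]: "\<And>i. Q i \<in> sets S" and Q: "\<And>i. approximable (Q i)"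
  shows "approximable (\<Union>i. Q i)"
  unfolding approximable_def
proof (intro allI impI)
  fix e :: real assume e: "0 < e"
  have "(\<lambda>n. measure S (\<Union>i<n. Q i)) \<longlonglongrightarrow> measure S (\<Union>n. \<Union>i<n. Q i)"
    by (intro P.finite_Lim_measure_incseq) (auto simp: incseq_def intro: less_le_trans)
  moreover have "(\<Union>n. \<Union>i<n. Q i) = (\<Union>i. Q i)" by auto
  ultimately have "(\<lambda>n. measure S (\<Union>i<n. Q i)) \<longlonglongrightarrow> measure S (\<Union>i. Q i)" by simp
  from LIMSEQ_D[OF this, of "e/2"] e obtain N where
    N: "norm (measure S (\<Union>i<N. Q i) - measure S (\<Union>i. Q i)) < e / 2" by auto
  have tail: "measure S ((\<Union>i. Q i) - (\<Union>i<N. Q i)) < e / 2"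
  proof -
    have "measure S ((\<Union>i. Q i) - (\<Union>i<N. Q i)) = measure S (\<Union>i. Q i) - measure S (\<Union>i<N. Q i)"
      by (intro P.finite_measure_Diff) auto
    moreover have "measure S (\<Union>i. Q i) - measure S (\<Union>i<N. Q i) < e / 2"
      using N unfolding real_norm_def abs_less_iff by linarith
    ultimately show ?thesis by linarith
  qed
  have "\<forall>i. \<exists>n R. R \<in> sets S \<and> determined_by n R \<and> measure S (sym_diff (Q i) R) < e / (2 * (N + 1))"
    using Q e unfolding approximable_def by simp
  then obtain n R where R: "\<And>i. R i \<in> sets S" "\<And>i. determined_by (n i) (R i)"
    "\<And>i. measure S (sym_diff (Q i) (R i)) < e / (2 * (N + 1))" by metis
  note [measurable] = R(1)
  have det: "determined_by (Max (n ` {..N})) (\<Union>i<N. R i)"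
  proof -
    have "determined_by (Max (n ` {..N})) (R i)" if "i < N" for i
      using R(2)[of i] by (rule determined_by_mono) (use that in auto)
    then show ?thesis unfolding determined_by_def by (metis (no_types, lifting) UN_iff lessThan_iff)
  qed
  have "measure S (sym_diff (\<Union>i. Q i) (\<Union>i<N. R i))
      \<le> measure S (((\<Union>i. Q i) - (\<Union>i<N. Q i)) \<union> (\<Union>i<N. sym_diff (Q i) (R i)))"
    by (intro P.finite_measure_mono) auto
  also have "\<dots> \<le> measure S ((\<Union>i. Q i) - (\<Union>i<N. Q i)) + measure S (\<Union>i<N. sym_diff (Q i) (R i))"
    by (intro measure_Un_le) auto
  also have "measure S (\<Union>i<N. sym_diff (Q i) (R i)) \<le> (\<Sum>i<N. measure S (sym_diff (Q i) (R i)))"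
    by (intro measure_UNION_le) auto
  also have "\<dots> \<le> (\<Sum>i<N. e / (2 * (N + 1)))"
    by (intro sum_mono less_imp_le R)
  also have "\<dots> \<le> e / 2" using e by (simp add: field_simps)
  finally have "measure S (sym_diff (\<Union>i. Q i) (\<Union>i<N. R i)) < e" using tail by linarith
  then show "\<exists>n R. R \<in> sets S \<and> determined_by n R \<and> measure S (sym_diff (\<Union>i. Q i) R) < e"
    using det by (intro exI[of _ "Max (n ` {..N})"] exI[of _ "\<Union>i<N. R i"]) auto
qed

text \<open>The approximable sets form a \<open>\<sigma>\<close>-algebra, which contains the coordinate sets.\<close>

lemma approximable_sets:
  assumes "Q \<in> sets S"
  shows "approximable Q"
proof -
  let ?G = "{{f \<in> \<Pi>\<^sub>E i\<in>(UNIV::nat set). space W. f i \<in> A} |i A. i \<in> UNIV \<and> A \<in> sets W}"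
  have S_eq: "sets S = sigma_sets (\<Pi>\<^sub>E i\<in>(UNIV::nat set). space W) ?G"
    by (rule sets_PiM_single)
  have "Q \<in> sigma_sets (\<Pi>\<^sub>E i\<in>(UNIV::nat set). space W) ?G" using assms S_eq by simp
  then have "Q \<in> sets S \<and> approximable Q"
  proof induction
    case (Basic a)
    then obtain i A where a: "a = {f \<in> space S. f i \<in> A}" and [measurable]: "A \<in> sets W"
      by (auto simp: space_PiM)
    have "a \<in> sets S" unfolding a by measurable
    moreover have "determined_by (Suc i) a" unfolding determined_by_def a by auto
    ultimately show ?case unfolding approximable_def by (metis Diff_cancel Un_empty measure_empty)
  next
    case Empty
    have "determined_by 0 {}" by (simp add: determined_by_def)
    then show ?case unfolding approximable_def by (metis Diff_cancel Un_empty measure_empty sets.empty_sets)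
  next
    case (Compl a)
    have sp: "(\<Pi>\<^sub>E i\<in>(UNIV::nat set). space W) = space S" by (simp add: space_PiM)
    have "approximable (space S - a)"
      unfolding approximable_def
    proof (intro allI impI)
      fix e :: real assume "0 < e"
      then obtain n R where R: "R \<in> sets S" "determined_by n R" "measure S (sym_diff a R) < e"
        using Compl unfolding approximable_def by blast
      have "sym_diff (space S - a) (space S - R) = sym_diff a R"
        using Compl R(1) sets.sets_into_space by blast
      moreover have "determined_by n (space S - R)" using R(2) unfolding determined_by_def by blast
      ultimately show "\<exists>n R. R \<in> sets S \<and> determined_by n R \<and> measure S (sym_diff (space S - a) R) < e"
        using R by (intro exI[of _ n] exI[of _ "space S - R"]) auto
    qed
    then show ?case unfolding sp using Compl by auto
  next
    case (Union a)
    then show ?case by (auto intro: approximable_UN)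
  qed
  then show ?thesis ..
qed

text \<open>The Markov property at time \<open>n\<close>: splice the first \<open>n\<close> shocks with an independent shock sequence.\<close>

lemma cylinder_inter:
  assumes A [measurable]: "A \<in> sets paths" and inv: "shift_invariant A"
    and R [measurable]: "R \<in> sets S" and det: "determined_by n R"
  shows "emeasure S ({w \<in> space S. orbit x w \<in> A} \<inter> R)
    = (\<integral>\<^sup>+w. indicator R w * path_prob A (orbit x w n) \<partial>S)"
proof -
  have "emeasure S ({w \<in> space S. orbit x w \<in> A} \<inter> R)
      = (\<integral>\<^sup>+w. indicator ({w \<in> space S. orbit x w \<in> A} \<inter> R) w \<partial>S)"
    by (subst nn_integral_indicator) auto
  also have "\<dots> = (\<integral>\<^sup>+w. indicator R w * indicator A (orbit x w) \<partial>S)"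
    by (intro nn_integral_cong) (auto simp: indicator_def)
  also have "\<dots> = (\<integral>\<^sup>+w. indicator R w * indicator A (orbit x w)
      \<partial>distr (S \<Otimes>\<^sub>M S) S (\<lambda>(w, w'). comb_seq n w w'))"
    by (simp add: PiM_comb_seq)
  also have "\<dots> = (\<integral>\<^sup>+z. indicator R (comb_seq n (fst z) (snd z)) *
      indicator A (orbit x (comb_seq n (fst z) (snd z))) \<partial>(S \<Otimes>\<^sub>M S))"
    by (subst nn_integral_distr) (auto simp: split_beta')
  also have "\<dots> = (\<integral>\<^sup>+z. indicator R (fst z) * indicator A (orbit (orbit x (fst z) n) (snd z)) \<partial>(S \<Otimes>\<^sub>M S))"
  proof (intro nn_integral_cong)
    fix z assume z: "z \<in> space (S \<Otimes>\<^sub>M S)"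
    then have sp: "fst z \<in> space S" "snd z \<in> space S" by (auto simp: space_pair_measure)
    have "comb_seq n (fst z) (snd z) \<in> space S"
      using sp by (auto simp: space_PiM PiE_iff comb_seq_def)
    then have "comb_seq n (fst z) (snd z) \<in> R \<longleftrightarrow> fst z \<in> R"
      using det[unfolded determined_by_def, rule_format, of "comb_seq n (fst z) (snd z)" "fst z"] sp
      by (auto simp: comb_seq_less)
    moreover have "orbit x (comb_seq n (fst z) (snd z)) \<in> A \<longleftrightarrow> orbit (orbit x (fst z) n) (snd z) \<in> A"
      using shift_invariant_add[OF inv, of "orbit x (comb_seq n (fst z) (snd z))" n]
      by (simp add: orbit_comb_seq)
    ultimately show "indicator R (comb_seq n (fst z) (snd z)) * indicator A (orbit x (comb_seq n (fst z) (snd z)))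
      = (indicator R (fst z) * indicator A (orbit (orbit x (fst z) n) (snd z)) :: ennreal)"
      by (auto simp: indicator_def)
  qed
  also have "\<dots> = (\<integral>\<^sup>+w. \<integral>\<^sup>+w'. indicator R w * indicator A (orbit (orbit x w n) w') \<partial>S \<partial>S)"
    by (subst P.nn_integral_fst[symmetric]) auto
  also have "\<dots> = (\<integral>\<^sup>+w. indicator R w * path_prob A (orbit x w n) \<partial>S)"
    by (intro nn_integral_cong) (simp add: path_prob_eq nn_integral_cmult)
  finally show ?thesis .
qed

text \<open>Let \<open>H\<close> be the event that the orbit of \<open>x\<close> is outside \<open>A\<close>. The bound \<open>P(H \<inter> R) \<le> (1 - c) P(R)\<close> holds
  for every event \<open>R\<close> of finitely many shocks, by conditioning on these shocks. Since such events
  approximate \<open>H\<close> itself, it holds for \<open>R = H\<close> and forces \<open>P(H) = 0\<close>.\<close>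

lemma zero_one:
  assumes A [measurable]: "A \<in> sets paths" and inv: "shift_invariant A"
    and c: "0 < c" and lower: "\<And>y. y \<in> E \<Longrightarrow> ennreal c \<le> path_prob A y"
    and absorbing: "\<And>n. AE w in S. orbit x w n \<in> E"
  shows "path_prob A x = 1"
proof -
  have mA [measurable]: "- A \<in> sets paths"
    using sets.compl_sets[OF A] by (simp add: space_PiM PiE_def Compl_eq_Diff_UNIV)
  have invc: "shift_invariant (- A)" using inv by (auto simp: shift_invariant_def)
  define H where "H = {w \<in> space S. orbit x w \<in> - A}"
  have [measurable]: "H \<in> sets S" unfolding H_def by measurable
  have le: "measure S (H \<inter> R) \<le> (1 - c) * measure S R" if R [measurable]: "R \<in> sets S" and "determined_by n R" for n R
  proof -
    have "emeasure S (H \<inter> R) + ennreal c * emeasure S R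
        = (\<integral>\<^sup>+w. indicator R w * path_prob (- A) (orbit x w n) \<partial>S) + (\<integral>\<^sup>+w. ennreal c * indicator R w \<partial>S)"
      unfolding H_def by (subst cylinder_inter[OF mA invc R that(2)]) (simp add: nn_integral_cmult)
    also have "\<dots> = (\<integral>\<^sup>+w. indicator R w * path_prob (- A) (orbit x w n) + ennreal c * indicator R w \<partial>S)"
      by (subst nn_integral_add) auto
    also have "\<dots> \<le> (\<integral>\<^sup>+w. indicator R w \<partial>S)"
    proof (intro nn_integral_mono_AE)
      show "AE w in S. indicator R w * path_prob (- A) (orbit x w n) + ennreal c * indicator R w \<le> indicator R w"
        using absorbing[of n]
      proof eventually_elim
        case (elim w)
        have "path_prob (- A) (orbit x w n) + ennreal c \<le> path_prob (- A) (orbit x w n) + path_prob A (orbit x w n)"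
          using lower[OF elim] by (intro add_left_mono)
        also have "\<dots> = 1" using path_prob_compl[OF A, of "orbit x w n"] by (simp add: add.commute)
        finally show ?case by (auto simp: indicator_def)
      qed
    qed
    also have "\<dots> = emeasure S R" by simp
    finally have "ennreal (measure S (H \<inter> R) + c * measure S R) \<le> ennreal (measure S R)"
      using c by (simp add: P.emeasure_eq_measure ennreal_mult)
    then have "measure S (H \<inter> R) + c * measure S R \<le> measure S R"
      by (simp add: ennreal_le_iff)
    then show ?thesis by (simp add: algebra_simps)
  qed
  have "c * measure S H \<le> 0 + e" if e: "e > 0" for e
  proof -
    obtain n R where R [measurable]: "R \<in> sets S" and det: "determined_by n R"
      and close: "measure S (sym_diff H R) < e / (2 + c)"
      using approximable_sets[of H] e c unfolding approximable_def by (metis \<open>H \<in> sets S\<close> add_pos_pos divide_pos_pos zero_less_numeral)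
    let ?d = "measure S (sym_diff H R)"
    have "measure S H \<le> measure S ((H \<inter> R) \<union> sym_diff H R)"
      by (intro P.finite_measure_mono) auto
    also have "\<dots> \<le> measure S (H \<inter> R) + ?d" by (intro measure_Un_le) auto
    finally have 1: "measure S H \<le> measure S (H \<inter> R) + ?d" .
    have "measure S R \<le> measure S (H \<union> sym_diff H R)"
      by (intro P.finite_measure_mono) auto
    also have "\<dots> \<le> measure S H + ?d" by (intro measure_Un_le) auto
    finally have 2: "measure S R \<le> measure S H + ?d" .
    have "H \<subseteq> R \<union> sym_diff H R" by auto
    then have "measure S H \<le> measure S (R \<union> sym_diff H R)"
      by (intro P.finite_measure_mono) auto
    also have "\<dots> \<le> measure S R + ?d" by (intro measure_Un_le) auto
    finally have 3: "c * measure S H \<le> c * (measure S R + ?d)" using c by (intro mult_left_mono) auto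
    have "measure S H + c * measure S H \<le> (1 - c) * measure S R + ?d + c * (measure S R + ?d)"
      using 1 le[OF R det] 3 by linarith
    also have "\<dots> = measure S R + (1 + c) * ?d" by (simp add: algebra_simps)
    also have "\<dots> \<le> measure S H + (2 + c) * ?d" using 2 by (simp add: algebra_simps)
    finally have "c * measure S H \<le> (2 + c) * ?d" by simp
    also have "\<dots> \<le> (2 + c) * (e / (2 + c))" using close c by (intro mult_left_mono) auto
    also have "\<dots> = e" using c by simp
    finally show ?thesis by simp
  qed
  then have "c * measure S H \<le> 0" using field_le_epsilon by blast
  then have "measure S H = 0" using c by (simp add: mult_le_0_iff measure_le_0_iff)
  then have "path_prob (- A) x = 0" unfolding path_prob_def H_def by (simp add: P.emeasure_eq_measure)
  then show ?thesis using path_prob_compl[OF A, of x] by simp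
qed

section \<open>Foster drift condition and harmonic functions\<close>

lemma avg_mono: "(\<And>x. f x \<le> g x) \<Longrightarrow> avg f x \<le> avg g x"
  unfolding avg_def by (intro nn_integral_mono) auto

lemma avg_iter_mono: "(\<And>x. f x \<le> g x) \<Longrightarrow> (avg ^^ n) f x \<le> (avg ^^ n) g x"
  by (induction n arbitrary: x) (auto intro: avg_mono)

lemma avg_iter_measurable [measurable]: "f \<in> borel_measurable borel \<Longrightarrow> (avg ^^ n) f \<in> borel_measurable borel"
  by (induction n) auto

lemma avg_add:
  assumes [measurable]: "f \<in> borel_measurable borel" "g \<in> borel_measurable borel"
  shows "avg (\<lambda>x. f x + g x) = (\<lambda>x. avg f x + avg g x)"
  unfolding avg_def by (intro ext nn_integral_add) auto

lemma avg_cmult: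
  assumes [measurable]: "f \<in> borel_measurable borel"
  shows "avg (\<lambda>x. c * f x) = (\<lambda>x. c * avg f x)"
  unfolding avg_def by (intro ext nn_integral_cmult) auto

lemma avg_const: "avg (\<lambda>x. c) = (\<lambda>x. c)"
  by (simp add: avg_def fun_eq_iff M.emeasure_space_1)

text \<open>Iterate the drift inequality: the potential pays \<open>k\<close> in each step and gets back at most \<open>b\<close> for
  each visit to \<open>C\<close>.\<close>

lemma avg_iter_drift:
  assumes [measurable]: "V \<in> borel_measurable borel" "C \<in> sets borel"
    and drift: "\<And>x. avg V x + k \<le> V x + b * indicator C x"
  shows "(avg ^^ n) V x + of_nat n * k \<le> V x + b * (\<Sum>i<n. (avg ^^ i) (indicator C) x)"
proof (induction n arbitrary: x)
  case (Suc n)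
  have m [measurable]: "(\<lambda>x. \<Sum>i<n. (avg ^^ i) (indicator C) x) \<in> borel_measurable borel" by measurable
  have "avg (\<lambda>x. (avg ^^ n) V x + of_nat n * k) x
      \<le> avg (\<lambda>x. V x + b * (\<Sum>i<n. (avg ^^ i) (indicator C) x)) x"
    using Suc by (rule avg_mono)
  then have "(avg ^^ Suc n) V x + of_nat n * k
      \<le> avg V x + b * avg (\<lambda>x. \<Sum>i<n. (avg ^^ i) (indicator C) x) x"
    by (simp add: avg_add avg_cmult avg_const)
  also have "avg (\<lambda>x. \<Sum>i<n. (avg ^^ i) (indicator C) x) x = (\<Sum>i<n. (avg ^^ Suc i) (indicator C) x)"
    unfolding avg_def[of "\<lambda>x. \<Sum>i<n. (avg ^^ i) (indicator C) x"]
    by (subst nn_integral_sum) (auto simp: avg_def)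
  finally have "(avg ^^ Suc n) V x + of_nat n * k + k
      \<le> (avg V x + k) + b * (\<Sum>i<n. (avg ^^ Suc i) (indicator C) x)"
    by (simp add: add_ac add_left_mono)
  also have "\<dots> \<le> V x + b * indicator C x + b * (\<Sum>i<n. (avg ^^ Suc i) (indicator C) x)"
    by (intro add_right_mono drift)
  also have "\<dots> = V x + b * (\<Sum>i<Suc n. (avg ^^ i) (indicator C) x)"
    by (simp add: sum.lessThan_Suc_shift distrib_left add_ac del: sum.lessThan_Suc)
  finally show ?case by (simp add: distrib_right add_ac)
qed simp

text \<open>Because \<open>V\<close> cannot become negative, the chain visits \<open>C\<close> with average frequency at least about \<open>k / b\<close>, so
  at some time it is in \<open>C\<close> with probability at least \<open>k / (2 b)\<close>, and \<open>h\<close> is its own mean at that time.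
  The time depends on the starting point, but the bound does not. States that the chain has to
  avoid are excluded by giving \<open>V\<close> the value \<open>\<infinity>\<close> there.\<close>

lemma harmonic_lower_bound:
  fixes k b c :: real
  assumes V [measurable]: "V \<in> borel_measurable borel" and C [measurable]: "C \<in> sets borel"
    and drift: "\<And>x. avg V x + ennreal k \<le> V x + ennreal b * indicator C x"
    and k: "0 < k" and b: "0 < b" and c: "0 < c"
    and harmonic: "avg h = h" and lower: "\<And>x. x \<in> C \<Longrightarrow> ennreal c \<le> h x"
    and fin: "V x < \<infinity>"
  shows "ennreal (c * k / (2 * b)) \<le> h x"
proof (rule ccontr)
  assume neg: "\<not> ?thesis"
  obtain v where v: "V x = ennreal v" "0 \<le> v" using fin by (cases "V x") auto
  have iter: "(avg ^^ i) h = h" for i by (induction i) (auto simp: harmonic)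
  have vis: "(avg ^^ i) (indicator C) x \<le> ennreal (k / (2 * b))" for i
  proof -
    have "ennreal c * (avg ^^ i) (indicator C) x = (avg ^^ i) (\<lambda>x. ennreal c * indicator C x) x"
    proof (induction i arbitrary: x)
      case (Suc i)
      have "avg ((avg ^^ i) (\<lambda>x. ennreal c * indicator C x)) x = avg (\<lambda>x. ennreal c * (avg ^^ i) (indicator C) x) x"
        using Suc by (metis ext)
      then show ?case by (simp add: avg_cmult)
    qed simp
    also have "\<dots> \<le> (avg ^^ i) h x"
      by (intro avg_iter_mono) (use lower in \<open>auto simp: indicator_def\<close>)
    also have "\<dots> \<le> ennreal (c * (k / (2 * b)))" using neg by (simp add: iter)
    also have "\<dots> = ennreal c * ennreal (k / (2 * b))" using c k b by (subst ennreal_mult[symmetric]) auto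
    finally show ?thesis using c
      by (subst (asm) ennreal_mult_le_mult_iff) (simp_all add: ennreal_eq_0_iff)
  qed
  obtain n :: nat where n: "real n * (k / 2) > v" using k
    by (metis half_gt_zero reals_Archimedean3)
  have "ennreal (real n * k) \<le> (avg ^^ n) V x + of_nat n * ennreal k"
    using k by (simp add: ennreal_mult ennreal_of_nat_eq_real_of_nat)
  also have "\<dots> \<le> ennreal v + ennreal b * (\<Sum>i<n. (avg ^^ i) (indicator C) x)"
    using avg_iter_drift[OF V C drift, of n x] v by simp
  also have "\<dots> \<le> ennreal v + ennreal b * (\<Sum>i<n. ennreal (k / (2 * b)))"
    by (intro add_left_mono mult_left_mono sum_mono vis) auto
  also have "\<dots> = ennreal (v + real n * (k / 2))"
    using k b v(2) by (simp add: ennreal_mult'[symmetric] ennreal_of_nat_eq_real_of_nat ennreal_plus[symmetric] del: ennreal_plus)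
  finally have "real n * k \<le> v + real n * (k / 2)"
    using k v(2) by (subst (asm) ennreal_le_iff) auto
  then show False using n by (simp add: field_simps)
qed

end

section \<open>Birkhoff theorem for bounded observables\<close>

text \<open>The maximum of \<open>0\<close> and the first \<open>n\<close> partial sums of \<open>a\<close>, in the recursive form that the
  maximal ergodic theorem uses.\<close>

fun run_max :: "(nat \<Rightarrow> real) \<Rightarrow> nat \<Rightarrow> real" where
  "run_max a 0 = 0"
| "run_max a (Suc n) = max 0 (a 0 + run_max (\<lambda>k. a (Suc k)) n)"

lemma run_max_ge: "k \<le> n \<Longrightarrow> (\<Sum>i<k. a i) \<le> run_max a n"
proof (induction n arbitrary: a k)
  case (Suc n)
  show ?case
  proof (cases k)
    case (Suc j)
    have "(\<Sum>i<j. a (Suc i)) \<le> run_max (\<lambda>k. a (Suc k)) n" using Suc Suc.IH[of j "\<lambda>k. a (Suc k)"] Suc.prems by simp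
    then show ?thesis by (simp add: Suc sum.lessThan_Suc_shift del: sum.lessThan_Suc)
  qed simp
qed simp

lemma run_max_nonneg: "0 \<le> run_max a n"
  by (cases n) auto

lemma run_max_Suc_ge: "run_max a n \<le> run_max a (Suc n)"
proof (induction n arbitrary: a)
  case (Suc n)
  from Suc[of "\<lambda>k. a (Suc k)"] show ?case by simp
qed simp

lemma run_max_bound: "(\<And>i. \<bar>a i\<bar> \<le> c) \<Longrightarrow> run_max a n \<le> real n * c"
proof (induction n arbitrary: a)
  case (Suc n)
  have "run_max (\<lambda>k. a (Suc k)) n \<le> real n * c" by (rule Suc.IH) (rule Suc.prems)
  moreover have "\<bar>a 0\<bar> \<le> c" by (rule Suc.prems)
  moreover have "0 \<le> real n * c" using Suc.prems[of 0] by simp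
  ultimately show ?case by (simp add: distrib_right)
qed simp

lemma run_max_measurable:
  "(\<And>i. (\<lambda>w. a w i) \<in> borel_measurable M) \<Longrightarrow> (\<lambda>w. run_max (a w) n) \<in> borel_measurable M"
proof (induction n arbitrary: a)
  case (Suc n)
  have "(\<lambda>w. run_max (\<lambda>k. a w (Suc k)) n) \<in> borel_measurable M" by (rule Suc.IH) (rule Suc.prems)
  with Suc.prems[of 0] show ?case by simp
qed simp

lemma run_max_pos:
  assumes "k \<le> n" "0 < (\<Sum>i<k. a i)" shows "0 < run_max a n"
  using run_max_ge[OF assms(1), of a] assms(2) by linarith

text \<open>Garsia's argument. Where the running maximum \<open>R\<^sub>n\<close> is positive it is at most \<open>Y\<^sub>0\<close> plus the running
  maximum of the shifted sequence, and elsewhere it is \<open>0\<close>. By stationarity the two maxima have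
  the same mean, so \<open>Y\<^sub>0\<close> has nonnegative mean on \<open>{R\<^sub>n > 0}\<close>, and these events increase to the whole
  space.\<close>

lemma (in prob_space) maximal_ergodic:
  fixes Y :: "nat \<Rightarrow> 'a \<Rightarrow> real"
  assumes Y [measurable]: "\<And>n. Y n \<in> borel_measurable M" and bound: "\<And>n w. \<bar>Y n w\<bar> \<le> c"
    and stat: "\<And>n. expectation (\<lambda>w. run_max (\<lambda>k. Y (Suc k) w) n) = expectation (\<lambda>w. run_max (\<lambda>k. Y k w) n)"
    and pos: "AE w in M. \<exists>n. 0 < (\<Sum>i<n. Y i w)"
  shows "0 \<le> expectation (Y 0)"
proof -
  let ?R = "\<lambda>n w. run_max (\<lambda>k. Y k w) n" and ?R' = "\<lambda>n w. run_max (\<lambda>k. Y (Suc k) w) n"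
  have c: "0 \<le> c" using bound[of 0 undefined] by linarith
  have int: "integrable M (?R n)" "integrable M (?R' n)" for n
  proof -
    have "norm (?R n w) \<le> real n * c" "norm (?R' n w) \<le> real n * c" for w
      using run_max_bound[of "\<lambda>k. Y k w" c n] run_max_bound[of "\<lambda>k. Y (Suc k) w" c n] bound
        run_max_nonneg[of "\<lambda>k. Y k w" n] run_max_nonneg[of "\<lambda>k. Y (Suc k) w" n] by auto
    note bd = this
    show "integrable M (?R n)" "integrable M (?R' n)"
      by (rule integrable_const_bound[OF AE_I2, OF bd(1)], rule run_max_measurable, rule Y)
         (rule integrable_const_bound[OF AE_I2, OF bd(2)], rule run_max_measurable, rule Y)
  qed
  have intY: "integrable M (\<lambda>w. if 0 < ?R n w then Y 0 w else 0)" for n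
  proof (rule integrable_const_bound[OF AE_I2])
    show "norm (if 0 < ?R n w then Y 0 w else 0) \<le> c" for w using bound[of 0 w] c by simp
    have [measurable]: "(\<lambda>w. ?R n w) \<in> borel_measurable M" by (rule run_max_measurable, rule Y)
    show "(\<lambda>w. if 0 < ?R n w then Y 0 w else 0) \<in> borel_measurable M" by measurable
  qed
  have "0 \<le> expectation (\<lambda>w. if 0 < ?R n w then Y 0 w else 0)" for n
  proof -
    have "0 = expectation (\<lambda>w. ?R n w - ?R' n w)" using stat[of n] int by simp
    also have "\<dots> \<le> expectation (\<lambda>w. if 0 < ?R n w then Y 0 w else 0)"
    proof (intro integral_mono)
      fix w
      show "?R n w - ?R' n w \<le> (if 0 < ?R n w then Y 0 w else 0)"
      proof (cases n)
        case (Suc m)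
        have "run_max (\<lambda>k. Y (Suc k) w) m \<le> ?R' n w"
          unfolding Suc by (rule run_max_Suc_ge)
        then show ?thesis using run_max_nonneg[of "\<lambda>k. Y (Suc k) w" n] by (auto simp: Suc)
      qed simp
    qed (rule Bochner_Integration.integrable_diff[OF int], rule intY)
    finally show ?thesis .
  qed
  moreover have "(\<lambda>n. expectation (\<lambda>w. if 0 < ?R n w then Y 0 w else 0)) \<longlonglongrightarrow> expectation (Y 0)"
  proof (rule integral_dominated_convergence[where w="\<lambda>_. c"])
    show "AE w in M. (\<lambda>n. if 0 < ?R n w then Y 0 w else 0) \<longlonglongrightarrow> Y 0 w"
      using pos
    proof eventually_elim
      case (elim w)
      then obtain k where k: "0 < (\<Sum>i<k. Y i w)" by blast
      have "\<forall>\<^sub>F n in sequentially. (if 0 < ?R n w then Y 0 w else 0) = Y 0 w"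
        using eventually_ge_at_top[of k] by eventually_elim (use run_max_pos[OF _ k] in auto)
      then show ?case by (rule tendsto_eventually)
    qed
    show "AE w in M. norm (if 0 < ?R n w then Y 0 w else 0) \<le> c" for n
      using bound[of 0] c by simp
    show "(\<lambda>w. if 0 < ?R n w then Y 0 w else 0) \<in> borel_measurable M" for n
      using intY by (rule borel_measurable_integrable)
  qed auto
  ultimately show ?thesis by (intro LIMSEQ_le_const) auto
qed

text \<open>The two sums differ by \<open>a\<^sub>n - a\<^sub>0\<close> only.\<close>

lemma average_shift:
  fixes a :: "nat \<Rightarrow> real"
  assumes "\<And>i. \<bar>a i\<bar> \<le> c"
  shows "(\<lambda>n. (\<Sum>i<n. a (Suc i)) / real n - (\<Sum>i<n. a i) / real n) \<longlonglongrightarrow> 0"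
proof (rule Lim_null_comparison)
  show "\<forall>\<^sub>F n in sequentially. norm ((\<Sum>i<n. a (Suc i)) / real n - (\<Sum>i<n. a i) / real n) \<le> (2 * c) / real n"
  proof (rule always_eventually, rule allI)
    fix n
    have "(\<Sum>i<n. a (Suc i)) - (\<Sum>i<n. a i) = a n - a 0"
      by (induction n) auto
    then have "norm ((\<Sum>i<n. a (Suc i)) / real n - (\<Sum>i<n. a i) / real n) = \<bar>a n - a 0\<bar> / real n"
      by (simp only: diff_divide_distrib[symmetric] real_norm_def abs_divide abs_of_nat)
    also have "\<dots> \<le> (2 * c) / real n"
      using assms[of n] assms[of 0] by (intro divide_right_mono) auto
    finally show "norm ((\<Sum>i<n. a (Suc i)) / real n - (\<Sum>i<n. a i) / real n) \<le> (2 * c) / real n" .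
  qed
  show "(\<lambda>n. 2 * c / real n) \<longlonglongrightarrow> 0" by (rule lim_const_over_n)
qed

text \<open>The margin \<open>q\<close> is quantified existentially because a shift changes the averages by a null
  sequence, so that exceeding a fixed level infinitely often is not invariant.\<close>

lemma exceeds_shift:
  fixes a :: "nat \<Rightarrow> real"
  assumes "\<And>i. \<bar>a i\<bar> \<le> c"
  shows "(\<exists>q>0. \<exists>\<^sub>F n in sequentially. (\<Sum>i<n. a (Suc i)) / real n > m + q)
    \<longleftrightarrow> (\<exists>q>0. \<exists>\<^sub>F n in sequentially. (\<Sum>i<n. a i) / real n > m + q)"
proof -
  have aux: "\<exists>q>0. \<exists>\<^sub>F n in sequentially. y n > m + q"
    if xy: "(\<lambda>n. x n - y n) \<longlonglongrightarrow> 0" and ex: "\<exists>q>0. \<exists>\<^sub>F n in sequentially. x n > m + q" for x y :: "nat \<Rightarrow> real"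
  proof -
    obtain q where q: "q > 0" and fr: "\<exists>\<^sub>F n in sequentially. x n > m + q" using ex by blast
    have "\<forall>\<^sub>F n in sequentially. x n - y n < q / 2"
      using xy q by (intro order_tendstoD) auto
    with fr have "\<exists>\<^sub>F n in sequentially. x n - y n < q / 2 \<and> x n > m + q"
      by (rule frequently_eventually_conj)
    then have "\<exists>\<^sub>F n in sequentially. y n > m + q / 2"
      by (rule frequently_mono[rotated]) (auto simp: field_simps)
    then show ?thesis using q by (intro exI[of _ "q/2"]) auto
  qed
  note l = average_shift[of a c, OF assms]
  show ?thesis
    using aux[OF l] aux[OF tendsto_minus[OF l, simplified]] by (rule iffI)
qed

lemma stationary_expectation_shift:
  assumes "prob_space M" and st: "strictly_stationary M borel X"
    and g [measurable]: "g \<in> borel_measurable (\<Pi>\<^sub>M t\<in>UNIV. borel)"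
  shows "integral\<^sup>L M (\<lambda>w. g (\<lambda>t. X (Suc t) w)) = integral\<^sup>L M (\<lambda>w. g (\<lambda>t. X t w :: 's::topological_space) :: real)"
proof -
  interpret prob_space M by fact
  have X [measurable]: "X t \<in> borel_measurable M" for t using st by (simp add: strictly_stationary_def)
  have m: "(\<lambda>w t. X (f t) w) \<in> M \<rightarrow>\<^sub>M (\<Pi>\<^sub>M t\<in>UNIV. borel)" for f :: "nat \<Rightarrow> nat"
    using measurable_restrict[of UNIV "\<lambda>t. X (f t)" M "\<lambda>_. borel"] by (simp add: restrict_UNIV)
  have "integral\<^sup>L (distr M (\<Pi>\<^sub>M t\<in>UNIV. borel) (\<lambda>w t. X (t + 1) w)) g = integral\<^sup>L (distr M (\<Pi>\<^sub>M t\<in>UNIV. borel) (\<lambda>w t. X t w)) g"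
    using st unfolding strictly_stationary_def by metis
  then show ?thesis
    using m[of Suc] m[of "\<lambda>t. t"] by (simp add: integral_distr)
qed

text \<open>The event that the averages exceed \<open>l\<close> by some margin infinitely often is invariant, hence has
  probability 0 or 1. With probability 1 the maximal ergodic theorem, applied to \<open>f - l\<close>, would give
  \<open>E f \<ge> l\<close>.\<close>

lemma ergodic_average_le:
  fixes X :: "nat \<Rightarrow> 'a \<Rightarrow> 's::topological_space"
  assumes "prob_space M" and erg: "ergodic_process M borel X"
    and f [measurable]: "f \<in> borel_measurable borel" and bound: "\<And>x. \<bar>f x :: real\<bar> \<le> c"
    and l: "integral\<^sup>L M (\<lambda>w. f (X 0 w)) < l"
  shows "AE w in M. \<forall>q>0. \<forall>\<^sub>F n in sequentially. (\<Sum>i<n. f (X i w)) / real n \<le> l + q"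
proof -
  interpret prob_space M by fact
  have st: "strictly_stationary M borel X" using erg by (simp add: ergodic_process_def)
  have X [measurable]: "X t \<in> borel_measurable M" for t using st by (simp add: strictly_stationary_def)
  have mX [measurable]: "(\<lambda>w t. X t w) \<in> M \<rightarrow>\<^sub>M (\<Pi>\<^sub>M t\<in>UNIV. borel)"
    using measurable_restrict[of UNIV "\<lambda>t. X t" M "\<lambda>_. borel"] by (simp add: restrict_UNIV)
  let ?P = "\<Pi>\<^sub>M t\<in>(UNIV::nat set). (borel :: 's measure)"
  have sp: "space ?P = UNIV" by (simp add: space_PiM PiE_def)
  have intf: "integrable M (\<lambda>w. f (X 0 w))"
    by (intro integrable_const_bound[where B=c]) (use bound in auto)
  define B where "B q = {y. \<exists>\<^sub>F n in sequentially. (\<Sum>i<n. f (y i)) / real n > l + q}" for q :: real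
  define A where "A = {y. \<exists>q>0. y \<in> B q}"
  have B_mono: "y \<in> B p" if "y \<in> B q" "p \<le> q" for y p q
    using that unfolding B_def by (auto elim!: frequently_mono[rotated])
  have A_eq: "A = (\<Union>k. B (inverse (real (Suc k))))"
  proof (intro equalityI subsetI)
    fix y assume "y \<in> A"
    then obtain q where q: "q > 0" "y \<in> B q" by (auto simp: A_def)
    then obtain k where "inverse (real (Suc k)) < q" using reals_Archimedean by blast
    then show "y \<in> (\<Union>k. B (inverse (real (Suc k))))" using B_mono[OF q(2)] by (auto intro: less_imp_le)
  next
    fix y assume "y \<in> (\<Union>k. B (inverse (real (Suc k))))"
    then obtain k where k: "y \<in> B (inverse (real (Suc k)))" by blast
    have "inverse (real (Suc k)) > 0" by simp
    with k show "y \<in> A" unfolding A_def by blast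
  qed
  have [measurable]: "B q \<in> sets ?P" for q
  proof -
    have "B q = {y \<in> space ?P. \<exists>\<^sub>F n in sequentially. (\<Sum>i<n. f (y i)) / real n > l + q}" by (simp add: B_def sp)
    also have "\<dots> \<in> sets ?P" unfolding frequently_def eventually_sequentially by measurable
    finally show ?thesis .
  qed
  have Am [measurable]: "A \<in> sets ?P" unfolding A_eq by measurable
  have inv: "{x \<in> space ?P. (\<lambda>t. x (t + 1)) \<in> A} = A"
  proof -
    have "(\<lambda>t. y (Suc t)) \<in> A \<longleftrightarrow> y \<in> A" for y
      using exceeds_shift[of "\<lambda>i. f (y i)" c l, OF bound] by (simp add: A_def B_def)
    then show ?thesis by (auto simp: sp)
  qed
  have "measure M {w \<in> space M. (\<lambda>t. X t w) \<in> A} \<in> {0, 1}"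
    using erg Am inv unfolding ergodic_process_def by blast
  moreover have "measure M {w \<in> space M. (\<lambda>t. X t w) \<in> A} \<noteq> 1"
  proof
    assume "measure M {w \<in> space M. (\<lambda>t. X t w) \<in> A} = 1"
    then have AE_A: "AE w in M. (\<lambda>t. X t w) \<in> A"
      by (subst (asm) prob_Collect_eq_1) auto
    have "0 \<le> expectation (\<lambda>w. f (X 0 w) - l)"
    proof (rule maximal_ergodic[where Y="\<lambda>n w. f (X n w) - l" and c="c + \<bar>l\<bar>"])
      show "\<bar>f (X n w) - l\<bar> \<le> c + \<bar>l\<bar>" for n w using bound[of "X n w"] by linarith
      show "expectation (\<lambda>w. run_max (\<lambda>k. f (X (Suc k) w) - l) n) = expectation (\<lambda>w. run_max (\<lambda>k. f (X k w) - l) n)" for n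
        by (rule stationary_expectation_shift[OF assms(1) st, of "\<lambda>y. run_max (\<lambda>k. f (y k) - l) n"],
          rule run_max_measurable) measurable
      show "AE w in M. \<exists>n. 0 < (\<Sum>i<n. f (X i w) - l)"
        using AE_A
      proof eventually_elim
        case (elim w)
        then obtain q where "q > 0" and fr: "\<exists>\<^sub>F n in sequentially. (\<Sum>i<n. f (X i w)) / real n > l + q"
          unfolding A_def B_def by blast
        from frequently_eventually_conj[OF fr eventually_gt_at_top[of 0]]
        obtain n where n: "(\<Sum>i<n. f (X i w)) / real n > l + q" "n > 0"
          by (auto dest: frequently_ex)
        then have "(\<Sum>i<n. f (X i w)) > real n * (l + q)" by (simp add: field_simps)
        moreover have "real n * (l + q) \<ge> real n * l" using \<open>q > 0\<close> by (intro mult_left_mono) auto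
        ultimately show ?case by (intro exI[of _ n]) (simp add: sum_subtractf)
      qed
    qed auto
    then show False using l intf by (simp add: prob_space)
  qed
  ultimately have "measure M {w \<in> space M. (\<lambda>t. X t w) \<in> A} = 0" by auto
  then have "AE w in M. (\<lambda>t. X t w) \<notin> A" by (subst (asm) prob_Collect_eq_0) auto
  then show ?thesis
  proof eventually_elim
    case (elim w)
    show ?case
    proof (intro allI impI)
      fix q :: real assume "q > 0"
      with elim have "(\<lambda>t. X t w) \<notin> B q" by (auto simp: A_def)
      then show "\<forall>\<^sub>F n in sequentially. (\<Sum>i<n. f (X i w)) / real n \<le> l + q"
        by (simp add: B_def frequently_def not_less)
    qed
  qed
qed

lemma ergodic_average_eventually_le:
  fixes X :: "nat \<Rightarrow> 'a \<Rightarrow> 's::topological_space"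
  assumes "prob_space M" and erg: "ergodic_process M borel X"
    and f [measurable]: "f \<in> borel_measurable borel" and bound: "\<And>x. \<bar>f x :: real\<bar> \<le> c"
  shows "AE w in M. \<forall>q>0. \<forall>\<^sub>F n in sequentially. (\<Sum>i<n. f (X i w)) / real n < integral\<^sup>L M (\<lambda>w. f (X 0 w)) + q"
proof -
  let ?m = "integral\<^sup>L M (\<lambda>w. f (X 0 w))"
  have "AE w in M. \<forall>k::nat. \<forall>q>0. \<forall>\<^sub>F n in sequentially. (\<Sum>i<n. f (X i w)) / real n \<le> (?m + inverse (real (Suc k))) + q"
    unfolding AE_all_countable by (intro allI ergodic_average_le[OF assms]) simp
  then show ?thesis
  proof eventually_elim
    case (elim w)
    show ?case
    proof (intro allI impI)
      fix q :: real assume "q > 0"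
      then obtain k where k: "inverse (real (Suc k)) < q / 2" using reals_Archimedean[of "q/2"] by auto
      have "\<forall>\<^sub>F n in sequentially. (\<Sum>i<n. f (X i w)) / real n \<le> (?m + inverse (real (Suc k))) + q / 2"
        using elim \<open>q > 0\<close> by simp
      then show "\<forall>\<^sub>F n in sequentially. (\<Sum>i<n. f (X i w)) / real n < ?m + q"
        by eventually_elim (use k in linarith)
    qed
  qed
qed

theorem ergodic_theorem:
  fixes X :: "nat \<Rightarrow> 'a \<Rightarrow> 's::topological_space"
  assumes "prob_space M" and erg: "ergodic_process M borel X"
    and f [measurable]: "f \<in> borel_measurable borel" and bound: "\<And>x. \<bar>f x :: real\<bar> \<le> c"
  shows "AE w in M. (\<lambda>n. (\<Sum>i<n. f (X i w)) / real n) \<longlonglongrightarrow> integral\<^sup>L M (\<lambda>w. f (X 0 w))"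
proof -
  have "AE w in M. \<forall>q>0. \<forall>\<^sub>F n in sequentially.
      (\<Sum>i<n. - f (X i w)) / real n < integral\<^sup>L M (\<lambda>w. - f (X 0 w)) + q"
    by (rule ergodic_average_eventually_le[OF assms(1,2), of "\<lambda>x. - f x" c]) (use bound in auto)
  with ergodic_average_eventually_le[OF assms] show ?thesis
  proof eventually_elim
    case (elim w)
    show ?case
    proof (rule order_tendstoI)
      fix a assume "a < integral\<^sup>L M (\<lambda>w. f (X 0 w))"
      with elim(2)[rule_format, of "integral\<^sup>L M (\<lambda>w. f (X 0 w)) - a"]
      show "\<forall>\<^sub>F n in sequentially. a < (\<Sum>i<n. f (X i w)) / real n"
        by (simp add: sum_negf)
    next
      fix a assume "integral\<^sup>L M (\<lambda>w. f (X 0 w)) < a"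
      with elim(1)[rule_format, of "a - integral\<^sup>L M (\<lambda>w. f (X 0 w))"]
      show "\<forall>\<^sub>F n in sequentially. (\<Sum>i<n. f (X i w)) / real n < a" by simp
    qed
qed
qed

section \<open>Local lower bounds of harmonic functions\<close>

definition bounded_below_near :: "('s::topological_space \<Rightarrow> ennreal) \<Rightarrow> 's \<Rightarrow> bool" where
  "bounded_below_near h x \<longleftrightarrow> (\<exists>c>0. \<forall>\<^sub>F y in nhds x. ennreal c \<le> h y)"

lemma bounded_below_on_compact:
  assumes "compact C" and near: "\<And>x. x \<in> C \<Longrightarrow> bounded_below_near h x"
  shows "\<exists>c>0. \<forall>x\<in>C. ennreal c \<le> h x"
proof -
  have "\<forall>x\<in>C. \<exists>c U. c > 0 \<and> open U \<and> x \<in> U \<and> (\<forall>y\<in>U. ennreal c \<le> h y)"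
    using near unfolding bounded_below_near_def eventually_nhds by metis
  then obtain c U where cU: "\<And>x. x \<in> C \<Longrightarrow> c x > 0 \<and> open (U x) \<and> x \<in> U x \<and> (\<forall>y\<in>U x. ennreal (c x) \<le> h y)"
    by metis
  obtain D where D: "D \<subseteq> C" "finite D" "C \<subseteq> (\<Union>x\<in>D. U x)"
    by (rule compactE_image[OF \<open>compact C\<close>, of C U]) (use cU in auto)
  define m where "m = Min (insert 1 (c ` D))"
  have "m > 0" unfolding m_def using D cU by (subst Min_gr_iff) auto
  moreover have "ennreal m \<le> h y" if yC: "y \<in> C" for y
  proof -
    obtain x where x: "x \<in> D" "y \<in> U x" using D(3) yC by blast
    have "m \<le> c x" unfolding m_def using D x by (intro Min_le) auto
    then have "ennreal m \<le> ennreal (c x)" by (intro ennreal_leI)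
    also have "\<dots> \<le> h y" using cU x D by blast
    finally show ?thesis .
  qed
  ultimately show ?thesis by blast
qed

text \<open>With positive probability the first shock falls so close to \<open>w0\<close> that every state near \<open>x\<close> is
  sent to the neighbourhood of \<open>F x w0\<close> on which \<open>h\<close> is bounded below.\<close>

lemma bounded_below_near_step:
  fixes F :: "'s::topological_space \<Rightarrow> 'w::topological_space \<Rightarrow> 's"
  assumes "random_recursion W F" and sets_W [measurable_cong]: "sets W = sets borel"
    and harmonic: "random_recursion.avg W F h = h"
    and cont: "((\<lambda>(y, w). F y w) \<longlongrightarrow> F x w0) (nhds x \<times>\<^sub>F nhds w0)"
    and support: "\<And>U. open U \<Longrightarrow> w0 \<in> U \<Longrightarrow> 0 < emeasure W U"
    and good: "bounded_below_near h (F x w0)"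
  shows "bounded_below_near h x"
proof -
  interpret random_recursion W F by fact
  obtain c where c: "c > 0" "\<forall>\<^sub>F y in nhds (F x w0). ennreal c \<le> h y"
    using good unfolding bounded_below_near_def by blast
  have "\<forall>\<^sub>F z in nhds x \<times>\<^sub>F nhds w0. ennreal c \<le> h ((\<lambda>(y, w). F y w) z)"
    by (rule eventually_compose_filterlim[OF c(2) cont])
  then obtain P Q where P: "eventually P (nhds x)" and Q: "eventually Q (nhds w0)"
    and PQ: "\<And>y w. P y \<Longrightarrow> Q w \<Longrightarrow> ennreal c \<le> h (F y w)"
    unfolding eventually_prod_filter by auto
  obtain U where U: "open U" "w0 \<in> U" "\<And>w. w \<in> U \<Longrightarrow> Q w"
    using Q unfolding eventually_nhds by blast
  have [measurable]: "U \<in> sets W" using U(1) by (simp add: sets_W)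
  have pos: "0 < measure W U" using support[OF U(1,2)] by (simp add: M.emeasure_eq_measure)
  have "ennreal (c * measure W U) \<le> h y" if "P y" for y
  proof -
    have "ennreal (c * measure W U) = (\<integral>\<^sup>+w. ennreal c * indicator U w \<partial>W)"
      using c by (simp add: nn_integral_cmult M.emeasure_eq_measure ennreal_mult)
    also have "\<dots> \<le> (\<integral>\<^sup>+w. h (F y w) \<partial>W)"
      using PQ[OF that] U(3) by (intro nn_integral_mono) (auto simp: indicator_def)
    also have "\<dots> = h y" using fun_cong[OF harmonic, of y] by (simp add: avg_def)
    finally show ?thesis .
  qed
  then have "\<forall>\<^sub>F y in nhds x. ennreal (c * measure W U) \<le> h y"
    using P by (auto elim: eventually_mono)
  then show ?thesis unfolding bounded_below_near_def using c pos by (intro exI[of _ "c * measure W U"]) auto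
qed

section \<open>The chain of log-volatility and log-ratio\<close>

text \<open>The factor by which a shock pulls the log-ratio \<open>d\<close> back: observations are divided by the
  reconstructed volatility, which exceeds the true one by the factor \<open>exp (d / 2)\<close>.\<close>

definition contract :: "real \<Rightarrow> real" where
  "contract d = 1 - exp (- d / 2)"

definition ratio_step :: "real \<Rightarrow> real \<Rightarrow> real \<Rightarrow> real" where
  "ratio_step \<beta> d w = \<beta> * d - w * contract d"

lemma contract_bounds:
  "0 \<le> d \<Longrightarrow> 0 \<le> contract d" "contract d < 1" "contract d \<le> d / 2"
  "d \<le> 0 \<Longrightarrow> contract d \<le> 0"
  using exp_ge_add_one_self[of "- d / 2"] by (auto simp: contract_def)

lemma contract_eq_0_iff [simp]: "contract d = 0 \<longleftrightarrow> d = 0"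
  by (simp add: contract_def)

lemma contract_pos: "0 < d \<Longrightarrow> 0 < contract d" and contract_neg: "d < 0 \<Longrightarrow> contract d < 0"
  by (auto simp: contract_def)

lemma abs_contract_le: assumes "\<bar>d\<bar> \<le> 1" shows "\<bar>contract d\<bar> \<le> \<bar>d\<bar>"
proof (cases "0 \<le> d")
  case True
  then show ?thesis using contract_bounds[of d] by auto
next
  case False
  have "exp (- d / 2) \<le> 1 + (- d / 2) + (- d / 2)\<^sup>2"
    using False assms by (intro exp_bound) auto
  also have "(- d / 2)\<^sup>2 \<le> - d / 2"
    using False assms mult_right_mono[of "- d / 2" 1 "- d / 2"] by (simp add: power2_eq_square)
  finally show ?thesis using False contract_bounds(4)[of d] by (simp add: contract_def)
qed

lemma contract_measurable [measurable]: "contract \<in> borel_measurable borel"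
  unfolding contract_def[abs_def] by measurable

lemma contract_continuous [continuous_intros]: "continuous_on A f \<Longrightarrow> continuous_on A (\<lambda>x. contract (f x))"
  unfolding contract_def by (intro continuous_intros) auto

lemma ratio_step_measurable [measurable (raw)]:
  assumes [measurable]: "f \<in> borel_measurable M" "g \<in> borel_measurable M"
  shows "(\<lambda>x. ratio_step \<beta> (f x) (g x)) \<in> borel_measurable M"
  unfolding ratio_step_def by measurable

text \<open>A Lyapunov function for the log-ratio. A negative ratio \<open>- x\<close> can jump up to the order \<open>w exp (x / 2)\<close>,
  so only logarithmic growth on the positive side is compatible with linear growth on the negative
  side. The slope \<open>1 / (1 - \<beta>)\<close> is large enough to pay \<open>x / 2\<close> for such a jump and \<open>x / 2\<close> for the
  drift.\<close>

definition ratio_size :: "real \<Rightarrow> real \<Rightarrow> real" where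
  "ratio_size \<beta> d = (if 0 \<le> d then ln (1 + d) else - d / (1 - \<beta>))"

lemma ratio_size_measurable [measurable]: "ratio_size \<beta> \<in> borel_measurable borel"
  unfolding ratio_size_def[abs_def] by measurable

context
  fixes \<beta> :: real assumes \<beta>: "0 < \<beta>" "\<beta> < 1"
begin

lemma ratio_size_nonneg: "0 \<le> ratio_size \<beta> d"
  using \<beta> by (auto simp: ratio_size_def divide_nonpos_pos)

lemma ratio_size_le_abs: "ratio_size \<beta> d \<le> \<bar>d\<bar> / (1 - \<beta>)"
proof (cases "0 \<le> d")
  case True
  then have "ln (1 + d) \<le> d" using ln_add_one_self_le_self by auto
  also have "d \<le> d / (1 - \<beta>)" using True \<beta> by (simp add: field_simps)
  finally show ?thesis using True by (simp add: ratio_size_def)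
qed (simp add: ratio_size_def)

lemma ratio_size_step_neg:
  assumes "d < 0" "0 \<le> w"
  shows "ratio_size \<beta> (ratio_step \<beta> d w) \<le> ratio_size \<beta> d - \<bar>d\<bar> / 2 + w"
proof -
  have size: "ratio_size \<beta> d = \<bar>d\<bar> / (1 - \<beta>)" using assms by (simp add: ratio_size_def)
  have b: "\<bar>d\<bar> \<le> \<bar>d\<bar> / (1 - \<beta>)" using \<beta> by (simp add: field_simps)
  have b2: "\<beta> * \<bar>d\<bar> / (1 - \<beta>) = \<bar>d\<bar> / (1 - \<beta>) - \<bar>d\<bar>" using \<beta> by (simp add: field_simps)
  let ?y = "ratio_step \<beta> d w"
  show ?thesis
  proof (cases "0 \<le> ?y")
    case True
    have "?y \<le> w * (exp (\<bar>d\<bar> / 2) - 1)" using assms \<beta> by (auto simp: ratio_step_def contract_def algebra_simps mult_nonneg_nonpos)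
    then have "1 + ?y \<le> exp (\<bar>d\<bar> / 2) * (1 + w)"
    proof -
      assume *: "?y \<le> w * (exp (\<bar>d\<bar> / 2) - 1)"
      have "1 \<le> exp (\<bar>d\<bar> / 2)" by simp
      moreover have "exp (\<bar>d\<bar> / 2) * (1 + w) = exp (\<bar>d\<bar> / 2) + w * exp (\<bar>d\<bar> / 2)"
        "w * (exp (\<bar>d\<bar> / 2) - 1) = w * exp (\<bar>d\<bar> / 2) - w" by (simp_all add: algebra_simps)
      ultimately show ?thesis using * assms(2) by linarith
    qed
    then have "ln (1 + ?y) \<le> ln (exp (\<bar>d\<bar> / 2) * (1 + w))" using True assms by (subst ln_le_cancel_iff) auto
    also have "\<dots> = \<bar>d\<bar> / 2 + ln (1 + w)" using assms by (simp add: ln_mult)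
    also have "ln (1 + w) \<le> w" using assms ln_add_one_self_le_self by auto
    finally show ?thesis using True b by (simp add: ratio_size_def[of _ ?y] size)
  next
    case False
    have "- ?y \<le> \<beta> * \<bar>d\<bar>" using assms contract_bounds(4)[of d] by (auto simp: ratio_step_def mult_nonneg_nonpos)
    then have "- ?y / (1 - \<beta>) \<le> \<beta> * \<bar>d\<bar> / (1 - \<beta>)" using \<beta> by (intro divide_right_mono) auto
    then have "ratio_size \<beta> ?y \<le> \<bar>d\<bar> / (1 - \<beta>) - \<bar>d\<bar>" using False b2 by (simp add: ratio_size_def)
    then show ?thesis using assms by (simp add: size)
  qed
qed

text \<open>From a large positive ratio the sign changes only if \<open>w\<close> exceeds \<open>\<beta> d\<close>. The excess is controlled
  by \<open>w - y \<le> w\<^sup>2 / (4 y)\<close> and becomes negligible as \<open>d\<close> grows.\<close>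

lemma ratio_size_step_pos:
  assumes "0 < d" "0 \<le> w"
  shows "ratio_size \<beta> (ratio_step \<beta> d w) \<le> ln (1 + \<beta> * d) + w\<^sup>2 / (4 * (\<beta> * d) * (1 - \<beta>))"
proof -
  let ?y = "ratio_step \<beta> d w"
  have bd: "0 < \<beta> * d" using \<beta> assms by simp
  have u: "0 \<le> contract d" "contract d \<le> 1" using contract_bounds(1,2)[of d] assms by auto
  have rest: "0 \<le> w\<^sup>2 / (4 * (\<beta> * d) * (1 - \<beta>))" using \<beta> bd by simp
  show ?thesis
  proof (cases "0 \<le> ?y")
    case True
    have "?y \<le> \<beta> * d" using assms u by (simp add: ratio_step_def)
    then have "ln (1 + ?y) \<le> ln (1 + \<beta> * d)" using True by simp
    then show ?thesis using True rest by (simp add: ratio_size_def)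
  next
    case False
    have "w * contract d \<le> w" using u assms by (simp add: mult_left_le)
    then have "- ?y \<le> w - \<beta> * d" by (simp add: ratio_step_def)
    also have "\<dots> \<le> w\<^sup>2 / (4 * (\<beta> * d))"
    proof -
      have "0 \<le> (w - 2 * (\<beta> * d))\<^sup>2" by simp
      then have "(w - \<beta> * d) * (4 * (\<beta> * d)) \<le> w\<^sup>2" by (simp add: power2_eq_square algebra_simps)
      then show ?thesis using bd by (simp add: pos_le_divide_eq)
    qed
    finally have "- ?y / (1 - \<beta>) \<le> w\<^sup>2 / (4 * (\<beta> * d)) / (1 - \<beta>)" using \<beta> by (intro divide_right_mono) auto
    moreover have "0 \<le> ln (1 + \<beta> * d)" using bd by simp
    ultimately show ?thesis using False by (simp add: ratio_size_def)
  qed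
qed

lemma ratio_size_step:
  assumes "0 \<le> w"
  shows "ratio_size \<beta> (ratio_step \<beta> d w) \<le> ratio_size \<beta> d + w / (1 - \<beta>)"
proof (cases "0 \<le> d")
  case False
  have "w \<le> w / (1 - \<beta>)" using \<beta> assms by (simp add: field_simps)
  then show ?thesis using ratio_size_step_neg[of d w] False assms by auto
next
  case True
  let ?y = "ratio_step \<beta> d w"
  have u: "0 \<le> contract d" "contract d \<le> 1" using contract_bounds(1,2)[of d] True by auto
  have q: "0 \<le> w / (1 - \<beta>)" using \<beta> assms by simp
  show ?thesis
  proof (cases "0 \<le> ?y")
    case True': True
    have "\<beta> * d \<le> d" using \<beta> True by (simp add: mult_left_le_one_le)
    then have "?y \<le> d" using mult_nonneg_nonneg[OF assms u(1)] by (simp add: ratio_step_def)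
    then have "ln (1 + ?y) \<le> ln (1 + d)" using True' by (subst ln_le_cancel_iff) auto
    moreover have "ratio_size \<beta> ?y = ln (1 + ?y)" "ratio_size \<beta> d = ln (1 + d)"
      using True True' by (simp_all add: ratio_size_def)
    ultimately show ?thesis using q by linarith
  next
    case False
    have "w * contract d \<le> w" using u assms by (simp add: mult_left_le)
    moreover have "0 \<le> \<beta> * d" using True \<beta> by simp
    ultimately have "- ?y \<le> w" by (simp add: ratio_step_def)
    then have "- ?y / (1 - \<beta>) \<le> w / (1 - \<beta>)" using \<beta> by (intro divide_right_mono) auto
    moreover have "ratio_size \<beta> ?y = - ?y / (1 - \<beta>)" "ratio_size \<beta> d = ln (1 + d)"
      using False True by (simp_all add: ratio_size_def)
    moreover have "0 \<le> ln (1 + d)" using True by simp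
    ultimately show ?thesis by linarith
  qed
qed

lemma abs_ratio_step_le:
  assumes "\<bar>d\<bar> \<le> 1" "0 \<le> w"
  shows "\<bar>ratio_step \<beta> d w\<bar> \<le> \<bar>d\<bar> * (\<beta> + w)"
proof -
  have "\<bar>ratio_step \<beta> d w\<bar> \<le> \<beta> * \<bar>d\<bar> + w * \<bar>contract d\<bar>"
    using \<beta> assms abs_triangle_ineq4[of "\<beta> * d" "w * contract d"] by (simp add: ratio_step_def abs_mult)
  also have "w * \<bar>contract d\<bar> \<le> w * \<bar>d\<bar>" using abs_contract_le[OF assms(1)] assms by (intro mult_left_mono) auto
  finally show ?thesis by (simp add: algebra_simps)
qed

end

text \<open>\<open>W\<close> stands for the law of the shock \<open>\<gamma> \<bar>\<epsilon>\<bar> + \<delta> \<epsilon>\<close>. States are pairs of log-volatility and log-ratio.\<close>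

locale egarch_chain = prob_space W for W :: "real measure" +
  fixes \<alpha> \<beta> :: real
  assumes \<beta>: "0 < \<beta>" "\<beta> < 1"
    and sets_W [measurable_cong]: "sets W = sets borel"
    and nonneg: "AE w in W. 0 \<le> w"
    and square_integrable: "integrable W (\<lambda>w. w\<^sup>2)"
    and near_0: "\<And>e. 0 < e \<Longrightarrow> 0 < emeasure W {w. \<bar>w\<bar> < e}"
begin

lemma total_mass: "measure W (space W) = 1"
  by (rule prob_space)

definition step :: "real \<times> real \<Rightarrow> real \<Rightarrow> real \<times> real" where
  "step x w = (\<alpha> + \<beta> * fst x + w, ratio_step \<beta> (snd x) w)"

sublocale random_recursion W step
proof -
  interpret P: product_prob_space "\<lambda>_::nat. W" UNIV
    by (rule product_prob_spaceI) (rule prob_space_axioms)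
  have "(\<lambda>(x, w). step x w) \<in> borel \<Otimes>\<^sub>M W \<rightarrow>\<^sub>M borel"
    unfolding step_def split_beta' borel_prod[symmetric] by measurable
  then show "random_recursion W step" by unfold_locales
qed

definition shock_mean :: real where "shock_mean = integral\<^sup>L W (\<lambda>w. w)"
definition shock_square_mean :: real where "shock_square_mean = integral\<^sup>L W (\<lambda>w. w\<^sup>2)"

lemma integrable_shock: "integrable W (\<lambda>w. w)"
proof (rule Bochner_Integration.integrable_bound)
  show "integrable W (\<lambda>w. 1 + w\<^sup>2)" using square_integrable by simp
  show "AE w in W. norm w \<le> norm (1 + w\<^sup>2)"
  proof (rule AE_I2)
    fix w :: real
    have "0 \<le> (\<bar>w\<bar> - 1)\<^sup>2" by simp
    then have "2 * \<bar>w\<bar> \<le> 1 + w\<^sup>2" by (simp add: power2_eq_square algebra_simps)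
    then show "norm w \<le> norm (1 + w\<^sup>2)" by simp
  qed
qed measurable

lemma shock_mean_nonneg: "0 \<le> shock_mean" and shock_square_mean_nonneg: "0 \<le> shock_square_mean"
  unfolding shock_mean_def shock_square_mean_def using nonneg by (auto intro: integral_nonneg_AE)

text \<open>Drift inequalities are proved pointwise in \<open>w\<close> with a quadratic bound and then integrated.\<close>

lemma quadratic_bound:
  assumes [measurable]: "f \<in> borel_measurable borel" and c: "0 \<le> c0" "0 \<le> c1" "0 \<le> c2"
    and le: "\<And>w. 0 \<le> w \<Longrightarrow> f w \<le> c0 + c1 * w + c2 * w\<^sup>2"
  shows "(\<integral>\<^sup>+w. ennreal (f w) \<partial>W) \<le> ennreal (c0 + c1 * shock_mean + c2 * shock_square_mean)"
proof -
  have int: "integrable W (\<lambda>w. c0 + c1 * w + c2 * w\<^sup>2)"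
    using integrable_shock square_integrable by simp
  have "(\<integral>\<^sup>+w. ennreal (f w) \<partial>W) \<le> (\<integral>\<^sup>+w. ennreal (c0 + c1 * w + c2 * w\<^sup>2) \<partial>W)"
    using nonneg by (intro nn_integral_mono_AE) (auto elim!: eventually_mono intro: ennreal_leI le)
  also have "\<dots> = ennreal (integral\<^sup>L W (\<lambda>w. c0 + c1 * w + c2 * w\<^sup>2))"
    using int nonneg c by (intro nn_integral_eq_integral) (auto elim!: eventually_mono)
  also have "integral\<^sup>L W (\<lambda>w. c0 + c1 * w + c2 * w\<^sup>2) = c0 + c1 * shock_mean + c2 * shock_square_mean"
    using integrable_shock square_integrable by (simp add: shock_mean_def shock_square_mean_def total_mass)
  finally show ?thesis .
qed

text \<open>Truncation from below makes the logarithm integrable; the exponent itself may be \<open>- \<infinity>\<close>.\<close>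

lemma log_max_integrable:
  assumes "0 < \<tau>" shows "integrable W (\<lambda>w. ln (max \<tau> \<bar>\<beta> - w / 2\<bar>))"
proof (rule Bochner_Integration.integrable_bound)
  show "integrable W (\<lambda>w. \<bar>ln \<tau>\<bar> + (\<tau> + \<beta> + \<bar>w\<bar>))" using integrable_shock by simp
  show "AE w in W. norm (ln (max \<tau> \<bar>\<beta> - w / 2\<bar>)) \<le> norm (\<bar>ln \<tau>\<bar> + (\<tau> + \<beta> + \<bar>w\<bar>))"
  proof (rule AE_I2)
    fix w
    let ?m' = "max \<tau> \<bar>\<beta> - w / 2\<bar>"
    have "ln \<tau> \<le> ln ?m'" using assms by (subst ln_le_cancel_iff) auto
    moreover have "ln ?m' \<le> ?m'" using assms by (intro ln_bound) auto
    moreover have "?m' \<le> \<tau> + \<beta> + \<bar>w\<bar>" using assms \<beta> by (auto simp: max_def)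
    ultimately show "norm (ln ?m') \<le> norm (\<bar>ln \<tau>\<bar> + (\<tau> + \<beta> + \<bar>w\<bar>))"
      using assms \<beta> unfolding real_norm_def by linarith
  qed
qed measurable

lemma ratio_size_avg:
  "(\<integral>\<^sup>+w. ennreal (ratio_size \<beta> (ratio_step \<beta> d w)) \<partial>W) \<le> ennreal (ratio_size \<beta> d + shock_mean / (1 - \<beta>))"
proof -
  have "(\<integral>\<^sup>+w. ennreal (ratio_size \<beta> (ratio_step \<beta> d w)) \<partial>W)
      \<le> ennreal (ratio_size \<beta> d + 1 / (1 - \<beta>) * shock_mean + 0 * shock_square_mean)"
    by (rule quadratic_bound) (use ratio_size_step[OF \<beta>] ratio_size_nonneg[OF \<beta>] \<beta> in auto)
  then show ?thesis by simp
qed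

lemma ratio_size_avg_near_0:
  assumes "\<bar>d\<bar> \<le> 1"
  shows "(\<integral>\<^sup>+w. ennreal (ratio_size \<beta> (ratio_step \<beta> d w)) \<partial>W) \<le> ennreal (\<bar>d\<bar> * (1 + shock_mean) / (1 - \<beta>))"
proof -
  have "(\<integral>\<^sup>+w. ennreal (ratio_size \<beta> (ratio_step \<beta> d w)) \<partial>W)
      \<le> ennreal (\<bar>d\<bar> / (1 - \<beta>) + \<bar>d\<bar> / (1 - \<beta>) * shock_mean + 0 * shock_square_mean)"
  proof (rule quadratic_bound)
    fix w :: real assume w: "0 \<le> w"
    have "ratio_size \<beta> (ratio_step \<beta> d w) \<le> \<bar>ratio_step \<beta> d w\<bar> / (1 - \<beta>)"
      by (rule ratio_size_le_abs[OF \<beta>])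
    also have "\<dots> \<le> (\<bar>d\<bar> * (1 + w)) / (1 - \<beta>)"
    proof (rule divide_right_mono)
      have "\<bar>ratio_step \<beta> d w\<bar> \<le> \<bar>d\<bar> * (\<beta> + w)" by (rule abs_ratio_step_le[OF \<beta> assms w])
      also have "\<dots> \<le> \<bar>d\<bar> * (1 + w)" using \<beta> by (intro mult_left_mono) auto
      finally show "\<bar>ratio_step \<beta> d w\<bar> \<le> \<bar>d\<bar> * (1 + w)" .
    qed (use \<beta> in auto)
    finally show "ratio_size \<beta> (ratio_step \<beta> d w) \<le> \<bar>d\<bar> / (1 - \<beta>) + \<bar>d\<bar> / (1 - \<beta>) * w + 0 * w\<^sup>2"
      by (simp add: distrib_left add_divide_distrib)
  qed (use \<beta> in auto)
  then show ?thesis by (simp add: distrib_left add_divide_distrib)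
qed

text \<open>On the positive side the drift tends to \<open>ln \<beta>\<close> only, so it is a negative constant; on the negative
  side it tends to \<open>- \<infinity>\<close>.\<close>

lemma ratio_size_drift:
  obtains K k where "1 \<le> K" "0 < k"
    "\<And>d. K < \<bar>d\<bar> \<Longrightarrow> (\<integral>\<^sup>+w. ennreal (ratio_size \<beta> (ratio_step \<beta> d w)) \<partial>W) + ennreal k \<le> ennreal (ratio_size \<beta> d)"
proof -
  define k where "k = - ln ((1 + \<beta>) / 2) / 2"
  have k: "0 < k" using \<beta> by (simp add: k_def)
  define K where "K = max 1 (max (2 * (shock_mean + k)) (shock_square_mean / (4 * \<beta> * (1 - \<beta>) * k)))"
  have K: "1 \<le> K" "2 * (shock_mean + k) \<le> K" "shock_square_mean / (4 * \<beta> * (1 - \<beta>) * k) \<le> K" by (auto simp: K_def)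
  have "(\<integral>\<^sup>+w. ennreal (ratio_size \<beta> (ratio_step \<beta> d w)) \<partial>W) + ennreal k \<le> ennreal (ratio_size \<beta> d)"
    if d: "K < \<bar>d\<bar>" for d
  proof (cases "d < 0")
    case True
    have q: "0 \<le> ratio_size \<beta> d - \<bar>d\<bar> / 2"
    proof -
      have "\<bar>d\<bar> / 2 \<le> \<bar>d\<bar>" by simp
      also have "\<bar>d\<bar> \<le> \<bar>d\<bar> / (1 - \<beta>)" using \<beta> by (simp add: field_simps)
      finally show ?thesis using True by (simp add: ratio_size_def)
    qed
    have "(\<integral>\<^sup>+w. ennreal (ratio_size \<beta> (ratio_step \<beta> d w)) \<partial>W) \<le> ennreal (ratio_size \<beta> d - \<bar>d\<bar> / 2 + 1 * shock_mean + 0 * shock_square_mean)"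
      by (rule quadratic_bound) (use q ratio_size_step_neg[OF \<beta> True] in auto)
    then have "(\<integral>\<^sup>+w. ennreal (ratio_size \<beta> (ratio_step \<beta> d w)) \<partial>W) + ennreal k
        \<le> ennreal (ratio_size \<beta> d - \<bar>d\<bar> / 2 + shock_mean) + ennreal k" by (intro add_right_mono) simp
    also have "\<dots> = ennreal (ratio_size \<beta> d - \<bar>d\<bar> / 2 + shock_mean + k)"
      using q shock_mean_nonneg k by (subst ennreal_plus[symmetric]) auto
    also have "\<dots> \<le> ennreal (ratio_size \<beta> d)" using K d by (intro ennreal_leI) auto
    finally show ?thesis .
  next
    case False
    with d K have d0: "0 < d" "1 \<le> d" "K \<le> d" by auto
    let ?c = "1 / (4 * (\<beta> * d) * (1 - \<beta>))"
    have c: "0 \<le> ?c" using \<beta> d0 by simp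
    have l: "0 \<le> ln (1 + \<beta> * d)" using \<beta> d0 by simp
    have "(\<integral>\<^sup>+w. ennreal (ratio_size \<beta> (ratio_step \<beta> d w)) \<partial>W) \<le> ennreal (ln (1 + \<beta> * d) + 0 * shock_mean + ?c * shock_square_mean)"
      by (rule quadratic_bound) (use c l ratio_size_step_pos[OF \<beta> d0(1)] in auto)
    then have "(\<integral>\<^sup>+w. ennreal (ratio_size \<beta> (ratio_step \<beta> d w)) \<partial>W) + ennreal k
        \<le> ennreal (ln (1 + \<beta> * d) + ?c * shock_square_mean) + ennreal k" by (intro add_right_mono) simp
    also have "\<dots> = ennreal (ln (1 + \<beta> * d) + ?c * shock_square_mean + k)"
      using l c shock_square_mean_nonneg k by (subst ennreal_plus[symmetric]) auto
    also have "\<dots> \<le> ennreal (ratio_size \<beta> d)"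
    proof (rule ennreal_leI)
      have "1 + \<beta> * d \<le> (1 + \<beta>) / 2 * (1 + d)"
        using mult_left_mono[of 1 d "1 - \<beta>"] \<beta> d0 by (simp add: field_simps)
      then have "ln (1 + \<beta> * d) \<le> ln ((1 + \<beta>) / 2 * (1 + d))"
        using \<beta> d0 by (subst ln_le_cancel_iff) (auto simp: add_pos_pos)
      also have "\<dots> = ln ((1 + \<beta>) / 2) + ln (1 + d)" using \<beta> d0 by (subst ln_mult) auto
      finally have 1: "ln (1 + \<beta> * d) \<le> ln (1 + d) - 2 * k" by (simp add: k_def)
      have "shock_square_mean / (4 * \<beta> * (1 - \<beta>) * k) \<le> d" using K d0 by linarith
      then have "shock_square_mean \<le> d * (4 * \<beta> * (1 - \<beta>) * k)" using \<beta> k by (simp add: pos_divide_le_eq)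
      then have "shock_square_mean \<le> k * (4 * (\<beta> * d) * (1 - \<beta>))" by (simp add: mult_ac)
      then have 2: "?c * shock_square_mean \<le> k" using \<beta> d0 by (simp add: pos_divide_le_eq)
      show "ln (1 + \<beta> * d) + ?c * shock_square_mean + k \<le> ratio_size \<beta> d"
        using 1 2 d0 by (simp add: ratio_size_def)
    qed
    finally show ?thesis .
  qed
  with that[of K k] K k show ?thesis by blast
qed

text \<open>Adds the log-volatility to a Lyapunov function of the log-ratio. Its drift is \<open>- \<infinity>\<close> at infinity but
  a positive constant near \<open>0\<close>; the weight \<open>s\<close> is so small that this constant uses up only half
  of the drift \<open>k\<close>.\<close>

lemma drift_with_level:
  fixes f :: "real \<Rightarrow> ennreal" and b k :: real
  assumes f [measurable]: "f \<in> borel_measurable borel" and D: "compact D" and k: "0 < k" and b: "0 < b"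
    and drift: "\<And>d. (\<integral>\<^sup>+w. f (ratio_step \<beta> d w) \<partial>W) + ennreal k \<le> f d + ennreal b * indicator D d"
  obtains s A where "0 < s"
    "\<And>x. avg (\<lambda>(a, d). f d + ennreal (s * \<bar>a\<bar>)) x + ennreal (k / 2)
        \<le> (case x of (a, d) \<Rightarrow> f d + ennreal (s * \<bar>a\<bar>)) + ennreal b * indicator ({-A..A} \<times> D) x"
proof -
  define ca where "ca = \<bar>\<alpha>\<bar> + shock_mean + 1"
  have ca: "0 < ca" using shock_mean_nonneg by (simp add: ca_def)
  define s where "s = k / (2 * ca)"
  have s: "0 < s" using k ca by (simp add: s_def)
  define A where "A = b / (s * (1 - \<beta>))"
  have A: "0 < A" using b s \<beta> by (simp add: A_def)
  have "avg (\<lambda>(a, d). f d + ennreal (s * \<bar>a\<bar>)) x + ennreal (k / 2)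
        \<le> (case x of (a, d) \<Rightarrow> f d + ennreal (s * \<bar>a\<bar>)) + ennreal b * indicator ({-A..A} \<times> D) x" for x
  proof -
    obtain a d where x: "x = (a, d)" by (cases x)
    have "(\<integral>\<^sup>+w. ennreal (s * \<bar>\<alpha> + \<beta> * a + w\<bar>) \<partial>W) \<le> ennreal (s * (\<bar>\<alpha>\<bar> + \<beta> * \<bar>a\<bar>) + s * shock_mean + 0 * shock_square_mean)"
    proof (rule quadratic_bound)
      fix w :: real assume "0 \<le> w"
      have "\<bar>\<alpha> + \<beta> * a + w\<bar> \<le> \<bar>\<alpha>\<bar> + \<beta> * \<bar>a\<bar> + w"
        using \<beta> \<open>0 \<le> w\<close> abs_triangle_ineq[of "\<alpha> + \<beta> * a" w] abs_triangle_ineq[of \<alpha> "\<beta> * a"] by (simp add: abs_mult)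
      then have "s * \<bar>\<alpha> + \<beta> * a + w\<bar> \<le> s * (\<bar>\<alpha>\<bar> + \<beta> * \<bar>a\<bar> + w)" using s by (intro mult_left_mono) auto
      then show "s * \<bar>\<alpha> + \<beta> * a + w\<bar> \<le> s * (\<bar>\<alpha>\<bar> + \<beta> * \<bar>a\<bar>) + s * w + 0 * w\<^sup>2"
        by (simp add: algebra_simps)
    qed (use s \<beta> in auto)
    also have "s * (\<bar>\<alpha>\<bar> + \<beta> * \<bar>a\<bar>) + s * shock_mean + 0 * shock_square_mean \<le> s * \<beta> * \<bar>a\<bar> + k / 2"
    proof -
      have "s * (\<bar>\<alpha>\<bar> + shock_mean) \<le> s * ca" using s by (intro mult_left_mono) (auto simp: ca_def)
      also have "\<dots> = k / 2" using ca by (simp add: s_def)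
      finally show ?thesis by (simp add: algebra_simps)
    qed
    finally have level: "(\<integral>\<^sup>+w. ennreal (s * \<bar>\<alpha> + \<beta> * a + w\<bar>) \<partial>W) \<le> ennreal (s * \<beta> * \<bar>a\<bar> + k / 2)"
      by (simp add: ennreal_leI)
    have "avg (\<lambda>(a, d). f d + ennreal (s * \<bar>a\<bar>)) x
        = (\<integral>\<^sup>+w. f (ratio_step \<beta> d w) \<partial>W) + (\<integral>\<^sup>+w. ennreal (s * \<bar>\<alpha> + \<beta> * a + w\<bar>) \<partial>W)"
      unfolding avg_def x step_def by (simp add: nn_integral_add)
    also have "\<dots> \<le> (\<integral>\<^sup>+w. f (ratio_step \<beta> d w) \<partial>W) + ennreal (s * \<beta> * \<bar>a\<bar> + k / 2)"
      using level by (intro add_left_mono)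
    finally have "avg (\<lambda>(a, d). f d + ennreal (s * \<bar>a\<bar>)) x + ennreal (k / 2)
        \<le> (\<integral>\<^sup>+w. f (ratio_step \<beta> d w) \<partial>W) + ennreal (s * \<beta> * \<bar>a\<bar> + k / 2) + ennreal (k / 2)"
      by (intro add_right_mono)
    also have "\<dots> = ((\<integral>\<^sup>+w. f (ratio_step \<beta> d w) \<partial>W) + ennreal k) + ennreal (s * \<beta> * \<bar>a\<bar>)"
    proof -
      have "ennreal (s * \<beta> * \<bar>a\<bar> + k / 2) + ennreal (k / 2) = ennreal k + ennreal (s * \<beta> * \<bar>a\<bar>)"
        using s k \<beta> by (subst (1 2) ennreal_plus[symmetric]) auto
      then show ?thesis by (simp add: add.assoc)
    qed
    also have "\<dots> \<le> (f d + ennreal b * indicator D d) + ennreal (s * \<beta> * \<bar>a\<bar>)"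
      by (intro add_right_mono drift)
    also have "\<dots> \<le> (f d + ennreal (s * \<bar>a\<bar>)) + ennreal b * indicator ({-A..A} \<times> D) x"
    proof (cases "d \<in> D \<and> A < \<bar>a\<bar>")
      case True
      then have "b \<le> s * (1 - \<beta>) * \<bar>a\<bar>" using s \<beta> by (simp add: A_def field_simps)
      then have "ennreal (b + s * \<beta> * \<bar>a\<bar>) \<le> ennreal (s * \<bar>a\<bar>)"
        by (intro ennreal_leI) (simp add: algebra_simps)
      then have "ennreal b + ennreal (s * \<beta> * \<bar>a\<bar>) \<le> ennreal (s * \<bar>a\<bar>)"
        using b s \<beta> by (subst ennreal_plus[symmetric]) auto
      then show ?thesis using True by (auto simp: x indicator_def add.assoc intro!: add_left_mono)
    next
      case False
      have "s * \<beta> * \<bar>a\<bar> \<le> s * \<bar>a\<bar>" using s \<beta> by (intro mult_right_mono) auto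
      then have "ennreal (s * \<beta> * \<bar>a\<bar>) \<le> ennreal (s * \<bar>a\<bar>)" by (rule ennreal_leI)
      moreover have "(indicator D d :: ennreal) \<le> indicator ({-A..A} \<times> D) x"
        using False by (auto simp: x indicator_def abs_le_iff)
      ultimately have "(f d + ennreal (s * \<beta> * \<bar>a\<bar>)) + ennreal b * indicator D d
          \<le> (f d + ennreal (s * \<bar>a\<bar>)) + ennreal b * indicator ({-A..A} \<times> D) x"
        by (intro add_mono mult_left_mono) auto
      then show ?thesis by (simp only: add_ac)
    qed
    finally show ?thesis by (simp add: x)
  qed
  with that[of s A] s show ?thesis by blast
qed

end

section \<open>Negative exponent: the ratio converges\<close>

lemma borel_measurable_fst_real [measurable]: "fst \<in> (borel :: (real \<times> real) measure) \<rightarrow>\<^sub>M borel"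
  and borel_measurable_snd_real [measurable]: "snd \<in> (borel :: (real \<times> real) measure) \<rightarrow>\<^sub>M borel"
  by (auto intro!: borel_measurable_continuous_onI continuous_intros)

lemma contract_quadratic:
  assumes "\<bar>d\<bar> \<le> 2" shows "\<bar>contract d - d / 2\<bar> \<le> d\<^sup>2 / 4"
proof -
  define y where "y = - d / 2"
  have y: "\<bar>y\<bar> \<le> 1" using assms by (simp add: y_def)
  have "exp y \<le> 1 + y + y\<^sup>2"
  proof (cases "0 \<le> y")
    case True
    then show ?thesis using y by (intro exp_bound) auto
  next
    case False
    define z where "z = - y"
    have z: "0 \<le> z" using False by (simp add: z_def)
    have "1 \<le> (1 - z + z\<^sup>2) * (1 + z + z\<^sup>2 / 2)"
    proof -
      have "(1 - z + z\<^sup>2) * (1 + z + z\<^sup>2 / 2) = 1 + (z\<^sup>2 / 2 + z ^ 3 / 2 + z ^ 4 / 2)"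
        by (simp add: field_simps eval_nat_numeral)
      then show ?thesis using z by simp
    qed
    also have "\<dots> \<le> (1 - z + z\<^sup>2) * exp z"
    proof (rule mult_left_mono)
      show "1 + z + z\<^sup>2 / 2 \<le> exp z" by (rule exp_lower_Taylor_quadratic[OF z])
      have "0 \<le> (1 - z)\<^sup>2 + z" using z by simp
      then show "0 \<le> 1 - z + z\<^sup>2" by (simp add: power2_eq_square algebra_simps)
    qed
    finally have "exp (- z) \<le> 1 - z + z\<^sup>2" by (simp add: exp_minus field_simps)
    then show ?thesis by (simp add: z_def)
  qed
  then show ?thesis using exp_ge_add_one_self[of y]
    by (simp add: contract_def y_def power2_eq_square)
qed

text \<open>The linearization \<open>\<beta> - w / 2\<close> with the quadratic error of \<open>contract\<close>.\<close>

lemma abs_ratio_step_local: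
  assumes "\<bar>d\<bar> \<le> e" "e \<le> 1" "0 \<le> w"
  shows "\<bar>ratio_step \<beta> d w\<bar> \<le> \<bar>d\<bar> * (\<bar>\<beta> - w / 2\<bar> + w * e)"
proof -
  have "ratio_step \<beta> d w = d * (\<beta> - w / 2) - w * (contract d - d / 2)"
    by (simp add: ratio_step_def algebra_simps)
  then have "\<bar>ratio_step \<beta> d w\<bar> \<le> \<bar>d\<bar> * \<bar>\<beta> - w / 2\<bar> + w * \<bar>contract d - d / 2\<bar>"
    using assms abs_triangle_ineq4[of "d * (\<beta> - w / 2)" "w * (contract d - d / 2)"] by (simp add: abs_mult)
  also have "w * \<bar>contract d - d / 2\<bar> \<le> w * (\<bar>d\<bar> * e)"
  proof (rule mult_left_mono)
    have "\<bar>contract d - d / 2\<bar> \<le> d\<^sup>2 / 4" using assms by (intro contract_quadratic) auto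
    also have "\<dots> \<le> \<bar>d\<bar> * \<bar>d\<bar>" by (simp add: power2_eq_square)
    also have "\<dots> \<le> \<bar>d\<bar> * e" using assms by (intro mult_left_mono) auto
    finally show "\<bar>contract d - d / 2\<bar> \<le> \<bar>d\<bar> * e" .
  qed (use assms in auto)
  finally show ?thesis by (simp add: algebra_simps)
qed

lemma powr_root_bounds:
  fixes y :: real
  assumes y: "0 < y" and n: "1 \<le> n"
  shows "ln y \<le> real n * (y powr (1 / real n) - 1)"
    and "real n * (y powr (1 / real n) - 1) \<le> ln y * y powr (1 / real n)"
    and "real n * (y powr (1 / real n) - 1) \<le> y"
proof -
  have e: "y powr (1 / real n) = exp (ln y / real n)" using y by (simp add: powr_def)
  have "1 + ln y / real n \<le> exp (ln y / real n)" by (rule exp_ge_add_one_self)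
  then have "ln y / real n \<le> exp (ln y / real n) - 1" by linarith
  then have "real n * (ln y / real n) \<le> real n * (exp (ln y / real n) - 1)"
    by (rule mult_left_mono) simp
  then show "ln y \<le> real n * (y powr (1 / real n) - 1)" using n e by simp
  have "1 - ln y / real n \<le> exp (- (ln y / real n))"
    using exp_ge_add_one_self[of "- (ln y / real n)"] by simp
  then have "(1 - ln y / real n) * exp (ln y / real n) \<le> exp (- (ln y / real n)) * exp (ln y / real n)"
    by (intro mult_right_mono) auto
  then have "(1 - ln y / real n) * exp (ln y / real n) \<le> 1" by (simp add: exp_minus_inverse mult.commute)
  then have "real n * (exp (ln y / real n) - 1) \<le> real n * (ln y / real n * exp (ln y / real n))"
    by (intro mult_left_mono) (auto simp: algebra_simps)
  then show "real n * (y powr (1 / real n) - 1) \<le> ln y * y powr (1 / real n)" using n e by simp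
  have "y powr (1 / real n) * 1 powr (1 - 1 / real n) \<le> (1 / real n) * y + (1 - 1 / real n) * 1"
    using y n by (intro Youngs_inequality_0) (auto simp: field_simps)
  then have "real n * (y powr (1 / real n) - 1) \<le> real n * ((1 / real n) * y - 1 / real n)"
    by (intro mult_left_mono) (auto simp: algebra_simps)
  also have "\<dots> \<le> y" using n by (simp add: right_diff_distrib)
  finally show "real n * (y powr (1 / real n) - 1) \<le> y" .
qed

text \<open>The derivative of \<open>y powr s\<close> at \<open>s = 0\<close>, with \<open>s = 1 / n\<close> and a base that moves with \<open>n\<close>: the
  radius of the neighbourhood and the power shrink together in the application.\<close>

lemma powr_root_tendsto_ln:
  fixes m w :: real
  assumes "0 < m" "0 \<le> w"
  shows "(\<lambda>n. real n * ((m + w / real n) powr (1 / real n) - 1)) \<longlonglongrightarrow> ln m"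
proof (rule tendsto_sandwich)
  have y: "(\<lambda>n. m + w / real n) \<longlonglongrightarrow> m + 0" by (intro tendsto_intros lim_const_over_n)
  have pos: "0 < m + w / real n" for n using assms by (simp add: add_pos_nonneg)
  have l: "(\<lambda>n. ln (m + w / real n)) \<longlonglongrightarrow> ln m" using tendsto_ln[OF y] assms by simp
  show "(\<lambda>n. ln (m + w / real n)) \<longlonglongrightarrow> ln m" by (rule l)
  have "(\<lambda>n. (m + w / real n) powr (1 / real n)) \<longlonglongrightarrow> (m + 0) powr 0"
    by (intro tendsto_powr y lim_const_over_n) (use assms in auto)
  from tendsto_mult[OF l this]
  show "(\<lambda>n. ln (m + w / real n) * (m + w / real n) powr (1 / real n)) \<longlonglongrightarrow> ln m"
    using assms by simp
  show "\<forall>\<^sub>F n in sequentially. ln (m + w / real n) \<le> real n * ((m + w / real n) powr (1 / real n) - 1)"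
    using eventually_ge_at_top[of 1] by eventually_elim (rule powr_root_bounds[OF pos])
  show "\<forall>\<^sub>F n in sequentially. real n * ((m + w / real n) powr (1 / real n) - 1)
      \<le> ln (m + w / real n) * (m + w / real n) powr (1 / real n)"
    using eventually_ge_at_top[of 1] by eventually_elim (rule powr_root_bounds[OF pos])
qed

context egarch_chain
begin

lemma prob_space_W: "prob_space W"
  by unfold_locales

lemma step_tendsto: "((\<lambda>(y, w). step y w) \<longlongrightarrow> step x w0) (nhds x \<times>\<^sub>F nhds w0)"
proof -
  have "continuous_on UNIV (\<lambda>z :: (real \<times> real) \<times> real. (\<alpha> + \<beta> * fst (fst z) + snd z, ratio_step \<beta> (snd (fst z)) (snd z)))"
    unfolding ratio_step_def by (intro continuous_intros)
  then have "continuous_on UNIV (\<lambda>(y, w). step y w)" by (simp add: step_def split_beta')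
  then have "isCont (\<lambda>(y, w). step y w) (x, w0)"
    by (metis UNIV_I continuous_on_eq_continuous_at open_UNIV)
  then have "((\<lambda>(y, w). step y w) \<longlongrightarrow> (\<lambda>(y, w). step y w) (x, w0)) (at (x, w0))"
    unfolding isCont_def .
  then have "((\<lambda>(y, w). step y w) \<longlongrightarrow> (\<lambda>(y, w). step y w) (x, w0)) (nhds (x, w0))"
    by (rule iffD1[OF tendsto_at_iff_tendsto_nhds])
  then show ?thesis by (simp add: nhds_prod)
qed

text \<open>A negative mean of the logarithm gives a contraction of a small power in mean, because
  \<open>(y powr s - 1) / s\<close> tends to \<open>ln y\<close> under an integrable bound. The same \<open>s\<close> serves as radius of the
  neighbourhood, where \<open>\<bar>w\<bar> * s\<close> dominates the linearization error.\<close>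

lemma contraction_moment:
  assumes \<tau>: "0 < \<tau>" and neg: "(LINT w|W. ln (max \<tau> \<bar>\<beta> - w / 2\<bar>)) < 0"
  obtains s where "0 < s" "s \<le> 1"
    "(\<integral>\<^sup>+w. ennreal ((max \<tau> \<bar>\<beta> - w / 2\<bar> + \<bar>w\<bar> * s) powr s) \<partial>W) < 1"
proof -
  let ?m = "\<lambda>w. max \<tau> \<bar>\<beta> - w / 2\<bar>"
  let ?g = "\<lambda>n w. real n * ((?m w + \<bar>w\<bar> / real n) powr (1 / real n) - 1)"
  let ?b = "\<lambda>w. \<bar>ln \<tau>\<bar> + \<tau> + \<beta> + 2 * \<bar>w\<bar>"
  have bint: "integrable W ?b" using integrable_shock by simp
  have dom: "norm (?g (Suc n) w) \<le> ?b w" for n w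
  proof -
    let ?y = "?m w + \<bar>w\<bar> / real (Suc n)"
    have y0: "\<tau> \<le> ?y" by (simp add: add_increasing2)
    then have y: "0 < ?y" using \<tau> by linarith
    have "\<bar>w\<bar> / real (Suc n) \<le> \<bar>w\<bar>" by (simp add: field_simps)
    then have "?y \<le> \<tau> + \<beta> + 2 * \<bar>w\<bar>" using \<tau> \<beta> by (auto simp: max_def)
    moreover have "ln \<tau> \<le> ln ?y" using y0 \<tau> y by (subst ln_le_cancel_iff) auto
    moreover have "ln ?y \<le> ?g (Suc n) w" "?g (Suc n) w \<le> ?y"
      using powr_root_bounds(1,3)[OF y, of "Suc n"] by auto
    moreover have "0 \<le> \<tau> + \<beta> + 2 * \<bar>w\<bar>" using \<tau> \<beta> by simp
    ultimately show ?thesis unfolding real_norm_def abs_le_iff by linarith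
  qed
  have "(\<lambda>n. LINT w|W. ?g (Suc n) w) \<longlonglongrightarrow> (LINT w|W. ln (?m w))"
  proof (rule integral_dominated_convergence[OF _ _ bint])
    show "AE w in W. (\<lambda>n. ?g (Suc n) w) \<longlonglongrightarrow> ln (?m w)"
    proof (rule AE_I2)
      fix w
      have "(\<lambda>n. ?g n w) \<longlonglongrightarrow> ln (?m w)" using \<tau> by (intro powr_root_tendsto_ln) auto
      then show "(\<lambda>n. ?g (Suc n) w) \<longlonglongrightarrow> ln (?m w)" by (rule LIMSEQ_Suc)
    qed
    show "AE w in W. norm (?g (Suc n) w) \<le> ?b w" for n by (rule AE_I2) (rule dom)
  qed measurable
  from order_tendstoD(2)[OF this neg] obtain n where n: "(LINT w|W. ?g (Suc n) w) < 0"
    by (auto simp: eventually_sequentially)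
  define s where "s = 1 / real (Suc n)"
  let ?f = "\<lambda>w. (?m w + \<bar>w\<bar> * s) powr s"
  have gint: "integrable W (?g (Suc n))"
    by (rule Bochner_Integration.integrable_bound[OF bint]) (measurable, rule AE_I2, unfold real_norm_def[of "?b _"], rule order_trans[OF dom abs_ge_self])
  have f_eq: "?f w = 1 + s * ?g (Suc n) w" for w by (simp add: s_def)
  have fint: "integrable W ?f" unfolding f_eq using gint by simp
  have "(LINT w|W. ?f w) = 1 + s * (LINT w|W. ?g (Suc n) w)"
    unfolding f_eq using gint by (simp add: total_mass)
  also have "\<dots> < 1" using mult_pos_neg[OF _ n, of s] by (simp add: s_def)
  finally have "(LINT w|W. ?f w) < 1" .
  moreover have "(\<integral>\<^sup>+w. ennreal (?f w) \<partial>W) = ennreal (LINT w|W. ?f w)"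
    using fint by (intro nn_integral_eq_integral) auto
  ultimately have "(\<integral>\<^sup>+w. ennreal (?f w) \<partial>W) < 1"
    by (simp add: ennreal_less_one_iff)
  with that[of s] show ?thesis by (simp add: s_def)
qed

lemma nn_integral_prod_coordinates:
  assumes [measurable]: "f \<in> borel_measurable W"
  shows "(\<integral>\<^sup>+w. (\<Prod>i<n. f (w i)) \<partial>S) = (\<integral>\<^sup>+x. f x \<partial>W) ^ n"
proof (induction n)
  case 0
  then show ?case by (simp add: P.emeasure_space_1)
next
  case (Suc n)
  have "(\<integral>\<^sup>+w. (\<Prod>i<Suc n. f (w i)) \<partial>S)
      = (\<integral>\<^sup>+w. (\<Prod>i<Suc n. f (w i)) \<partial>distr (W \<Otimes>\<^sub>M S) S (\<lambda>(s, w). case_nat s w))"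
    by (simp add: PiM_iter)
  also have "\<dots> = (\<integral>\<^sup>+z. (\<Prod>i<Suc n. f (case_nat (fst z) (snd z) i)) \<partial>(W \<Otimes>\<^sub>M S))"
    by (subst nn_integral_distr) (auto simp: split_beta')
  also have "\<dots> = (\<integral>\<^sup>+z. f (fst z) * (\<Prod>i<n. f (snd z i)) \<partial>(W \<Otimes>\<^sub>M S))"
    by (simp add: prod.lessThan_Suc_shift del: prod.lessThan_Suc)
  also have "\<dots> = (\<integral>\<^sup>+x. \<integral>\<^sup>+w. f x * (\<Prod>i<n. f (w i)) \<partial>S \<partial>W)"
    by (subst P.nn_integral_fst[symmetric]) auto
  also have "\<dots> = (\<integral>\<^sup>+x. f x \<partial>W) * (\<integral>\<^sup>+w. (\<Prod>i<n. f (w i)) \<partial>S)"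
    by (simp add: nn_integral_cmult nn_integral_multc)
  finally show ?case using Suc by simp
qed

definition ratio_to_0 :: "(nat \<Rightarrow> real \<times> real) set" where
  "ratio_to_0 = {y. (\<lambda>n. snd (y n)) \<longlonglongrightarrow> 0}"

lemma ratio_to_0_sets [measurable]: "ratio_to_0 \<in> sets paths"
proof -
  have "ratio_to_0 = {y \<in> space paths. (\<lambda>n. snd (y n)) \<longlonglongrightarrow> 0}"
    by (auto simp: ratio_to_0_def space_PiM PiE_def)
  also have "\<dots> \<in> sets paths" by (rule sets_Collect_tendsto) measurable
  finally show ?thesis .
qed

lemma ratio_to_0_invariant: "shift_invariant ratio_to_0"
  unfolding shift_invariant_def ratio_to_0_def mem_Collect_eq
  by (intro allI filterlim_sequentially_Suc)

text \<open>The products of the local contraction factors to the power \<open>s\<close> have a finite expected sum, so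
  with probability at least one half this sum is below a constant \<open>c\<close>. On that event an orbit that
  starts in a correspondingly smaller neighbourhood never leaves the region where the linearization is
  valid, and it converges to \<open>0\<close>.\<close>

lemma ratio_to_0_local:
  assumes \<tau>: "0 < \<tau>" and neg: "(LINT w|W. ln (max \<tau> \<bar>\<beta> - w / 2\<bar>)) < 0"
  obtains \<delta> where "0 < \<delta>" "\<And>a d. \<bar>d\<bar> < \<delta> \<Longrightarrow> ennreal (1 / 2) \<le> path_prob ratio_to_0 (a, d)"
proof -
  obtain s where s: "0 < s" "s \<le> 1"
    and moment: "(\<integral>\<^sup>+w. ennreal ((max \<tau> \<bar>\<beta> - w / 2\<bar> + \<bar>w\<bar> * s) powr s) \<partial>W) < 1"
    using contraction_moment[OF \<tau> neg] by blast
  define f where "f w = (max \<tau> \<bar>\<beta> - w / 2\<bar> + \<bar>w\<bar> * s) powr s" for w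
  have f0: "0 \<le> f w" for w by (simp add: f_def)
  have [measurable]: "f \<in> borel_measurable borel" unfolding f_def[abs_def] by measurable
  obtain \<rho> where \<rho>: "(\<integral>\<^sup>+w. ennreal (f w) \<partial>W) = ennreal \<rho>" "0 \<le> \<rho>" "\<rho> < 1"
    using moment unfolding f_def by (cases "\<integral>\<^sup>+w. ennreal ((max \<tau> \<bar>\<beta> - w / 2\<bar> + \<bar>w\<bar> * s) powr s) \<partial>W") (auto simp: ennreal_less_one_iff)
  define Mp where "Mp n w = (\<Prod>i<n. f (w i))" for n and w :: "nat \<Rightarrow> real"
  have Mp0: "0 \<le> Mp n w" for n w by (simp add: Mp_def prod_nonneg f0)
  have [measurable]: "Mp n \<in> borel_measurable S" for n unfolding Mp_def[abs_def] by measurable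
  define Z where "Z w = (\<Sum>n. ennreal (Mp n w))" for w
  have [measurable]: "Z \<in> borel_measurable S" unfolding Z_def[abs_def] by measurable
  define c where "c = 2 / (1 - \<rho>)"
  have c: "0 < c" using \<rho> by (simp add: c_def)
  have "(\<integral>\<^sup>+w. Z w \<partial>S) = (\<Sum>n. \<integral>\<^sup>+w. ennreal (Mp n w) \<partial>S)"
    unfolding Z_def by (intro nn_integral_suminf) measurable
  also have "\<dots> = (\<Sum>n. ennreal (\<rho> ^ n))"
  proof (rule suminf_cong)
    fix n
    have "(\<integral>\<^sup>+w. ennreal (Mp n w) \<partial>S) = (\<integral>\<^sup>+w. (\<Prod>i<n. ennreal (f (w i))) \<partial>S)"
      unfolding Mp_def by (simp add: prod_ennreal f0)
    also have "\<dots> = ennreal (\<rho> ^ n)"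
      using nn_integral_prod_coordinates[of "\<lambda>x. ennreal (f x)" n] \<rho> by (simp add: ennreal_power)
    finally show "(\<integral>\<^sup>+w. ennreal (Mp n w) \<partial>S) = ennreal (\<rho> ^ n)" .
  qed
  also have "\<dots> = ennreal (1 / (1 - \<rho>))"
  proof -
    have "(\<lambda>n. \<rho> ^ n) sums (1 / (1 - \<rho>))" using \<rho> by (intro geometric_sums) auto
    then show ?thesis using \<rho>(2) by (intro suminf_ennreal_eq) auto
  qed
  finally have EZ: "(\<integral>\<^sup>+w. Z w \<partial>S) = ennreal (1 / (1 - \<rho>))" .
  have "ennreal c * emeasure S {w \<in> space S. ennreal c \<le> Z w} \<le> (\<integral>\<^sup>+w. Z w \<partial>S)"
  proof -
    have "ennreal c * emeasure S {w \<in> space S. ennreal c \<le> Z w}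
        = (\<integral>\<^sup>+w. ennreal c * indicator {w \<in> space S. ennreal c \<le> Z w} w \<partial>S)"
      by (simp add: nn_integral_cmult)
    also have "\<dots> \<le> (\<integral>\<^sup>+w. Z w \<partial>S)" by (intro nn_integral_mono) (auto simp: indicator_def)
    finally show ?thesis .
  qed
  then have "ennreal (c * measure S {w \<in> space S. ennreal c \<le> Z w}) \<le> ennreal (1 / (1 - \<rho>))"
    using c unfolding EZ by (simp add: P.emeasure_eq_measure ennreal_mult)
  then have "c * measure S {w \<in> space S. ennreal c \<le> Z w} \<le> 1 / (1 - \<rho>)"
    using \<rho> by (subst (asm) ennreal_le_iff) auto
  then have Pbad: "measure S {w \<in> space S. ennreal c \<le> Z w} \<le> 1 / 2"
  proof -
    have "2 * measure S {w \<in> space S. ennreal c \<le> Z w} / (1 - \<rho>) \<le> 1 / (1 - \<rho>)"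
      using \<open>c * measure S {w \<in> space S. ennreal c \<le> Z w} \<le> 1 / (1 - \<rho>)\<close> by (simp add: c_def)
    then show ?thesis using \<rho> by (subst (asm) divide_le_cancel) auto
  qed
  have Pgood: "1 / 2 \<le> measure S {w \<in> space S. Z w < ennreal c}"
  proof -
    have "{w \<in> space S. Z w < ennreal c} = space S - {w \<in> space S. ennreal c \<le> Z w}" by auto
    then have "measure S {w \<in> space S. Z w < ennreal c} = 1 - measure S {w \<in> space S. ennreal c \<le> Z w}"
      using P.prob_compl[of "{w \<in> space S. ennreal c \<le> Z w}"] by simp
    then show ?thesis using Pbad by simp
  qed
  \<comment> \<open>Chosen such that a growth of \<open>\<bar>d\<bar> powr s\<close> by the factor \<open>c\<close> does not leave the ball of radius \<open>s\<close>.\<close>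
  define \<delta> where "\<delta> = (s powr s / c) powr (1 / s)"
  have \<delta>: "0 < \<delta>" using s c by (simp add: \<delta>_def)
  have \<delta>s: "\<delta> powr s * c = s powr s" using s c by (simp add: \<delta>_def powr_powr)
  have AE_nonneg: "AE w in S. \<forall>i. 0 \<le> w i"
    unfolding AE_all_countable
  proof
    fix i
    have "AE x in W. 0 \<le> x" by (rule nonneg)
    then show "AE w in S. 0 \<le> w i"
      by (intro AE_PiM_component[where M="\<lambda>_. W"]) (auto simp: prob_space_W)
  qed
  have "ennreal (1 / 2) \<le> path_prob ratio_to_0 (a, d)" if d: "\<bar>d\<bar> < \<delta>" for a d
  proof -
    have conv: "orbit (a, d) w \<in> ratio_to_0" if w: "\<forall>i. 0 \<le> w i" and Zw: "Z w < ennreal c" for w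
    proof -
      let ?D = "\<lambda>n. snd (orbit (a, d) w n)"
      have summ: "summable (\<lambda>n. Mp n w)"
        using Zw Mp0 unfolding Z_def by (intro summable_suminf_not_top) auto
      have Mpc: "Mp n w \<le> c" for n
      proof -
        have "ennreal (Mp n w) \<le> Z w" unfolding Z_def using sum_le_suminf[of "\<lambda>n. ennreal (Mp n w)" "{n}"] by simp
        then have "ennreal (Mp n w) \<le> ennreal c" using Zw by simp
        then show ?thesis using c by (simp add: ennreal_le_iff)
      qed
      have bound: "\<bar>?D n\<bar> powr s \<le> Mp n w * \<bar>d\<bar> powr s" for n
      proof (induction n)
        case 0
        then show ?case by (simp add: Mp_def)
      next
        case (Suc n)
        have "\<bar>?D n\<bar> powr s \<le> c * \<bar>d\<bar> powr s"
          using Suc Mpc[of n] by (meson mult_right_mono order_trans powr_ge_zero)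
        also have "\<dots> \<le> c * \<delta> powr s" using d c s by (intro mult_left_mono powr_mono2) auto
        also have "\<dots> = s powr s" using \<delta>s by (simp add: mult.commute)
        finally have small: "\<bar>?D n\<bar> \<le> s" using powr_less_mono2[of s s "\<bar>?D n\<bar>"] s by linarith
        have "\<bar>?D (Suc n)\<bar> \<le> \<bar>?D n\<bar> * (\<bar>\<beta> - w n / 2\<bar> + w n * s)"
          using abs_ratio_step_local[OF small s(2), of "w n" \<beta>] w by (simp add: step_def)
        also have "\<dots> \<le> \<bar>?D n\<bar> * (max \<tau> \<bar>\<beta> - w n / 2\<bar> + \<bar>w n\<bar> * s)"
          using w s by (intro mult_left_mono add_mono) auto
        finally have "\<bar>?D (Suc n)\<bar> powr s \<le> (\<bar>?D n\<bar> * (max \<tau> \<bar>\<beta> - w n / 2\<bar> + \<bar>w n\<bar> * s)) powr s"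
          using s by (intro powr_mono2) auto
        also have "\<dots> = \<bar>?D n\<bar> powr s * f (w n)"
          using s \<tau> by (simp add: f_def powr_mult)
        also have "\<dots> \<le> (Mp n w * \<bar>d\<bar> powr s) * f (w n)" using Suc f0 by (intro mult_right_mono) auto
        also have "\<dots> = Mp (Suc n) w * \<bar>d\<bar> powr s" by (simp add: Mp_def)
        finally show ?case .
      qed
      have "(\<lambda>n. \<bar>?D n\<bar> powr s) \<longlonglongrightarrow> 0"
      proof (rule tendsto_sandwich[OF _ _ tendsto_const])
        show "(\<lambda>n. Mp n w * \<bar>d\<bar> powr s) \<longlonglongrightarrow> 0"
          using tendsto_mult_left_zero[OF summable_LIMSEQ_zero[OF summ]] by simp
      qed (use bound in auto)
      then have "(\<lambda>n. (\<bar>?D n\<bar> powr s) powr (1 / s)) \<longlonglongrightarrow> 0 powr (1 / s)"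
        using s by (intro tendsto_powr2) (auto intro: tendsto_const)
      then have "(\<lambda>n. \<bar>?D n\<bar>) \<longlonglongrightarrow> 0" using s by (simp add: powr_powr)
      then show ?thesis by (simp add: ratio_to_0_def tendsto_rabs_zero_iff)
    qed
    have "ennreal (1 / 2) \<le> emeasure S {w \<in> space S. Z w < ennreal c}"
      using Pgood by (simp add: P.emeasure_eq_measure ennreal_leI del: ennreal_half)
    also have "\<dots> \<le> path_prob ratio_to_0 (a, d)"
      unfolding path_prob_def
    proof (intro emeasure_mono_AE)
      show "AE w in S. w \<in> {w \<in> space S. Z w < ennreal c} \<longrightarrow> w \<in> {w \<in> space S. orbit (a, d) w \<in> ratio_to_0}"
        using AE_nonneg by eventually_elim (use conv in auto)
    qed measurable
    finally show ?thesis .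
  qed
  with that[of \<delta>] \<delta> show ?thesis by blast
qed

text \<open>Zero shocks multiply the log-ratio by \<open>\<beta>\<close>, so every state is steered into the neighbourhood of
  \<open>ratio_to_0_local\<close>.\<close>

theorem ratio_vanishes:
  assumes \<tau>: "0 < \<tau>" and neg: "(LINT w|W. ln (max \<tau> \<bar>\<beta> - w / 2\<bar>)) < 0"
  shows "path_prob ratio_to_0 x = 1"
proof -
  let ?h = "path_prob ratio_to_0"
  have harmonic: "avg ?h = ?h" by (rule path_prob_harmonic[OF ratio_to_0_sets ratio_to_0_invariant])
  obtain \<delta> where \<delta>: "0 < \<delta>" "\<And>a d. \<bar>d\<bar> < \<delta> \<Longrightarrow> ennreal (1 / 2) \<le> ?h (a, d)"
    using ratio_to_0_local[OF \<tau> neg] by blast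
  have near: "bounded_below_near ?h (a, d)" if "\<beta> ^ n * \<bar>d\<bar> < \<delta>" for n a d
    using that
  proof (induction n arbitrary: a d)
    case 0
    have "open ((UNIV :: real set) \<times> {-\<delta><..<\<delta>})" by (intro open_Times) auto
    moreover have "(a, d) \<in> UNIV \<times> {-\<delta><..<\<delta>}" using 0 by auto
    moreover have "\<forall>y\<in>UNIV \<times> {-\<delta><..<\<delta>}. ennreal (1 / 2) \<le> ?h y" using \<delta> by (auto simp: abs_less_iff)
    ultimately have "\<forall>\<^sub>F y in nhds (a, d). ennreal (1 / 2) \<le> ?h y"
      unfolding eventually_nhds by blast
    then show ?case unfolding bounded_below_near_def by (intro exI[of _ "1/2"]) auto
  next
    case (Suc n)
    have "\<beta> ^ n * \<bar>\<beta> * d\<bar> < \<delta>" using Suc.prems \<beta> by (simp add: abs_mult mult_ac)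
    then have good: "bounded_below_near ?h (step (a, d) 0)"
      by (simp add: step_def ratio_step_def Suc.IH)
    show ?case
    proof (rule bounded_below_near_step[OF random_recursion_axioms sets_W harmonic step_tendsto _ good])
      fix U :: "real set" assume U: "open U" "0 \<in> U"
      then obtain e where e: "e > 0" "ball 0 e \<subseteq> U" using openE by blast
      have "0 < emeasure W {w. \<bar>w\<bar> < e}" by (rule near_0[OF e(1)])
      also have "\<dots> \<le> emeasure W U" using e U(1) by (intro emeasure_mono) (auto simp: sets_W)
      finally show "0 < emeasure W U" .
    qed
  qed
  have all_near: "bounded_below_near ?h x" for x
  proof -
    obtain a d where x: "x = (a, d)" by (cases x)
    have "(\<lambda>n. \<beta> ^ n * \<bar>d\<bar>) \<longlonglongrightarrow> 0 * \<bar>d\<bar>" using \<beta> by (intro tendsto_intros LIMSEQ_power_zero) auto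
    then have "\<forall>\<^sub>F n in sequentially. \<beta> ^ n * \<bar>d\<bar> < \<delta>" using \<delta>(1) by (intro order_tendstoD) auto
    then obtain n where "\<beta> ^ n * \<bar>d\<bar> < \<delta>" by (auto simp: eventually_sequentially)
    then show ?thesis unfolding x by (rule near)
  qed
  obtain K k where K: "1 \<le> K" "0 < k" and drift: "\<And>d. K < \<bar>d\<bar> \<Longrightarrow>
      (\<integral>\<^sup>+w. ennreal (ratio_size \<beta> (ratio_step \<beta> d w)) \<partial>W) + ennreal k \<le> ennreal (ratio_size \<beta> d)"
    using ratio_size_drift by blast
  define b where "b = shock_mean / (1 - \<beta>) + k"
  have b: "0 < b" using shock_mean_nonneg \<beta> K by (simp add: b_def add_nonneg_pos)
  have drift': "(\<integral>\<^sup>+w. ennreal (ratio_size \<beta> (ratio_step \<beta> d w)) \<partial>W) + ennreal k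
      \<le> ennreal (ratio_size \<beta> d) + ennreal b * indicator {-K..K} d" for d
  proof (cases "K < \<bar>d\<bar>")
    case True
    then show ?thesis using drift[OF True] by (simp add: add_increasing2)
  next
    case False
    have "(\<integral>\<^sup>+w. ennreal (ratio_size \<beta> (ratio_step \<beta> d w)) \<partial>W) + ennreal k
        \<le> ennreal (ratio_size \<beta> d + shock_mean / (1 - \<beta>)) + ennreal k"
      by (intro add_right_mono ratio_size_avg)
    also have "\<dots> = ennreal (ratio_size \<beta> d) + ennreal b"
      using ratio_size_nonneg[OF \<beta>, of d] shock_mean_nonneg \<beta> K unfolding b_def
      by (simp add: ennreal_plus[symmetric] add.assoc del: ennreal_plus)
    finally show ?thesis using False by (cases "d \<in> {-K..K}") auto
  qed
  obtain s A where s: "0 < s" and D: "\<And>x. avg (\<lambda>(a, d). ennreal (ratio_size \<beta> d) + ennreal (s * \<bar>a\<bar>)) x + ennreal (k / 2)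
        \<le> (case x of (a, d) \<Rightarrow> ennreal (ratio_size \<beta> d) + ennreal (s * \<bar>a\<bar>)) + ennreal b * indicator ({-A..A} \<times> {-K..K}) x"
    using drift_with_level[of "\<lambda>d. ennreal (ratio_size \<beta> d)" "{-K..K}" k b, OF _ _ K(2) b drift'] by auto
  have "compact ({-A..A} \<times> {-K..K})" by (intro compact_Times) auto
  from bounded_below_on_compact[OF this all_near] obtain c
    where c: "0 < c" "\<And>x. x \<in> {-A..A} \<times> {-K..K} \<Longrightarrow> ennreal c \<le> ?h x" by blast
  have lower: "ennreal (c * (k / 2) / (2 * b)) \<le> ?h x" for x
    by (rule harmonic_lower_bound[OF _ _ D _ b c(1) harmonic c(2)])
      (use K in \<open>auto simp: split_beta' borel_prod[symmetric] borel_closed closed_Times\<close>)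
  show ?thesis
    by (rule zero_one[OF ratio_to_0_sets ratio_to_0_invariant _ lower, where E=UNIV]) (use c K b in auto)
qed

end

section \<open>Positive exponent: a Lyapunov function off the diagonal\<close>

text \<open>The negative part of the logarithm of \<open>\<bar>x\<bar>\<close>: \<open>ennreal\<close> maps negative numbers to \<open>0\<close>, and the value at
  \<open>0\<close> is the limit \<open>\<infinity>\<close>.\<close>

definition neg_log :: "real \<Rightarrow> ennreal" where
  "neg_log x = (if x = 0 then \<infinity> else ennreal (- ln \<bar>x\<bar>))"

lemma neg_log_measurable [measurable]: "neg_log \<in> borel_measurable borel"
  unfolding neg_log_def[abs_def] by measurable

text \<open>Compare with \<open>2 / sqrt \<bar>v\<bar>\<close> on \<open>[-1, 1]\<close>.\<close>

lemma neg_log_integral_finite: "(\<integral>\<^sup>+v. neg_log v \<partial>lborel) < \<infinity>"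
proof -
  define q where "q v = ennreal (2 * v powr (-1/2)) * indicator {0..1} v" for v :: real
  have [measurable]: "q \<in> borel_measurable borel" unfolding q_def[abs_def] by measurable
  have "((\<lambda>x. x powr (-1/2)) has_integral (1 powr (-1/2 + 1) / (-1/2 + 1))) {0..1::real}"
    by (rule has_integral_powr_from_0) auto
  from has_integral_mult_right[OF this, of 2]
  have "((\<lambda>x. 2 * x powr (-1/2)) has_integral 4) {0..1::real}" by simp
  then have q: "(\<integral>\<^sup>+v. q v \<partial>lborel) = ennreal 4"
    unfolding q_def by (intro nn_integral_has_integral_lebesgue') auto
  have q': "(\<integral>\<^sup>+v. q (- v) \<partial>lborel) = ennreal 4"
    using nn_integral_real_affine[of q "-1" 0] q by simp
  have "AE v in lborel. v \<noteq> (0::real)" by (rule AE_lborel_singleton)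
  then have "(\<integral>\<^sup>+v. neg_log v \<partial>lborel) \<le> (\<integral>\<^sup>+v. q v + q (- v) \<partial>lborel)"
  proof (intro nn_integral_mono_AE, eventually_elim)
    case (elim v)
    have pos: "neg_log z \<le> q z" if "0 < z" for z
    proof (cases "z \<le> 1")
      case True
      have "ln (z powr (-1/2)) \<le> z powr (-1/2)" using that by (intro ln_bound) auto
      then have "- ln z \<le> 2 * z powr (-1/2)" using that by (simp add: ln_powr)
      then show ?thesis using that True by (simp add: neg_log_def q_def ennreal_leI)
    next
      case False
      then show ?thesis by (simp add: neg_log_def ennreal_neg)
    qed
    have "neg_log (- v) = neg_log v" by (simp add: neg_log_def)
    then show ?case using pos[of v] pos[of "- v"] elim
      by (cases "0 < v") (auto intro: add_increasing add_increasing2)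
  qed
  also have "\<dots> = ennreal 8" using q q' by (subst nn_integral_add) (auto simp: ennreal_plus[symmetric] simp del: ennreal_plus)
  also have "\<dots> < \<infinity>" by simp
  finally show ?thesis .
qed

text \<open>The shock may have an atom at \<open>0\<close> (if \<open>\<gamma> = \<bar>\<delta>\<bar>\<close>), which is the term \<open>f 0\<close>; otherwise its density is
  bounded above by \<open>B\<close> and, on every bounded part of the half line, bounded below. The number \<open>l\<close> plays
  the role of the exponent; a bound for all truncations avoids an integral of an unbounded function.\<close>

locale egarch_chain_expanding = egarch_chain +
  fixes B l :: real
  assumes B: "0 \<le> B"
    and upper: "\<And>f. f \<in> borel_measurable borel \<Longrightarrow>
      (\<integral>\<^sup>+w. f w \<partial>W) \<le> f 0 + ennreal B * (\<integral>\<^sup>+w. f w \<partial>lborel)"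
    and lower: "\<And>L. 0 < L \<Longrightarrow> \<exists>m>0. \<forall>f\<in>borel_measurable borel.
      ennreal m * (\<integral>\<^sup>+w. f w * indicator {0..L} w \<partial>lborel) \<le> (\<integral>\<^sup>+w. f w \<partial>W)"
    and l: "0 < l" and expanding: "\<And>\<tau>. 0 < \<tau> \<Longrightarrow> l \<le> (LINT w|W. ln (max \<tau> \<bar>\<beta> - w / 2\<bar>))"
begin

definition neg_log_mass :: real where "neg_log_mass = enn2real (\<integral>\<^sup>+v. neg_log v \<partial>lborel)"

lemma neg_log_mass: "(\<integral>\<^sup>+v. neg_log v \<partial>lborel) = ennreal neg_log_mass" "0 \<le> neg_log_mass"
  using neg_log_integral_finite by (auto simp: neg_log_mass_def)

text \<open>Substitute \<open>v = (t - w c) / \<tau>\<close> in the bounded density; the atom contributes the first term.\<close>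

lemma neg_log_affine:
  assumes \<tau>: "0 < \<tau>" and c: "c \<noteq> 0"
  shows "(\<integral>\<^sup>+w. neg_log ((t - w * c) / \<tau>) \<partial>W) \<le> neg_log (t / \<tau>) + ennreal (B * \<tau> * neg_log_mass / \<bar>c\<bar>)"
proof -
  have "ennreal neg_log_mass = ennreal \<bar>- c / \<tau>\<bar> * (\<integral>\<^sup>+w. neg_log (t / \<tau> + (- c / \<tau>) * w) \<partial>lborel)"
    unfolding neg_log_mass(1)[symmetric] using \<tau> c by (intro nn_integral_real_affine) auto
  also have "(\<lambda>w. neg_log (t / \<tau> + (- c / \<tau>) * w)) = (\<lambda>w. neg_log ((t - w * c) / \<tau>))"
    using \<tau> by (intro ext arg_cong[where f=neg_log]) (simp add: field_simps)
  finally have e: "ennreal neg_log_mass = ennreal (\<bar>c\<bar> / \<tau>) * (\<integral>\<^sup>+w. neg_log ((t - w * c) / \<tau>) \<partial>lborel)"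
    using \<tau> by simp
  have "ennreal (\<tau> / \<bar>c\<bar>) * ennreal neg_log_mass = (ennreal (\<tau> / \<bar>c\<bar>) * ennreal (\<bar>c\<bar> / \<tau>)) * (\<integral>\<^sup>+w. neg_log ((t - w * c) / \<tau>) \<partial>lborel)"
    unfolding e by (simp only: mult.assoc)
  also have "ennreal (\<tau> / \<bar>c\<bar>) * ennreal (\<bar>c\<bar> / \<tau>) = 1"
    using \<tau> c by (subst ennreal_mult[symmetric]) auto
  finally have "(\<integral>\<^sup>+w. neg_log ((t - w * c) / \<tau>) \<partial>lborel) = ennreal (\<tau> / \<bar>c\<bar> * neg_log_mass)"
    using \<tau> neg_log_mass(2) by (subst ennreal_mult) auto
  then have "ennreal B * (\<integral>\<^sup>+w. neg_log ((t - w * c) / \<tau>) \<partial>lborel) = ennreal (B * \<tau> * neg_log_mass / \<bar>c\<bar>)"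
    using B \<tau> neg_log_mass(2) by (simp add: ennreal_mult[symmetric] mult.assoc)
  then show ?thesis using upper[of "\<lambda>w. neg_log ((t - w * c) / \<tau>)"] by simp
qed

lemma neg_log_avg_away_from_0:
  assumes "0 < e"
  obtains C where "0 \<le> C" "\<And>d. e \<le> \<bar>d\<bar> \<Longrightarrow> (\<integral>\<^sup>+w. neg_log (ratio_step \<beta> d w) \<partial>W) \<le> ennreal C"
proof -
  define u where "u = contract e"
  have u: "0 < u" using contract_pos[OF assms] by (simp add: u_def)
  define C where "C = \<bar>ln (\<beta> * e)\<bar> + B * neg_log_mass / u"
  have C: "0 \<le> C" using B neg_log_mass u by (simp add: C_def)
  have "(\<integral>\<^sup>+w. neg_log (ratio_step \<beta> d w) \<partial>W) \<le> ennreal C" if d: "e \<le> \<bar>d\<bar>" for d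
  proof -
    have d0: "d \<noteq> 0" using d assms by auto
    have uc: "u \<le> \<bar>contract d\<bar>"
    proof (cases "0 \<le> d")
      case True
      then show ?thesis using d contract_bounds(1)[OF True] by (simp add: u_def contract_def)
    next
      case False
      have "exp (e / 2) \<le> exp (- d / 2)" using d False by simp
      moreover have "1 - exp (- e / 2) \<le> exp (e / 2) - 1"
      proof -
        have "exp (e / 2) * (1 - exp (- (e / 2))) = exp (e / 2) - 1"
          by (simp add: algebra_simps exp_minus_inverse)
        moreover have "1 * (1 - exp (- (e / 2))) \<le> exp (e / 2) * (1 - exp (- (e / 2)))"
          using assms by (intro mult_right_mono) auto
        ultimately show ?thesis by simp
      qed
      ultimately have "1 - exp (- e / 2) \<le> - (1 - exp (- d / 2))" by linarith
      moreover have "\<bar>contract d\<bar> = - contract d" using False contract_neg[of d] by simp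
      ultimately show ?thesis unfolding u_def contract_def by linarith
    qed
    have "(\<integral>\<^sup>+w. neg_log (ratio_step \<beta> d w) \<partial>W) \<le> neg_log (\<beta> * d) + ennreal (B * neg_log_mass / \<bar>contract d\<bar>)"
      using neg_log_affine[of 1 "contract d" "\<beta> * d"] d0 by (simp add: ratio_step_def)
    also have "neg_log (\<beta> * d) \<le> ennreal \<bar>ln (\<beta> * e)\<bar>"
    proof -
      have "\<beta> * e \<le> \<bar>\<beta> * d\<bar>" using d \<beta> by (simp add: abs_mult)
      then have "ln (\<beta> * e) \<le> ln \<bar>\<beta> * d\<bar>" using \<beta> assms d0 by (subst ln_le_cancel_iff) auto
      then show ?thesis using d0 \<beta> by (simp add: neg_log_def ennreal_leI)
    qed
    also have "ennreal (B * neg_log_mass / \<bar>contract d\<bar>) \<le> ennreal (B * neg_log_mass / u)"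
    proof (intro ennreal_leI divide_left_mono)
      show "0 < \<bar>contract d\<bar> * u" using uc u by (intro mult_pos_pos) linarith+
    qed (use uc B neg_log_mass in auto)
    finally show ?thesis using B neg_log_mass u by (simp add: C_def add_mono)
  qed
  with that[of C] C show ?thesis by blast
qed

text \<open>Near \<open>d = 0\<close> the ratio is multiplied by \<open>\<beta> - w c\<close> with \<open>c\<close> close to \<open>1 / 2\<close>. Split its logarithm at
  the level \<open>\<tau>\<close>: the truncated part is Lipschitz in \<open>c\<close> and has mean at least about \<open>l\<close>, and
  the rest is \<open>O(\<tau>)\<close> because the density of the shock is bounded.\<close>

lemma neg_log_drift:
  obtains e k where "0 < e" "e \<le> 1" "0 < k"
    "\<And>d. \<bar>d\<bar> < e \<Longrightarrow> (\<integral>\<^sup>+w. neg_log (ratio_step \<beta> d w) \<partial>W) + ennreal k \<le> neg_log d"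
proof -
  \<comment> \<open>With \<open>\<tau> \<le> \<beta>\<close> the atom of the shock at 0 does not contribute.\<close>
  define \<tau> where "\<tau> = min \<beta> (l / (16 * B * neg_log_mass + 1))"
  have den: "0 < 16 * B * neg_log_mass + 1" using B neg_log_mass(2) by (simp add: add_nonneg_pos)
  have \<tau>: "0 < \<tau>" "\<tau> \<le> \<beta>" using \<beta> l den by (auto simp: \<tau>_def)
  have \<tau>l: "4 * (B * \<tau> * neg_log_mass) \<le> l / 4"
  proof -
    have "\<tau> \<le> l / (16 * B * neg_log_mass + 1)" by (simp add: \<tau>_def)
    then have "\<tau> * (16 * B * neg_log_mass + 1) \<le> l" using den by (simp add: pos_le_divide_eq)
    then have "16 * (B * \<tau> * neg_log_mass) \<le> l" using \<tau> by (simp add: algebra_simps)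
    then show ?thesis by simp
  qed
  define Q where "Q = shock_mean / \<tau> + \<tau> + \<beta> + shock_mean"
  have Q: "0 < Q" using shock_mean_nonneg \<tau> \<beta> by (simp add: Q_def add_nonneg_pos add_pos_nonneg)
  define e where "e = min 1 (l / (4 * Q))"
  have e: "0 < e" "e \<le> 1" using l Q by (auto simp: e_def)
  have "(\<integral>\<^sup>+w. neg_log (ratio_step \<beta> d w) \<partial>W) + ennreal (l / 2) \<le> neg_log d" if d: "\<bar>d\<bar> < e" for d
  proof (cases "d = 0")
    case True
    then show ?thesis by (simp add: neg_log_def)
  next
    case d0: False
    define c where "c = contract d / d"
    have cd: "contract d = c * d" using d0 by (simp add: c_def)
    have "\<bar>c - 1 / 2\<bar> \<le> \<bar>d\<bar> / 4"
    proof -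
      have "\<bar>contract d - d / 2\<bar> \<le> d\<^sup>2 / 4" using d e by (intro contract_quadratic) auto
      moreover have "contract d - d / 2 = (c - 1 / 2) * d" by (simp add: cd algebra_simps)
      ultimately have "\<bar>c - 1 / 2\<bar> * \<bar>d\<bar> \<le> (\<bar>d\<bar> / 4) * \<bar>d\<bar>" by (simp add: abs_mult power2_eq_square abs_mult_self_eq)
      then show ?thesis using d0 by (subst (asm) mult_le_cancel_right_pos) auto
    qed
    then have c: "\<bar>c - 1 / 2\<bar> \<le> \<bar>d\<bar>" "1 / 4 \<le> c" "c \<le> 1" using d e by linarith+
    let ?y = "\<lambda>w. \<bar>\<beta> - w * c\<bar>"
    define L where "L = - ln \<bar>d\<bar>"
    \<comment> \<open>An integrable majorant of \<open>- ln (\<bar>d\<bar> * m)\<close>, where \<open>m\<close> is the truncated factor; the last term keeps it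
    nonnegative even when one step leaves the unit ball.\<close>
    define R where "R w = L - ln (max \<tau> \<bar>\<beta> - w / 2\<bar>) + w * (\<bar>d\<bar> / \<tau>) + \<bar>d\<bar> * (\<tau> + \<beta> + w)" for w
    have R: "neg_log (ratio_step \<beta> d w) \<le> ennreal (R w) + neg_log ((\<beta> - w * c) / \<tau>)" "0 \<le> R w"
      if w: "0 \<le> w" for w
    proof -
      let ?m = "max \<tau> (?y w)" and ?m' = "max \<tau> \<bar>\<beta> - w / 2\<bar>"
      have m: "0 < ?m" "0 < ?m'" "\<tau> \<le> ?m" using \<tau> by auto
      have "ln ?m' - ln ?m \<le> w * (\<bar>d\<bar> / \<tau>)"
      proof -
        have "ln ?m' - ln ?m \<le> (?m' - ?m) / ?m" by (rule ln_diff_le[OF m(2,1)])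
        also have "\<dots> \<le> (w * \<bar>d\<bar>) / \<tau>"
        proof (rule frac_le)
          have "\<bar>\<beta> - w / 2\<bar> \<le> ?y w + w * \<bar>c - 1 / 2\<bar>"
          proof -
            have "\<beta> - w / 2 = (\<beta> - w * c) + w * (c - 1 / 2)" by (simp add: algebra_simps)
            moreover have "\<bar>w * (c - 1 / 2)\<bar> = w * \<bar>c - 1 / 2\<bar>" using w by (simp add: abs_mult)
            ultimately show ?thesis using abs_triangle_ineq[of "\<beta> - w * c" "w * (c - 1 / 2)"] by linarith
          qed
          also have "w * \<bar>c - 1 / 2\<bar> \<le> w * \<bar>d\<bar>" using c w by (intro mult_left_mono) auto
          finally show "?m' - ?m \<le> w * \<bar>d\<bar>" using mult_nonneg_nonneg[OF w abs_ge_zero[of d]] by linarith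
        qed (use \<tau> w in auto)
        finally show ?thesis by simp
      qed
      moreover have "\<bar>d\<bar> * ?m \<le> \<bar>d\<bar> * (\<tau> + \<beta> + w)"
      proof (rule mult_left_mono)
        have "\<bar>w * c\<bar> \<le> w" "0 \<le> w * c" using w c by (auto simp: abs_mult mult_left_le)
        then show "?m \<le> \<tau> + \<beta> + w" using \<tau> \<beta> w by (auto simp: max_def)
      qed simp
      ultimately have le: "L - ln ?m + \<bar>d\<bar> * ?m \<le> R w" by (simp add: R_def)
      have z: "ln (\<bar>d\<bar> * ?m) \<le> \<bar>d\<bar> * ?m" using m d0 by (intro ln_bound) auto
      have "ln (\<bar>d\<bar> * ?m) = - L + ln ?m" using m d0 by (simp add: ln_mult L_def)
      with z le show Rw: "0 \<le> R w" by linarith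
      have le2: "L - ln ?m \<le> R w" using le mult_nonneg_nonneg[OF abs_ge_zero[of d] less_imp_le[OF m(1)]] by linarith
      show "neg_log (ratio_step \<beta> d w) \<le> ennreal (R w) + neg_log ((\<beta> - w * c) / \<tau>)"
      proof (cases "\<beta> - w * c = 0")
        case True
        then show ?thesis by (simp add: neg_log_def)
      next
        case False
        have \<phi>: "ratio_step \<beta> d w = d * (\<beta> - w * c)" by (simp add: ratio_step_def cd algebra_simps)
        have "neg_log (ratio_step \<beta> d w) = ennreal (L - ln (?y w))"
          using False d0 by (simp add: neg_log_def \<phi> abs_mult ln_mult L_def)
        also have "L - ln (?y w) = (L - ln ?m) + (ln ?m - ln (?y w))" by simp
        also have "ennreal \<dots> \<le> ennreal (R w + (ln ?m - ln (?y w)))"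
          using le2 by (intro ennreal_leI) simp
        also have "\<dots> = ennreal (R w) + ennreal (ln ?m - ln (?y w))"
          using Rw False by (intro ennreal_plus) auto
        also have "ennreal (ln ?m - ln (?y w)) \<le> neg_log ((\<beta> - w * c) / \<tau>)"
        proof -
          have "ln (\<bar>\<beta> - w * c\<bar> / \<tau>) = ln (?y w) - ln \<tau>" using False \<tau> by (simp add: ln_div)
          then have e: "neg_log ((\<beta> - w * c) / \<tau>) = ennreal (ln \<tau> - ln (?y w))"
            using False \<tau> by (simp add: neg_log_def)
          show ?thesis unfolding e
            by (cases "\<tau> \<le> ?y w") (auto simp: max_def)
        qed
        finally show ?thesis by (simp add: add_left_mono)
      qed
    qed
    have ln_int: "integrable W (\<lambda>w. ln (max \<tau> \<bar>\<beta> - w / 2\<bar>))" by (rule log_max_integrable[OF \<tau>(1)])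
    have Rint: "integrable W R" unfolding R_def[abs_def] using ln_int integrable_shock by simp
    have "(LINT w|W. R w) = L - (LINT w|W. ln (max \<tau> \<bar>\<beta> - w / 2\<bar>)) + \<bar>d\<bar> * Q"
      unfolding R_def Q_def shock_mean_def using ln_int integrable_shock
      by (simp add: total_mass algebra_simps)
    also have "\<dots> \<le> L - l + l / 4"
    proof -
      have "\<bar>d\<bar> * Q \<le> l / (4 * Q) * Q" using d Q by (intro mult_right_mono) (auto simp: e_def)
      then show ?thesis using expanding[OF \<tau>(1)] Q by simp
    qed
    finally have ER: "(LINT w|W. R w) \<le> L - l + l / 4" .
    have ER0: "0 \<le> (LINT w|W. R w)"
      using nonneg by (intro integral_nonneg_AE) (auto elim!: eventually_mono intro: R(2))
    have "(\<integral>\<^sup>+w. neg_log (ratio_step \<beta> d w) \<partial>W) \<le> (\<integral>\<^sup>+w. ennreal (R w) + neg_log ((\<beta> - w * c) / \<tau>) \<partial>W)"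
      using nonneg by (intro nn_integral_mono_AE) (auto elim!: eventually_mono intro: R(1))
    also have "\<dots> = (\<integral>\<^sup>+w. ennreal (R w) \<partial>W) + (\<integral>\<^sup>+w. neg_log ((\<beta> - w * c) / \<tau>) \<partial>W)"
      by (intro nn_integral_add) (auto simp: R_def)
    also have "(\<integral>\<^sup>+w. ennreal (R w) \<partial>W) = ennreal (LINT w|W. R w)"
      using Rint nonneg by (intro nn_integral_eq_integral) (auto elim!: eventually_mono intro: R(2))
    also have "(\<integral>\<^sup>+w. neg_log ((\<beta> - w * c) / \<tau>) \<partial>W) \<le> ennreal (l / 4)"
    proof -
      have "neg_log (\<beta> / \<tau>) = 0" using \<tau> \<beta> by (simp add: neg_log_def ennreal_neg)
      moreover have "B * \<tau> * neg_log_mass / \<bar>c\<bar> \<le> l / 4"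
      proof -
        have "B * \<tau> * neg_log_mass / \<bar>c\<bar> \<le> B * \<tau> * neg_log_mass / (1 / 4)"
          using c B \<tau> neg_log_mass by (intro divide_left_mono) auto
        also have "\<dots> = 4 * (B * \<tau> * neg_log_mass)" by simp
        also note \<tau>l
        finally show ?thesis .
      qed
      ultimately show ?thesis using neg_log_affine[of \<tau> c \<beta>] \<tau> c
          ennreal_leI[of "B * \<tau> * neg_log_mass / \<bar>c\<bar>" "l / 4"] by (auto elim: order_trans)
    qed
    finally have "(\<integral>\<^sup>+w. neg_log (ratio_step \<beta> d w) \<partial>W) + ennreal (l / 2)
        \<le> ennreal (LINT w|W. R w) + ennreal (l / 4) + ennreal (l / 2)" by (simp add: add_mono)
    also have "\<dots> = ennreal ((LINT w|W. R w) + l / 4 + l / 2)" using ER0 l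
      by (simp add: ennreal_plus[symmetric] del: ennreal_plus)
    also have "\<dots> \<le> ennreal L" using ER by (intro ennreal_leI) simp
    also have "\<dots> = neg_log d" using d0 by (simp add: neg_log_def L_def)
    finally show ?thesis .
  qed
  with that[of e "l / 2"] e l show ?thesis by auto
qed

text \<open>The weight \<open>\<theta>\<close> of the logarithmic barrier is so small that the barrier cannot spoil the drift of
  \<open>ratio_size\<close> far out; close to \<open>0\<close>, in turn, \<open>ratio_size\<close> is small compared with the drift of the
  barrier.\<close>

lemma expanding_drift:
  obtains f :: "real \<Rightarrow> ennreal" and r K k b :: real where "f \<in> borel_measurable borel" "\<And>d. d \<noteq> 0 \<Longrightarrow> f d < \<infinity>"
    "0 < r" "0 < k" "0 < b"
    "\<And>d. (\<integral>\<^sup>+w. f (ratio_step \<beta> d w) \<partial>W) + ennreal k \<le> f d + ennreal b * indicator {d. r \<le> \<bar>d\<bar> \<and> \<bar>d\<bar> \<le> K} d"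
proof -
  obtain e \<kappa> where e: "0 < e" "e \<le> 1" and \<kappa>: "0 < \<kappa>" and near: "\<And>d. \<bar>d\<bar> < e \<Longrightarrow>
      (\<integral>\<^sup>+w. neg_log (ratio_step \<beta> d w) \<partial>W) + ennreal \<kappa> \<le> neg_log d"
    using neg_log_drift by blast
  obtain C where C: "0 \<le> C" "\<And>d. e \<le> \<bar>d\<bar> \<Longrightarrow> (\<integral>\<^sup>+w. neg_log (ratio_step \<beta> d w) \<partial>W) \<le> ennreal C"
    using neg_log_avg_away_from_0[OF e(1)] by blast
  obtain K k where K: "1 \<le> K" "0 < k" and far: "\<And>d. K < \<bar>d\<bar> \<Longrightarrow>
      (\<integral>\<^sup>+w. ennreal (ratio_size \<beta> (ratio_step \<beta> d w)) \<partial>W) + ennreal k \<le> ennreal (ratio_size \<beta> d)"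
    using ratio_size_drift by blast
  define \<theta> where "\<theta> = k / (2 * (C + 1))"
  have \<theta>: "0 < \<theta>" using K C by (simp add: \<theta>_def add_nonneg_pos)
  have \<theta>C: "\<theta> * C \<le> k / 2"
  proof -
    have "\<theta> * C \<le> \<theta> * (C + 1)" using \<theta> by simp
    also have "\<dots> = k / 2" using C by (simp add: \<theta>_def field_simps)
    finally show ?thesis .
  qed
  define c1 where "c1 = (1 + shock_mean) / (1 - \<beta>)"
  have c1: "0 < c1" using shock_mean_nonneg \<beta> by (simp add: c1_def add_pos_nonneg)
  define r where "r = min e (\<theta> * \<kappa> / (2 * c1))"
  have r: "0 < r" "r \<le> e" using e \<theta> \<kappa> c1 by (auto simp: r_def)
  obtain C1 where C1: "0 \<le> C1" "\<And>d. r \<le> \<bar>d\<bar> \<Longrightarrow> (\<integral>\<^sup>+w. neg_log (ratio_step \<beta> d w) \<partial>W) \<le> ennreal C1"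
    using neg_log_avg_away_from_0[OF r(1)] by blast
  define k' where "k' = min (k / 2) (\<theta> * \<kappa> / 2)"
  have k': "0 < k'" "k' \<le> k / 2" "k' \<le> \<theta> * \<kappa> / 2" using K \<theta> \<kappa> by (auto simp: k'_def)
  define b where "b = shock_mean / (1 - \<beta>) + \<theta> * C1 + k'"
  have b: "0 < b" using shock_mean_nonneg \<beta> \<theta> C1 k' by (simp add: b_def add_nonneg_pos)
  define f where "f d = ennreal (ratio_size \<beta> d) + ennreal \<theta> * neg_log d" for d
  have [measurable]: "f \<in> borel_measurable borel" unfolding f_def[abs_def] by measurable
  have fin: "f d < \<infinity>" if "d \<noteq> 0" for d
    using that by (simp add: f_def neg_log_def ennreal_mult_less_top)
  have "(\<integral>\<^sup>+w. f (ratio_step \<beta> d w) \<partial>W) + ennreal k' \<le> f d + ennreal b * indicator {d. r \<le> \<bar>d\<bar> \<and> \<bar>d\<bar> \<le> K} d" for d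
  proof -
    let ?I = "\<integral>\<^sup>+w. ennreal (ratio_size \<beta> (ratio_step \<beta> d w)) \<partial>W" and ?J = "\<integral>\<^sup>+w. neg_log (ratio_step \<beta> d w) \<partial>W"
    have eq: "(\<integral>\<^sup>+w. f (ratio_step \<beta> d w) \<partial>W) = ?I + ennreal \<theta> * ?J"
      unfolding f_def by (simp add: nn_integral_add nn_integral_cmult)
    consider "\<bar>d\<bar> < r" | "r \<le> \<bar>d\<bar>" "\<bar>d\<bar> \<le> K" | "K < \<bar>d\<bar>" by linarith
    then show ?thesis
    proof cases
      case 1
      have "?I \<le> ennreal (\<bar>d\<bar> * (1 + shock_mean) / (1 - \<beta>))" using 1 r e by (intro ratio_size_avg_near_0) auto
      also have "\<bar>d\<bar> * (1 + shock_mean) / (1 - \<beta>) = \<bar>d\<bar> * c1" by (simp add: c1_def)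
      also have "\<bar>d\<bar> * c1 \<le> \<theta> * \<kappa> / (2 * c1) * c1" using 1 c1 by (intro mult_right_mono) (auto simp: r_def)
      also have "\<dots> = \<theta> * \<kappa> / 2" using c1 by simp
      finally have "?I \<le> ennreal (\<theta> * \<kappa> / 2)" by (simp add: ennreal_leI)
      moreover have "ennreal k' \<le> ennreal (\<theta> * \<kappa> / 2)" using k' by (intro ennreal_leI)
      ultimately have "?I + ennreal k' \<le> ennreal (\<theta> * \<kappa> / 2) + ennreal (\<theta> * \<kappa> / 2)" by (rule add_mono)
      also have "\<dots> = ennreal \<theta> * ennreal \<kappa>" using \<theta> \<kappa>
        by (subst ennreal_plus[symmetric]) (auto simp: ennreal_mult mult.commute)
      finally have "?I + ennreal k' + ennreal \<theta> * ?J \<le> ennreal \<theta> * ennreal \<kappa> + ennreal \<theta> * ?J" by (rule add_right_mono)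
      also have "\<dots> = ennreal \<theta> * (?J + ennreal \<kappa>)" by (simp add: distrib_left add.commute)
      also have "\<dots> \<le> ennreal \<theta> * neg_log d" using near[of d] 1 r by (intro mult_left_mono) auto
      also have "\<dots> \<le> f d" by (simp add: f_def)
      finally show ?thesis unfolding eq by (simp add: add_ac add_increasing2)
    next
      case 2
      have "?I + ennreal \<theta> * ?J \<le> ennreal (ratio_size \<beta> d + shock_mean / (1 - \<beta>)) + ennreal \<theta> * ennreal C1"
        using ratio_size_avg[of d] C1(2)[OF 2(1)] by (intro add_mono mult_left_mono) auto
      then have "?I + ennreal \<theta> * ?J + ennreal k' \<le> ennreal (ratio_size \<beta> d + shock_mean / (1 - \<beta>)) + ennreal \<theta> * ennreal C1 + ennreal k'"
        by (rule add_right_mono)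
      also have "\<dots> = ennreal (ratio_size \<beta> d + shock_mean / (1 - \<beta>) + \<theta> * C1 + k')"
        using ratio_size_nonneg[OF \<beta>, of d] shock_mean_nonneg \<beta> \<theta> C1 k'
        by (simp add: ennreal_mult[symmetric] ennreal_plus[symmetric] del: ennreal_plus)
      also have "ratio_size \<beta> d + shock_mean / (1 - \<beta>) + \<theta> * C1 + k' = ratio_size \<beta> d + b" by (simp add: b_def)
      also have "ennreal \<dots> = ennreal (ratio_size \<beta> d) + ennreal b"
        using ratio_size_nonneg[OF \<beta>, of d] b by (intro ennreal_plus) auto
      also have "\<dots> \<le> f d + ennreal b" by (intro add_right_mono) (simp add: f_def)
      finally show ?thesis unfolding eq using 2 by simp
    next
      case 3
      have "?J \<le> ennreal C" using 3 K e by (intro C(2)) auto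
      then have "ennreal \<theta> * ?J \<le> ennreal \<theta> * ennreal C" by (intro mult_left_mono) auto
      also have "\<dots> \<le> ennreal (k / 2)" using \<theta>C \<theta> C by (simp add: ennreal_mult[symmetric] ennreal_leI)
      finally have "?I + ennreal \<theta> * ?J + ennreal k' \<le> ?I + ennreal (k / 2) + ennreal (k / 2)"
        using k' by (intro add_mono ennreal_leI) auto
      also have "\<dots> = ?I + (ennreal (k / 2) + ennreal (k / 2))" by (rule add.assoc)
      also have "ennreal (k / 2) + ennreal (k / 2) = ennreal k" using K by (subst ennreal_plus[symmetric]) auto
      also have "?I + ennreal k \<le> ennreal (ratio_size \<beta> d)" by (rule far[OF 3])
      also have "\<dots> \<le> f d" by (simp add: f_def)
      finally show ?thesis unfolding eq by (simp add: add_increasing2)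
    qed
  qed
  with that[of f r k' b K] fin r k' b show ?thesis by auto
qed

end

section \<open>Two-step densities\<close>

lemma contract_has_derivative [derivative_intros]:
  assumes "(f has_real_derivative f') (at x)"
  shows "((\<lambda>x. contract (f x)) has_real_derivative exp (- f x / 2) / 2 * f') (at x)"
  unfolding contract_def by (auto intro!: derivative_eq_intros assms)

text \<open>The log-ratio after two steps from \<open>x\<close> with first shock \<open>w\<close>, when the second shock is the one that
  brings the log-volatility to \<open>z\<close>. In these coordinates two changes of one real variable
  replace a change of variables in the plane.\<close>

definition two_step_ratio :: "real \<Rightarrow> real \<Rightarrow> real \<Rightarrow> real \<times> real \<Rightarrow> real \<Rightarrow> real" where
  "two_step_ratio \<alpha> \<beta> z x w =
     ratio_step \<beta> (ratio_step \<beta> (snd x) w) (z - (\<alpha> + \<beta> * (\<alpha> + \<beta> * fst x + w)))"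

definition two_step_ratio_deriv :: "real \<Rightarrow> real \<Rightarrow> real \<Rightarrow> real \<times> real \<Rightarrow> real \<Rightarrow> real" where
  "two_step_ratio_deriv \<alpha> \<beta> z x w =
     \<beta> * (contract (ratio_step \<beta> (snd x) w) - contract (snd x))
     + (z - (\<alpha> + \<beta> * (\<alpha> + \<beta> * fst x + w))) * (exp (- ratio_step \<beta> (snd x) w / 2) / 2 * contract (snd x))"

lemma two_step_ratio_has_derivative:
  "(two_step_ratio \<alpha> \<beta> z x has_real_derivative two_step_ratio_deriv \<alpha> \<beta> z x w) (at w)"
  unfolding two_step_ratio_def[abs_def] two_step_ratio_deriv_def ratio_step_def
  by (auto intro!: derivative_eq_intros simp: field_simps)

text \<open>The derivative is positive once the second shock is large: the bound \<open>6\<close> beats \<open>\<beta> < 1\<close> because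
  \<open>exp (-1) \<ge> 1 / 3\<close>.\<close>

lemma two_step_ratio_deriv_bounds:
  assumes \<beta>: "0 < \<beta>" "\<beta> < 1" and d: "1 / 2 \<le> snd x" "snd x \<le> 2" and w: "0 \<le> w" "w \<le> \<beta> / 2"
    and v: "6 \<le> z - (\<alpha> + \<beta> * (\<alpha> + \<beta> * fst x + w))" "z - (\<alpha> + \<beta> * (\<alpha> + \<beta> * fst x + w)) \<le> 12"
  shows "0 < two_step_ratio_deriv \<alpha> \<beta> z x w" "two_step_ratio_deriv \<alpha> \<beta> z x w \<le> 7"
proof -
  let ?u = "contract (snd x)" and ?d = "ratio_step \<beta> (snd x) w" and ?v = "z - (\<alpha> + \<beta> * (\<alpha> + \<beta> * fst x + w))"
  have u: "0 < ?u" "?u \<le> 1" using d contract_pos[of "snd x"] contract_bounds(2)[of "snd x"] by auto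
  have "w * ?u \<le> \<beta> / 2 * 1" using u w by (intro mult_mono) auto
  moreover have "\<beta> * (1 / 2) \<le> \<beta> * snd x" "\<beta> * snd x \<le> 1 * 2" using \<beta> d by (intro mult_left_mono mult_mono; simp)+
  moreover have "0 \<le> w * ?u" using u w by simp
  ultimately have d1: "0 \<le> ?d" "?d \<le> 2" by (auto simp: ratio_step_def)
  have c1: "0 \<le> contract ?d" "contract ?d \<le> 1" using contract_bounds(1,2)[of ?d] d1 by auto
  have e3: "exp (1::real) \<le> 3" by (rule exp_le)
  have ex: "1 / 3 \<le> exp (- ?d / 2)" "exp (- ?d / 2) \<le> 1"
  proof -
    have "1 / 3 \<le> exp (- 1 :: real)" using e3 by (simp add: exp_minus field_simps)
    also have "\<dots> \<le> exp (- ?d / 2)" using d1 by simp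
    finally show "1 / 3 \<le> exp (- ?d / 2)" .
    show "exp (- ?d / 2) \<le> 1" using d1 by simp
  qed
  have lo: "6 * (1 / 3 / 2 * ?u) \<le> ?v * (exp (- ?d / 2) / 2 * ?u)"
    using v ex u by (intro mult_mono divide_right_mono) auto
  have "\<beta> * ?u < 1 * ?u" using \<beta> u by (intro mult_strict_right_mono) auto
  moreover have "0 \<le> \<beta> * contract ?d" using \<beta> c1 by simp
  ultimately show "0 < two_step_ratio_deriv \<alpha> \<beta> z x w"
    using lo unfolding two_step_ratio_deriv_def right_diff_distrib by linarith
  have "?v * (exp (- ?d / 2) / 2 * ?u) \<le> 12 * (1 / 2 * 1)"
    using v ex u by (intro mult_mono divide_right_mono) auto
  moreover have "\<beta> * contract ?d \<le> 1 * 1" using \<beta> c1 by (intro mult_mono) auto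
  moreover have "0 \<le> \<beta> * ?u" using \<beta> u by simp
  ultimately show "two_step_ratio_deriv \<alpha> \<beta> z x w \<le> 7"
    unfolding two_step_ratio_deriv_def right_diff_distrib by linarith
qed

lemma nn_integral_substitution_le:
  fixes f :: "real \<Rightarrow> ennreal"
  assumes f [measurable]: "f \<in> borel_measurable borel" and f1: "\<And>x. f x \<le> 1" and ab: "a \<le> b"
    and g: "\<And>x. a \<le> x \<Longrightarrow> x \<le> b \<Longrightarrow> (g has_real_derivative g' x) (at x)"
    and g': "continuous_on {a..b} g'" "\<And>x. a \<le> x \<Longrightarrow> x \<le> b \<Longrightarrow> 0 \<le> g' x" "\<And>x. a \<le> x \<Longrightarrow> x \<le> b \<Longrightarrow> g' x \<le> c"
    and c: "0 \<le> c"
  shows "(\<integral>\<^sup>+y. f y * indicator {g a..g b} y \<partial>lborel) \<le> ennreal c * (\<integral>\<^sup>+x. f (g x) * indicator {a..b} x \<partial>lborel)"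
proof -
  define F where "F y = enn2real (f y)" for y
  have [measurable]: "F \<in> borel_measurable borel" unfolding F_def[abs_def] by measurable
  have F: "f y = ennreal (F y)" "0 \<le> F y" for y
    unfolding F_def using f1[of y] by (auto simp: ennreal_enn2real_if top_unique)
  have cg: "continuous_on {a..b} g"
    by (rule DERIV_continuous_on) (use g in \<open>auto intro: has_field_derivative_at_within\<close>)
  have [measurable]: "(\<lambda>x. g x * indicator {a..b} x) \<in> borel_measurable borel"
    using borel_measurable_continuous_on_indicator[OF _ cg] by (simp add: mult.commute)
  have "(\<integral>\<^sup>+y. f y * indicator {g a..g b} y \<partial>lborel) = (\<integral>\<^sup>+y. ennreal (F y) * indicator {g a..g b} y \<partial>lborel)"
    by (simp add: F)
  also have "\<dots> = (\<integral>\<^sup>+y. ennreal (F y * indicator {g a..g b} y) \<partial>lborel)"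
    by (intro nn_integral_cong) (auto simp: indicator_def)
  also have "\<dots> = (\<integral>\<^sup>+x. ennreal (F (g x) * g' x * indicator {a..b} x) \<partial>lborel)"
    by (rule nn_integral_substitution[OF _ _ g'(1) _ ab])
       (use g g' in \<open>auto simp: set_borel_measurable_def\<close>)
  also have "\<dots> \<le> (\<integral>\<^sup>+x. ennreal c * (f (g x * indicator {a..b} x) * indicator {a..b} x) \<partial>lborel)"
  proof (intro nn_integral_mono)
    fix x
    show "ennreal (F (g x) * g' x * indicator {a..b} x) \<le> ennreal c * (f (g x * indicator {a..b} x) * indicator {a..b} x)"
    proof (cases "x \<in> {a..b}")
      case True
      then have "F (g x) * g' x \<le> c * F (g x)" using g'(3)[of x] F(2)[of "g x"] by (simp add: mult.commute mult_right_mono)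
      then have "ennreal (F (g x) * g' x) \<le> ennreal c * ennreal (F (g x))"
        using c F(2) by (simp add: ennreal_mult[symmetric] ennreal_leI)
      then show ?thesis using True by (simp add: F(1))
    qed simp
  qed
  also have "\<dots> = ennreal c * (\<integral>\<^sup>+x. f (g x * indicator {a..b} x) * indicator {a..b} x \<partial>lborel)"
    by (intro nn_integral_cmult) measurable
  also have "(\<integral>\<^sup>+x. f (g x * indicator {a..b} x) * indicator {a..b} x \<partial>lborel) = (\<integral>\<^sup>+x. f (g x) * indicator {a..b} x \<partial>lborel)"
    by (intro nn_integral_cong) (auto simp: indicator_def)
  finally show ?thesis .
qed

context egarch_chain_expanding
begin

lemma avg_lower:
  assumes "0 < L"
  obtains m where "0 < m" "\<And>h x. h \<in> borel_measurable borel \<Longrightarrow>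
    ennreal m * (\<integral>\<^sup>+w. h (step x w) * indicator {0..L} w \<partial>lborel) \<le> avg h x"
proof -
  obtain m where m: "0 < m" "\<And>f. f \<in> borel_measurable borel \<Longrightarrow>
      ennreal m * (\<integral>\<^sup>+w. f w * indicator {0..L} w \<partial>lborel) \<le> (\<integral>\<^sup>+w. f w \<partial>W)"
    using lower[OF assms] by blast
  have "ennreal m * (\<integral>\<^sup>+w. h (step x w) * indicator {0..L} w \<partial>lborel) \<le> avg h x"
    if h [measurable]: "h \<in> borel_measurable borel" for h x
  proof -
    have "(\<lambda>w. h (step x w)) \<in> borel_measurable borel"
      using measurable_cong_sets[OF sets_W refl, of borel] by measurable
    from m(2)[OF this] show ?thesis by (simp add: avg_def)
  qed
  with that[of m] m show ?thesis by blast
qed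

text \<open>For each fixed \<open>z\<close>, the second coordinate sweeps an interval as the first shock runs through
  \<open>[0, \<beta> / 2]\<close>. By continuity this interval contains a fixed \<open>[p, q]\<close> for all \<open>z\<close> and \<open>x\<close> close to the
  base point, so one box serves a whole neighbourhood of \<open>(a0, 1)\<close>.\<close>

lemma harmonic_two_step_lower:
  obtains m J p q a' where "0 < (m::real)" "a' < (J::real)" "p < (q::real)"
    "\<And>h. h \<in> borel_measurable borel \<Longrightarrow> avg h = h \<Longrightarrow> (\<And>x. h x \<le> 1) \<Longrightarrow>
      \<forall>\<^sub>F x in nhds (a0, 1). ennreal m *
        (\<integral>\<^sup>+z. (\<integral>\<^sup>+y. h (z, y) * indicator {p..q} y \<partial>lborel) * indicator {a'..J} z \<partial>lborel) \<le> h x"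
proof -
  define \<rho> where "\<rho> = \<beta> / 2"
  have \<rho>: "0 < \<rho>" "\<rho> \<le> 1" using \<beta> by (auto simp: \<rho>_def)
  \<comment> \<open>The offset 9 leaves room: the second shock stays between 6 and 12 for all nearby data.\<close>
  define z0 where "z0 = \<alpha> + \<beta> * (\<alpha> + \<beta> * a0) + 9"
  let ?T = "two_step_ratio \<alpha> \<beta>" and ?v = "\<lambda>z x w. z - (\<alpha> + \<beta> * (\<alpha> + \<beta> * fst x + w))"
  have range: "6 \<le> ?v z x w" "?v z x w \<le> 12"
    if "\<bar>z - z0\<bar> \<le> 1" "\<bar>fst x - a0\<bar> \<le> 1" "0 \<le> w" "w \<le> \<rho>" for z x w
  proof -
    have 1: "\<bar>\<beta> * \<beta> * (fst x - a0)\<bar> \<le> 1 * 1"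
      unfolding abs_mult using \<beta> that(2) by (intro mult_mono) (auto simp: mult_le_one)
    have 2: "0 \<le> \<beta> * w" "\<beta> * w \<le> 1 * 1"
      using \<beta> that(3,4) \<rho> by (simp, intro mult_mono) auto
    have "?v z x w = 9 + (z - z0) - \<beta> * \<beta> * (fst x - a0) - \<beta> * w" by (simp add: z0_def algebra_simps)
    then show "6 \<le> ?v z x w" "?v z x w \<le> 12" using 1 2 that(1) by linarith+
  qed
  have "?T z0 (a0, 1) 0 < ?T z0 (a0, 1) \<rho>"
  proof (rule DERIV_pos_imp_increasing[OF \<rho>(1)])
    fix w assume w: "0 \<le> w" "w \<le> \<rho>"
    show "\<exists>y. (?T z0 (a0, 1) has_real_derivative y) (at w) \<and> 0 < y"
      using two_step_ratio_has_derivative two_step_ratio_deriv_bounds(1)[OF \<beta>, of "(a0, 1)" w z0 \<alpha>] range[of z0 "(a0, 1)" w] w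
      by (intro exI[of _ "two_step_ratio_deriv \<alpha> \<beta> z0 (a0, 1) w"]) (auto simp: \<rho>_def)
  qed
  then obtain p q where pq: "?T z0 (a0, 1) 0 < p" "p < q" "q < ?T z0 (a0, 1) \<rho>" by (meson dense)
  have cont: "((\<lambda>(z, x). ?T z x w) \<longlongrightarrow> ?T z0 (a0, 1) w) (nhds z0 \<times>\<^sub>F nhds (a0, 1))" for w
  proof -
    have "continuous_on UNIV (\<lambda>y :: real \<times> real \<times> real. ?T (fst y) (snd y) w)"
      unfolding two_step_ratio_def ratio_step_def by (intro continuous_intros)
    then have "isCont (\<lambda>y. ?T (fst y) (snd y) w) (z0, (a0, 1))"
      by (metis UNIV_I continuous_on_eq_continuous_at open_UNIV)
    then have "((\<lambda>y. ?T (fst y) (snd y) w) \<longlongrightarrow> (\<lambda>y. ?T (fst y) (snd y) w) (z0, (a0, 1))) (nhds (z0, (a0, 1)))"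
      unfolding isCont_def by (rule iffD1[OF tendsto_at_iff_tendsto_nhds])
    then show ?thesis by (simp add: nhds_prod split_beta')
  qed
  have "\<forall>\<^sub>F y in nhds z0 \<times>\<^sub>F nhds (a0, 1). (\<lambda>(z, x). ?T z x 0) y < p \<and> q < (\<lambda>(z, x). ?T z x \<rho>) y"
    using order_tendstoD(2)[OF cont[of 0] pq(1)] order_tendstoD(1)[OF cont[of \<rho>] pq(3)] by eventually_elim auto
  then obtain P Q where P: "eventually P (nhds z0)" and Q: "eventually Q (nhds (a0, 1 :: real))"
    and PQ: "\<And>z x. P z \<Longrightarrow> Q x \<Longrightarrow> ?T z x 0 < p \<and> q < ?T z x \<rho>"
    unfolding eventually_prod_filter by auto
  obtain r where r: "0 < r" "\<And>z. dist z z0 < r \<Longrightarrow> P z" using P unfolding eventually_nhds_metric by blast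
  define r' where "r' = min (r / 2) 1"
  have r': "0 < r'" "r' < r" "r' \<le> 1" using r by (auto simp: r'_def)
  obtain m where m: "0 < m" "\<And>h x. h \<in> borel_measurable borel \<Longrightarrow>
    ennreal m * (\<integral>\<^sup>+w. h (step x w) * indicator {0..12} w \<partial>lborel) \<le> avg h x"
    using avg_lower[of 12] by auto
  \<comment> \<open>Two lower bounds for the density of a shock, and the bound 7 for the derivative.\<close>
  define m' where "m' = m * m / 7"
  have m': "0 < m'" using m by (simp add: m'_def)
  have main: "\<forall>\<^sub>F x in nhds (a0, 1). ennreal m' *
        (\<integral>\<^sup>+z. (\<integral>\<^sup>+y. h (z, y) * indicator {p..q} y \<partial>lborel) * indicator {z0 - r'..z0 + r'} z \<partial>lborel) \<le> h x"
    if h [measurable]: "h \<in> borel_measurable borel" and harm: "avg h = h" and h1: "\<And>x. h x \<le> 1" for h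
  proof -
    have hpair [measurable]: "(\<lambda>z. h (f z, g z)) \<in> borel_measurable N"
      if [measurable]: "f \<in> borel_measurable N" "g \<in> borel_measurable N" for f g :: "'x \<Rightarrow> real" and N
      by (rule measurable_compose[OF _ h]) (simp add: borel_prod[symmetric])
    have T_meas [measurable]: "(\<lambda>y. ?T (f y) x (g y)) \<in> borel_measurable N"
      if [measurable]: "f \<in> borel_measurable N" "g \<in> borel_measurable N" for f g :: "'x \<Rightarrow> real" and N x
      unfolding two_step_ratio_def by measurable
    have "\<forall>\<^sub>F x in nhds (a0, 1 :: real). dist x (a0, 1) < 1 / 2"
      unfolding eventually_nhds_metric by (intro exI[of _ "1/2"]) auto
    with Q show ?thesis
    proof eventually_elim
      case (elim x)
      have x: "\<bar>fst x - a0\<bar> \<le> 1" "1 / 2 \<le> snd x" "snd x \<le> 2"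
      proof -
        have "\<bar>fst x - a0\<bar> < 1 / 2" "\<bar>snd x - 1\<bar> < 1 / 2"
          using elim(2) dist_fst_le[of x "(a0, 1)"] dist_snd_le[of x "(a0, 1)"] by (auto simp: dist_real_def)
        then show "\<bar>fst x - a0\<bar> \<le> 1" "1 / 2 \<le> snd x" "snd x \<le> 2" by linarith+
      qed
      let ?Z = "{z0 - r'..z0 + r'}"
      have Z: "\<bar>z - z0\<bar> \<le> 1" "P z" if "z \<in> ?Z" for z
        using that r' r(2)[of z] by (auto simp: dist_real_def)
      have inner: "(\<integral>\<^sup>+z. h (z, ?T z x w) * indicator ?Z z \<partial>lborel)
          \<le> (\<integral>\<^sup>+w2. h (step (step x w) w2) * indicator {0..12} w2 \<partial>lborel)" if w: "0 \<le> w" "w \<le> \<rho>" for w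
      proof -
        let ?q = "\<alpha> + \<beta> * (\<alpha> + \<beta> * fst x + w)"
        have "(\<integral>\<^sup>+z. h (z, ?T z x w) * indicator ?Z z \<partial>lborel)
            = (\<integral>\<^sup>+w2. h (?q + 1 * w2, ?T (?q + 1 * w2) x w) * indicator ?Z (?q + 1 * w2) \<partial>lborel)"
          using nn_integral_real_affine[of "\<lambda>z. h (z, ?T z x w) * indicator ?Z z" 1 ?q] by simp
        also have "\<dots> \<le> (\<integral>\<^sup>+w2. h (step (step x w) w2) * indicator {0..12} w2 \<partial>lborel)"
        proof (intro nn_integral_mono)
          fix w2
          show "h (?q + 1 * w2, ?T (?q + 1 * w2) x w) * indicator ?Z (?q + 1 * w2)
              \<le> h (step (step x w) w2) * indicator {0..12} w2"
          proof (cases "?q + 1 * w2 \<in> ?Z")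
            case True
            then have "6 \<le> w2" "w2 \<le> 12" using range[OF Z(1)[OF True] x(1) w] by auto
            moreover have "step (step x w) w2 = (?q + 1 * w2, ?T (?q + 1 * w2) x w)"
              by (simp add: step_def two_step_ratio_def)
            ultimately show ?thesis using True by simp
          qed simp
        qed
        finally show ?thesis .
      qed
      have outer: "(\<integral>\<^sup>+y. h (z, y) * indicator {p..q} y \<partial>lborel)
          \<le> ennreal 7 * (\<integral>\<^sup>+w. h (z, ?T z x w) * indicator {0..\<rho>} w \<partial>lborel)" if z: "z \<in> ?Z" for z
      proof -
        have "(\<integral>\<^sup>+y. h (z, y) * indicator {p..q} y \<partial>lborel)
            \<le> (\<integral>\<^sup>+y. h (z, y) * indicator {?T z x 0..?T z x \<rho>} y \<partial>lborel)"
          using PQ[OF Z(2)[OF z] elim(1)] by (intro nn_integral_mono mult_left_mono) (auto simp: indicator_def)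
        also have "\<dots> \<le> ennreal 7 * (\<integral>\<^sup>+w. h (z, ?T z x w) * indicator {0..\<rho>} w \<partial>lborel)"
        proof (rule nn_integral_substitution_le[where g'="two_step_ratio_deriv \<alpha> \<beta> z x"])
          show "continuous_on {0..\<rho>} (two_step_ratio_deriv \<alpha> \<beta> z x)"
            unfolding two_step_ratio_deriv_def[abs_def] ratio_step_def by (intro continuous_intros) auto
          fix w assume w: "0 \<le> w" "w \<le> \<rho>"
          have "0 < two_step_ratio_deriv \<alpha> \<beta> z x w \<and> two_step_ratio_deriv \<alpha> \<beta> z x w \<le> 7"
            using two_step_ratio_deriv_bounds[OF \<beta> x(2,3) w(1) _ range[OF Z(1)[OF z] x(1) w]] w by (auto simp: \<rho>_def)
          then show "0 \<le> two_step_ratio_deriv \<alpha> \<beta> z x w" "two_step_ratio_deriv \<alpha> \<beta> z x w \<le> 7" by auto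
        qed (use h1 \<rho> two_step_ratio_has_derivative in auto)
        finally show ?thesis .
      qed
      have sw: "(\<integral>\<^sup>+z. (\<integral>\<^sup>+w. h (z, ?T z x w) * indicator {0..\<rho>} w \<partial>lborel) * indicator ?Z z \<partial>lborel)
          = (\<integral>\<^sup>+w. (\<integral>\<^sup>+z. h (z, ?T z x w) * indicator ?Z z \<partial>lborel) * indicator {0..\<rho>} w \<partial>lborel)"
      proof -
        have "(\<integral>\<^sup>+z. (\<integral>\<^sup>+w. h (z, ?T z x w) * indicator {0..\<rho>} w \<partial>lborel) * indicator ?Z z \<partial>lborel)
            = (\<integral>\<^sup>+z. (\<integral>\<^sup>+w. h (z, ?T z x w) * indicator {0..\<rho>} w * indicator ?Z z \<partial>lborel) \<partial>lborel)"
          by (intro nn_integral_cong) (simp add: nn_integral_multc)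
        also have "\<dots> = (\<integral>\<^sup>+w. (\<integral>\<^sup>+z. h (z, ?T z x w) * indicator {0..\<rho>} w * indicator ?Z z \<partial>lborel) \<partial>lborel)"
          by (rule lborel_pair.Fubini') simp
        also have "\<dots> = (\<integral>\<^sup>+w. (\<integral>\<^sup>+z. h (z, ?T z x w) * indicator ?Z z \<partial>lborel) * indicator {0..\<rho>} w \<partial>lborel)"
        proof (intro nn_integral_cong)
          fix w :: real
          have "(\<integral>\<^sup>+z. h (z, ?T z x w) * indicator ?Z z \<partial>lborel) * indicator {0..\<rho>} w
              = (\<integral>\<^sup>+z. h (z, ?T z x w) * indicator ?Z z * indicator {0..\<rho>} w \<partial>lborel)"
            by (rule nn_integral_multc[symmetric]) measurable
          then show "(\<integral>\<^sup>+z. h (z, ?T z x w) * indicator {0..\<rho>} w * indicator ?Z z \<partial>lborel)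
              = (\<integral>\<^sup>+z. h (z, ?T z x w) * indicator ?Z z \<partial>lborel) * indicator {0..\<rho>} w"
            by (simp only: mult_ac)
        qed
        finally show ?thesis .
      qed
      have "(\<integral>\<^sup>+z. (\<integral>\<^sup>+y. h (z, y) * indicator {p..q} y \<partial>lborel) * indicator ?Z z \<partial>lborel)
          \<le> (\<integral>\<^sup>+z. ennreal 7 * ((\<integral>\<^sup>+w. h (z, ?T z x w) * indicator {0..\<rho>} w \<partial>lborel) * indicator ?Z z) \<partial>lborel)"
        using outer by (intro nn_integral_mono) (auto simp: indicator_def)
      also have "\<dots> = ennreal 7 * (\<integral>\<^sup>+w. (\<integral>\<^sup>+z. h (z, ?T z x w) * indicator ?Z z \<partial>lborel) * indicator {0..\<rho>} w \<partial>lborel)"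
        unfolding sw[symmetric] by (intro nn_integral_cmult) measurable
      also have "\<dots> \<le> ennreal 7 * (\<integral>\<^sup>+w. (\<integral>\<^sup>+w2. h (step (step x w) w2) * indicator {0..12} w2 \<partial>lborel) * indicator {0..12} w \<partial>lborel)"
        using inner \<rho> by (intro mult_left_mono nn_integral_mono) (auto simp: indicator_def)
      finally have 1: "(\<integral>\<^sup>+z. (\<integral>\<^sup>+y. h (z, y) * indicator {p..q} y \<partial>lborel) * indicator ?Z z \<partial>lborel)
          \<le> ennreal 7 * (\<integral>\<^sup>+w. (\<integral>\<^sup>+w2. h (step (step x w) w2) * indicator {0..12} w2 \<partial>lborel) * indicator {0..12} w \<partial>lborel)"
        (is "?A \<le> _ * ?C") .
      have "ennreal m * (ennreal m * ?C) = ennreal m * (\<integral>\<^sup>+w. (ennreal m * (\<integral>\<^sup>+w2. h (step (step x w) w2) * indicator {0..12} w2 \<partial>lborel)) * indicator {0..12} w \<partial>lborel)"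
        by (subst nn_integral_cmult[symmetric]) (auto simp: mult.assoc)
      also have "\<dots> \<le> ennreal m * (\<integral>\<^sup>+w. avg h (step x w) * indicator {0..12} w \<partial>lborel)"
        by (intro mult_left_mono nn_integral_mono mult_right_mono m(2) h) auto
      also have "\<dots> \<le> avg (avg h) x" by (intro m(2)) simp
      also have "\<dots> = h x" by (simp add: harm)
      finally have 2: "ennreal m * (ennreal m * ?C) \<le> h x" .
      have "ennreal m' * ?A \<le> ennreal m' * (ennreal 7 * ?C)" using 1 by (intro mult_left_mono) auto
      also have "\<dots> = ennreal (m * m) * ?C"
      proof -
        have "m * m = m' * 7" by (simp add: m'_def)
        then have "ennreal (m * m) = ennreal m' * ennreal 7"
          using m' by (simp only: ennreal_mult less_imp_le zero_le_numeral)
        then show ?thesis by (simp only: mult.assoc)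
      qed
      also have "\<dots> = ennreal m * (ennreal m * ?C)" using m by (simp add: ennreal_mult mult.assoc)
      also note 2
      finally show ?case .
    qed
  qed
  show ?thesis
  proof (rule that[OF m' _ pq(2)])
    show "z0 - r' < z0 + r'" using r' by simp
  qed (rule main)
qed

end

section \<open>Invariant events off the diagonal are trivial\<close>

context egarch_chain_expanding
begin

lemma shock_support:
  assumes U: "open U" and w: "w \<in> U" "0 \<le> w"
  shows "0 < emeasure W U"
proof -
  obtain e where e: "0 < e" "ball w e \<subseteq> U" using U w openE by blast
  have "0 < w + e" using w e by linarith
  from lower[OF this] obtain m where m: "0 < m" "\<And>f. f \<in> borel_measurable borel \<Longrightarrow>
      ennreal m * (\<integral>\<^sup>+v. f v * indicator {0..w + e} v \<partial>lborel) \<le> (\<integral>\<^sup>+v. f v \<partial>W)"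
    by blast
  have [measurable]: "U \<in> sets borel" using U by simp
  have "0 < ennreal m * ennreal (e / 2)" using m e by (simp add: ennreal_zero_less_mult_iff)
  also have "ennreal (e / 2) = (\<integral>\<^sup>+v. indicator {w..w + e / 2} v \<partial>lborel)"
  proof -
    have "(\<integral>\<^sup>+v. indicator {w..w + e / 2} v \<partial>lborel) = emeasure lborel {w..w + e / 2}"
      by (rule nn_integral_indicator) simp
    also have "\<dots> = ennreal (w + e / 2 - w)" using e by (intro emeasure_lborel_Icc) simp
    finally show ?thesis by (simp only: add_diff_cancel_left')
  qed
  also have "ennreal m * \<dots> \<le> ennreal m * (\<integral>\<^sup>+v. indicator U v * indicator {0..w + e} v \<partial>lborel)"
  proof (intro mult_left_mono nn_integral_mono)
    fix v :: real
    have "v \<in> U" if "w \<le> v" "v \<le> w + e / 2" using that e by (intro subsetD[OF e(2)]) (auto simp: dist_real_def)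
    then show "(indicator {w..w + e / 2} v :: ennreal) \<le> indicator U v * indicator {0..w + e} v"
      using w e by (auto simp: indicator_def)
  qed simp
  also have "\<dots> \<le> (\<integral>\<^sup>+v. indicator U v \<partial>W)" by (rule m(2)) simp
  also have "\<dots> = emeasure W U" by simp
  finally show ?thesis .
qed

lemma bounded_below_near_control:
  assumes "avg h = h" "0 \<le> w" "bounded_below_near h (step x w)"
  shows "bounded_below_near h x"
  by (rule bounded_below_near_step[OF random_recursion_axioms sets_W assms(1) step_tendsto _ assms(3)])
     (rule shock_support[OF _ _ assms(2)])

text \<open>The log-volatility of the controlled orbit of period two on which the log-ratio alternates
  between \<open>1\<close> and \<open>-1\<close>.\<close>

definition centre :: real where
  "centre = (\<alpha> + \<beta> * (\<alpha> + (1 + \<beta>) / contract 1) + (1 + \<beta>) / (- contract (- 1))) / (1 - \<beta>\<^sup>2)"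

text \<open>One shock brings the log-ratio to \<open>1\<close> or \<open>-1\<close>, according to its sign. Two fixed shocks then let it
  alternate, and the log-volatility approaches \<open>centre\<close> at rate \<open>\<beta>\<^sup>2\<close>. Local lower bounds are pulled
  back along this path.\<close>

lemma accessible:
  assumes harm: "avg h = h" and near: "bounded_below_near h (centre, 1)" and x: "snd x \<noteq> 0"
  shows "bounded_below_near h x"
proof -
  have u: "0 < contract 1" "contract (- 1) < 0" using contract_pos[of 1] contract_neg[of "- 1"] by auto
  define w1 where "w1 = (1 + \<beta>) / contract 1"
  define w2 where "w2 = (1 + \<beta>) / (- contract (- 1))"
  have w: "0 \<le> w1" "0 \<le> w2" unfolding w1_def w2_def using u \<beta> by (intro divide_nonneg_pos; linarith)+
  have s1: "step (a, 1) w1 = (\<alpha> + \<beta> * a + w1, - 1)" for a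
    using u by (simp add: step_def ratio_step_def w1_def)
  have s2: "step (a, - 1) w2 = (\<alpha> + \<beta> * a + w2, 1)" for a
    using u by (simp add: step_def ratio_step_def w2_def)
  obtain c U where c: "0 < c" and U: "open U" "(centre, 1) \<in> U" "\<And>y. y \<in> U \<Longrightarrow> ennreal c \<le> h y"
    using near unfolding bounded_below_near_def eventually_nhds by blast
  have nearU: "bounded_below_near h y" if "y \<in> U" for y
    unfolding bounded_below_near_def eventually_nhds using c U that by blast
  obtain r where r: "0 < r" "\<And>y. dist y (centre, 1) < r \<Longrightarrow> y \<in> U"
    using U(1,2) unfolding open_dist by blast
  have b2: "\<beta>\<^sup>2 < 1" using mult_strict_mono[of \<beta> 1 \<beta> 1] \<beta> by (simp add: power2_eq_square)
  have centre_eq: "\<alpha> + \<beta> * (\<alpha> + w1) + w2 = (1 - \<beta>\<^sup>2) * centre"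
    using b2 by (simp add: centre_def w1_def w2_def)
  have "bounded_below_near h (a, 1)" if "(\<beta>\<^sup>2) ^ n * \<bar>a - centre\<bar> < r" for n a
    using that
  proof (induction n arbitrary: a)
    case 0
    then show ?case by (intro nearU r) (simp add: dist_Pair_Pair dist_real_def)
  next
    case (Suc n)
    let ?a = "\<alpha> + \<beta> * (\<alpha> + \<beta> * a + w1) + w2"
    have "?a - centre = \<beta>\<^sup>2 * (a - centre)" using centre_eq by (simp add: algebra_simps power2_eq_square)
    then have "\<bar>?a - centre\<bar> = \<beta>\<^sup>2 * \<bar>a - centre\<bar>" by (simp add: abs_mult)
    then have "bounded_below_near h (?a, 1)" using Suc.prems by (intro Suc.IH) (simp add: mult_ac)
    then have "bounded_below_near h (\<alpha> + \<beta> * a + w1, - 1)"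
      using bounded_below_near_control[OF harm w(2), of "(\<alpha> + \<beta> * a + w1, - 1)"] by (simp add: s2)
    then show ?case using bounded_below_near_control[OF harm w(1), of "(a, 1)"] by (simp add: s1)
  qed
  moreover have "\<exists>n. (\<beta>\<^sup>2) ^ n * \<bar>a - centre\<bar> < r" for a
  proof -
    have "(\<lambda>n. (\<beta>\<^sup>2) ^ n * \<bar>a - centre\<bar>) \<longlonglongrightarrow> 0 * \<bar>a - centre\<bar>"
      using b2 by (intro tendsto_intros LIMSEQ_power_zero) auto
    then have "\<forall>\<^sub>F n in sequentially. (\<beta>\<^sup>2) ^ n * \<bar>a - centre\<bar> < r" using r(1) by (intro order_tendstoD) auto
    then show ?thesis by (auto simp: eventually_sequentially)
  qed
  ultimately have one: "bounded_below_near h (a, 1)" for a by blast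
  have minus_one: "bounded_below_near h (a, - 1)" for a
    using bounded_below_near_control[OF harm w(2), of "(a, - 1)"] by (simp add: s2 one)
  show ?thesis
  proof (cases "0 < snd x")
    case True
    define v where "v = (\<beta> * snd x + 1) / contract (snd x)"
    have "0 < contract (snd x)" using contract_pos[OF True] .
    then have "0 \<le> v" "step x v = (\<alpha> + \<beta> * fst x + v, - 1)"
      using True \<beta> by (auto simp: v_def step_def ratio_step_def)
    then show ?thesis using bounded_below_near_control[OF harm, of v x] minus_one by simp
  next
    case False
    then have neg: "snd x < 0" using x by simp
    define v where "v = (\<beta> * snd x - 1) / contract (snd x)"
    have u: "contract (snd x) < 0" using contract_neg[OF neg] .
    moreover have "\<beta> * snd x - 1 \<le> 0" using neg \<beta> mult_pos_neg[of \<beta> "snd x"] by linarith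
    ultimately have "0 \<le> v" by (simp add: v_def divide_nonpos_neg)
    moreover have "step x v = (\<alpha> + \<beta> * fst x + v, 1)" using neg by (simp add: v_def step_def ratio_step_def)
    ultimately show ?thesis using bounded_below_near_control[OF harm, of v x] one by simp
  qed
qed

text \<open>Otherwise the mean of the logarithmic barrier after one step would be infinite.\<close>

lemma ratio_step_AE_nonzero:
  assumes "d \<noteq> 0"
  shows "AE w in W. ratio_step \<beta> d w \<noteq> 0"
proof -
  obtain C where "(\<integral>\<^sup>+w. neg_log (ratio_step \<beta> d w) \<partial>W) \<le> ennreal C"
    using neg_log_avg_away_from_0[of "\<bar>d\<bar>"] assms by auto
  then have "(\<integral>\<^sup>+w. neg_log (ratio_step \<beta> d w) \<partial>W) \<noteq> \<infinity>" using ennreal_less_top[of C] by (auto simp: top_unique)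
  then have "AE w in W. neg_log (ratio_step \<beta> d w) \<noteq> \<infinity>"
    by (intro nn_integral_noteq_infinite) auto
  then show ?thesis by eventually_elim (auto simp: neg_log_def)
qed

lemma orbit_AE_nonzero:
  assumes "snd x \<noteq> 0"
  shows "AE w in S. snd (orbit x w n) \<noteq> 0"
  using assms
proof (induction n arbitrary: x)
  case (Suc n)
  have meas: "{w \<in> space S. snd (orbit y w m) \<noteq> 0} \<in> sets S" for y m by measurable
  have "AE z in W \<Otimes>\<^sub>M S. snd (orbit (step x (fst z)) (snd z) n) \<noteq> 0"
  proof (rule pair_sigma_finite.AE_pair_measure)
    show "pair_sigma_finite W S"
      by (intro pair_sigma_finite.intro prob_space_imp_sigma_finite prob_space_W P.prob_space_axioms)
    show "{z \<in> space (W \<Otimes>\<^sub>M S). snd (orbit (step x (fst z)) (snd z) n) \<noteq> 0} \<in> sets (W \<Otimes>\<^sub>M S)"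
      by measurable
    show "AE s in W. AE w in S. snd (orbit (step x (fst (s, w))) (snd (s, w)) n) \<noteq> 0"
      using ratio_step_AE_nonzero[OF Suc.prems]
      by eventually_elim (simp add: Suc.IH step_def)
  qed
  then have "AE z in W \<Otimes>\<^sub>M S. snd (orbit x (case_nat (fst z) (snd z)) (Suc n)) \<noteq> 0"
    unfolding orbit_case_nat .
  then have "AE w in distr (W \<Otimes>\<^sub>M S) S (\<lambda>(s, w). case_nat s w). snd (orbit x w (Suc n)) \<noteq> 0"
    by (subst AE_distr_iff) (use meas[of x "Suc n"] in \<open>auto simp: split_beta' simp del: orbit.simps\<close>)
  then show ?case by (simp only: PiM_iter)
qed simp

lemma harmonic_lower_bound_nonzero:
  assumes harm: "avg h = h" and near: "bounded_below_near h (centre, 1)"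
  obtains c where "0 < (c::real)" "\<And>x. snd x \<noteq> 0 \<Longrightarrow> ennreal c \<le> h x"
proof -
  obtain f :: "real \<Rightarrow> ennreal" and r K k b :: real where f: "f \<in> borel_measurable borel" "\<And>d. d \<noteq> 0 \<Longrightarrow> f d < \<infinity>"
    and pos: "0 < r" "0 < k" "0 < b" and drift:
    "\<And>d. (\<integral>\<^sup>+w. f (ratio_step \<beta> d w) \<partial>W) + ennreal k \<le> f d + ennreal b * indicator {d. r \<le> \<bar>d\<bar> \<and> \<bar>d\<bar> \<le> K} d"
    by (rule expanding_drift) blast
  let ?D = "{d. r \<le> \<bar>d\<bar> \<and> \<bar>d\<bar> \<le> K}"
  have D: "compact ?D"
  proof -
    have "?D = {-K..K} \<inter> {d. r \<le> \<bar>d\<bar>}" by (auto simp: abs_le_iff)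
    moreover have "closed {d::real. r \<le> \<bar>d\<bar>}" by (intro closed_Collect_le continuous_intros)
    ultimately show ?thesis by (simp add: compact_Int_closed)
  qed
  obtain s A where s: "0 < s" and V: "\<And>x. avg (\<lambda>(a, d). f d + ennreal (s * \<bar>a\<bar>)) x + ennreal (k / 2)
        \<le> (case x of (a, d) \<Rightarrow> f d + ennreal (s * \<bar>a\<bar>)) + ennreal b * indicator ({-A..A} \<times> ?D) x"
    using drift_with_level[OF f(1) D pos(2,3) drift] by blast
  have comp: "compact ({-A..A} \<times> ?D)" using D by (intro compact_Times) auto
  have "bounded_below_near h x" if "x \<in> {-A..A} \<times> ?D" for x
    using that pos by (intro accessible[OF harm near]) auto
  from bounded_below_on_compact[OF comp this] obtain c
    where c: "0 < c" "\<And>x. x \<in> {-A..A} \<times> ?D \<Longrightarrow> ennreal c \<le> h x" by blast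
  have "ennreal (c * (k / 2) / (2 * b)) \<le> h x" if "snd x \<noteq> 0" for x
  proof (rule harmonic_lower_bound[OF _ _ V _ pos(3) c(1) harm c(2)])
    show "(\<lambda>(a, d). f d + ennreal (s * \<bar>a\<bar>)) \<in> borel_measurable borel"
      using f(1) by (simp add: split_beta')
    show "{-A..A} \<times> ?D \<in> sets borel" using comp by (intro borel_closed compact_imp_closed)
    show "(case x of (a, d) \<Rightarrow> f d + ennreal (s * \<bar>a\<bar>)) < \<infinity>"
      using f(2)[OF that] by (cases x) auto
  qed (use pos in auto)
  with that[of "c * (k / 2) / (2 * b)"] c pos show ?thesis by simp
qed

text \<open>The probabilities of \<open>A\<close> and of its complement add up to 1, so one of them has positive mean over
  the box of \<open>harmonic_two_step_lower\<close>, hence is bounded below near \<open>(centre, 1)\<close>, hence on all states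
  off the diagonal.\<close>

theorem invariant_dichotomy:
  assumes A: "A \<in> sets paths" and inv: "shift_invariant A"
  shows "(\<forall>x. snd x \<noteq> 0 \<longrightarrow> path_prob A x = 1) \<or> (\<forall>x. snd x \<noteq> 0 \<longrightarrow> path_prob A x = 0)"
proof -
  obtain m J p q a' where m: "0 < (m::real)" and box: "a' < (J::real)" "p < (q::real)" and two:
    "\<And>h. h \<in> borel_measurable borel \<Longrightarrow> avg h = h \<Longrightarrow> (\<And>x. h x \<le> 1) \<Longrightarrow>
      \<forall>\<^sub>F x in nhds (centre, 1). ennreal m *
        (\<integral>\<^sup>+z. (\<integral>\<^sup>+y. h (z, y) * indicator {p..q} y \<partial>lborel) * indicator {a'..J} z \<partial>lborel) \<le> h x"
    by (rule harmonic_two_step_lower[of centre]) blast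
  let ?I = "\<lambda>h. \<integral>\<^sup>+z. (\<integral>\<^sup>+y. h (z, y) * indicator {p..q} y \<partial>lborel) * indicator {a'..J} z \<partial>lborel"
  have one: "path_prob E x = 1" if E: "E \<in> sets paths" "shift_invariant E" and I: "?I (path_prob E) \<noteq> 0" and x: "snd x \<noteq> 0" for E x
  proof -
    have le1: "path_prob E y \<le> 1" for y
      using path_prob_compl[OF E(1), of y] by (metis add_increasing2 dual_order.refl zero_le)
    have harm: "avg (path_prob E) = path_prob E" by (rule path_prob_harmonic[OF E])
    have ev: "\<forall>\<^sub>F x in nhds (centre, 1). ennreal m * ?I (path_prob E) \<le> path_prob E x"
      by (rule two[OF _ harm le1]) (use E(1) in measurable)
    then have "ennreal m * ?I (path_prob E) \<le> path_prob E (centre, 1)" by (rule eventually_nhds_x_imp_x)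
    also have "\<dots> \<le> 1" by (rule le1)
    finally obtain c where c: "ennreal m * ?I (path_prob E) = ennreal c" "0 \<le> c"
      by (cases "ennreal m * ?I (path_prob E)") (auto simp: top_unique)
    have "c \<noteq> 0" using c I m by (auto simp: ennreal_eq_0_iff)
    then have "bounded_below_near (path_prob E) (centre, 1)"
      unfolding bounded_below_near_def using ev c by (intro exI[of _ c]) auto
    from harmonic_lower_bound_nonzero[OF harm this] obtain c'
      where c': "0 < c'" "\<And>y. snd y \<noteq> 0 \<Longrightarrow> ennreal c' \<le> path_prob E y" by blast
    show ?thesis
      by (rule zero_one[OF E c'(1), where E="{y. snd y \<noteq> 0}"]) (use c' orbit_AE_nonzero[OF x] in auto)
  qed
  have mA: "- A \<in> sets paths"
    using sets.compl_sets[OF A] by (simp add: space_PiM PiE_def Compl_eq_Diff_UNIV)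
  have invc: "shift_invariant (- A)" using inv by (auto simp: shift_invariant_def)
  have hm [measurable]: "path_prob A \<in> borel_measurable borel" "path_prob (- A) \<in> borel_measurable borel"
    using A mA by measurable
  have pm [measurable]: "(\<lambda>z. h (f z, g z)) \<in> borel_measurable N"
    if "h \<in> borel_measurable borel" "f \<in> borel_measurable N" "g \<in> borel_measurable N" for f g :: "'x \<Rightarrow> real" and N and h :: "real \<times> real \<Rightarrow> ennreal"
    by (rule measurable_compose[OF _ that(1)]) (use that in \<open>simp add: borel_prod[symmetric]\<close>)
  have "?I (path_prob A) + ?I (path_prob (- A)) = (\<integral>\<^sup>+z. (\<integral>\<^sup>+y. indicator {p..q} y \<partial>lborel) * indicator {a'..J} z \<partial>lborel)"
  proof -
    have "?I (path_prob A) + ?I (path_prob (- A))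
        = (\<integral>\<^sup>+z. (\<integral>\<^sup>+y. path_prob A (z, y) * indicator {p..q} y + path_prob (- A) (z, y) * indicator {p..q} y \<partial>lborel) * indicator {a'..J} z \<partial>lborel)"
      by (simp add: nn_integral_add distrib_right)
    also have "\<dots> = (\<integral>\<^sup>+z. (\<integral>\<^sup>+y. indicator {p..q} y \<partial>lborel) * indicator {a'..J} z \<partial>lborel)"
      by (simp only: distrib_right[symmetric] path_prob_compl[OF A] mult_1)
    finally show ?thesis .
  qed
  also have "\<dots> = ennreal (q - p) * ennreal (J - a')" using box by (simp add: nn_integral_cmult)
  also have "\<dots> \<noteq> 0" using box by (simp add: ennreal_mult[symmetric])
  finally consider "?I (path_prob A) \<noteq> 0" | "?I (path_prob (- A)) \<noteq> 0" by fastforce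
  then show ?thesis
  proof cases
    case 1
    then show ?thesis using one[OF A inv] by blast
  next
    case 2
    have "path_prob A x = 0" if "snd x \<noteq> 0" for x
    proof -
      have "1 + path_prob A x = 1 + 0"
        using one[OF mA invc 2 that] path_prob_compl[OF A, of x] by (simp add: add.commute)
      then show ?thesis unfolding ennreal_add_left_cancel by simp
    qed
    then show ?thesis by blast
  qed
qed

end

section \<open>The law of the shock and the sign of the exponent\<close>

context egarch_chain
begin

definition log_pos :: ennreal where "log_pos = (\<integral>\<^sup>+w. ennreal (ln \<bar>\<beta> - w / 2\<bar>) \<partial>W)"
definition log_neg :: ennreal where "log_neg = (\<integral>\<^sup>+w. neg_log (\<beta> - w / 2) \<partial>W)"

lemma log_pos_finite: "log_pos < \<infinity>"
proof -
  have "log_pos \<le> ennreal (\<beta> + 1 * shock_mean + 0 * shock_square_mean)"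
    unfolding log_pos_def
  proof (rule quadratic_bound)
    fix w :: real assume "0 \<le> w"
    have "ln \<bar>\<beta> - w / 2\<bar> \<le> \<bar>\<beta> - w / 2\<bar>" by (cases "\<beta> - w / 2 = 0") (auto intro: ln_bound)
    then show "ln \<bar>\<beta> - w / 2\<bar> \<le> \<beta> + 1 * w + 0 * w\<^sup>2" using \<open>0 \<le> w\<close> \<beta> by linarith
  qed (use \<beta> in auto)
  then show ?thesis using le_less_trans[OF _ ennreal_less_top] by simp
qed

lemma expanding_if_positive:
  assumes pos: "0 < enn2ereal log_pos - enn2ereal log_neg"
  obtains l where "0 < (l::real)" "\<And>\<tau>. 0 < \<tau> \<Longrightarrow> l \<le> (LINT w|W. ln (max \<tau> \<bar>\<beta> - w / 2\<bar>))"
proof -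
  obtain p where p: "log_pos = ennreal p" "0 \<le> p" using log_pos_finite by (cases log_pos) auto
  have "log_neg \<noteq> \<infinity>" using pos p by auto
  then obtain q where q: "log_neg = ennreal q" "0 \<le> q" by (cases log_neg) auto
  have "0 < p - q" using pos p q by simp
  moreover have "p - q \<le> (LINT w|W. ln (max \<tau> \<bar>\<beta> - w / 2\<bar>))" if \<tau>: "0 < \<tau>" for \<tau>
  proof -
    let ?f = "\<lambda>w. ln (max \<tau> \<bar>\<beta> - w / 2\<bar>)"
    have int: "integrable W ?f" by (rule log_max_integrable[OF \<tau>])
    have fin: "(\<integral>\<^sup>+w. ennreal (?f w) \<partial>W) < \<infinity>"
      using int by (auto simp: integrable_iff_bounded elim!: le_less_trans[rotated] intro!: nn_integral_mono ennreal_leI)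
    have "log_pos \<le> (\<integral>\<^sup>+w. ennreal (?f w) \<partial>W)"
      unfolding log_pos_def
    proof (intro nn_integral_mono)
      fix w
      show "ennreal (ln \<bar>\<beta> - w / 2\<bar>) \<le> ennreal (?f w)"
      proof (cases "\<beta> - w / 2 = 0")
        case False
        then show ?thesis by (intro ennreal_leI) (subst ln_le_cancel_iff; auto)
      next
        case True
        then have "ln \<bar>\<beta> - w / 2\<bar> = 0" unfolding True by simp
        then show ?thesis by simp
      qed
    qed
    then have 1: "p \<le> enn2real (\<integral>\<^sup>+w. ennreal (?f w) \<partial>W)"
      using enn2real_mono[OF _ fin[unfolded infinity_ennreal_def]] p by (metis enn2real_ennreal)
    have "(\<integral>\<^sup>+w. ennreal (- ?f w) \<partial>W) \<le> log_neg"
      unfolding log_neg_def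
    proof (intro nn_integral_mono)
      fix w
      show "ennreal (- ?f w) \<le> neg_log (\<beta> - w / 2)"
      proof (cases "\<beta> - w / 2 = 0")
        case False
        then have "ln \<bar>\<beta> - w / 2\<bar> \<le> ?f w" by (subst ln_le_cancel_iff) auto
        then show ?thesis using False by (simp add: neg_log_def ennreal_leI)
      qed (simp add: neg_log_def)
    qed
    then have 2: "enn2real (\<integral>\<^sup>+w. ennreal (- ?f w) \<partial>W) \<le> q"
      using enn2real_mono[of _ "ennreal q"] q by (metis enn2real_ennreal ennreal_less_top)
    show ?thesis using 1 2 real_lebesgue_integral_def[OF int] by simp
  qed
  ultimately show ?thesis using that[of "p - q"] by blast
qed

text \<open>The negative part may have infinite mean; by monotone convergence some truncation
  \<open>\<tau> = exp (- n)\<close> already makes the mean negative.\<close>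

lemma contracting_if_negative:
  assumes neg: "enn2ereal log_pos - enn2ereal log_neg < 0"
  obtains \<tau> where "0 < (\<tau>::real)" "(LINT w|W. ln (max \<tau> \<bar>\<beta> - w / 2\<bar>)) < 0"
proof -
  obtain p where p: "log_pos = ennreal p" "0 \<le> p" using log_pos_finite by (cases log_pos) auto
  have less: "log_pos < log_neg"
  proof (cases log_neg)
    case (real q)
    then show ?thesis using neg p by (simp add: ennreal_lessI)
  next
    case top
    then show ?thesis using log_pos_finite by simp
  qed
  define J where "J n = (\<integral>\<^sup>+w. min (neg_log (\<beta> - w / 2)) (ennreal (real n)) \<partial>W)" for n :: nat
  have "log_neg = (\<integral>\<^sup>+w. (SUP n. min (neg_log (\<beta> - w / 2)) (ennreal (real n))) \<partial>W)"
    unfolding log_neg_def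
  proof (intro nn_integral_cong)
    fix w
    have sup: "(SUP n. ennreal (real n)) = top"
      by (simp add: ennreal_of_nat_eq_real_of_nat[symmetric] ennreal_SUP_of_nat_eq_top)
    show "neg_log (\<beta> - w / 2) = (SUP n. min (neg_log (\<beta> - w / 2)) (ennreal (real n)))"
      using inf_SUP[of "neg_log (\<beta> - w / 2)" "\<lambda>n. ennreal (real n)" UNIV]
      unfolding sup inf_top_right unfolding inf_min .
  qed
  also have "\<dots> = (SUP n. J n)"
    unfolding J_def by (intro nn_integral_monotone_convergence_SUP)
      (auto simp: incseq_def le_fun_def intro: min.coboundedI2 ennreal_leI)
  finally have "log_pos < (SUP n. J n)" using less by simp
  then obtain n where n: "log_pos < J n" by (auto simp: less_SUP_iff)
  define \<tau> where "\<tau> = exp (- real n)"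
  have \<tau>: "0 < \<tau>" "\<tau> \<le> 1" "ln \<tau> = - real n" by (auto simp: \<tau>_def)
  let ?f = "\<lambda>w. ln (max \<tau> \<bar>\<beta> - w / 2\<bar>)"
  have int: "integrable W ?f" by (rule log_max_integrable[OF \<tau>(1)])
  have "(\<integral>\<^sup>+w. ennreal (?f w) \<partial>W) = log_pos"
    unfolding log_pos_def
  proof (intro nn_integral_cong)
    fix w
    show "ennreal (?f w) = ennreal (ln \<bar>\<beta> - w / 2\<bar>)"
    proof (cases "\<tau> \<le> \<bar>\<beta> - w / 2\<bar>")
      case False
      then have "ln \<bar>\<beta> - w / 2\<bar> \<le> 0" using \<tau> by (cases "\<beta> - w / 2 = 0") auto
      moreover have "?f w \<le> 0" using False \<tau> by (simp add: max_def)
      ultimately show ?thesis by (simp add: ennreal_neg)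
    qed (simp add: max_def)
  qed
  moreover have "(\<integral>\<^sup>+w. ennreal (- ?f w) \<partial>W) = J n"
    unfolding J_def
  proof (intro nn_integral_cong)
    fix w
    show "ennreal (- ?f w) = min (neg_log (\<beta> - w / 2)) (ennreal (real n))"
    proof (cases "\<beta> - w / 2 = 0")
      case True
      then show ?thesis using \<tau> by (simp add: neg_log_def max_def)
    next
      case False
      have "- ?f w = min (- ln \<bar>\<beta> - w / 2\<bar>) (real n)"
      proof (cases "\<tau> \<le> \<bar>\<beta> - w / 2\<bar>")
        case True
        then have "ln \<tau> \<le> ln \<bar>\<beta> - w / 2\<bar>" using \<tau> False by (subst ln_le_cancel_iff) auto
        then show ?thesis using True \<tau> by (simp add: max_def min_def)
      next
        case F: False
        then have "ln \<bar>\<beta> - w / 2\<bar> \<le> ln \<tau>" using \<tau> False by (subst ln_le_cancel_iff) auto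
        then show ?thesis using F \<tau> by (simp add: max_def min_def)
      qed
      then show ?thesis using False by (simp add: neg_log_def min_def ennreal_le_iff2)
    qed
  qed
  moreover have "J n < \<infinity>"
  proof -
    have "J n \<le> (\<integral>\<^sup>+w. ennreal (real n) \<partial>W)" unfolding J_def by (intro nn_integral_mono) simp
    also have "\<dots> = ennreal (real n)" using prob_space.emeasure_space_1[OF prob_space_W] by simp
    also have "\<dots> < \<infinity>" by simp
    finally show ?thesis .
  qed
  ultimately have "(LINT w|W. ?f w) < 0"
    using n p real_lebesgue_integral_def[OF int] by (cases "J n") (auto simp: ennreal_less_iff)
  with that \<tau>(1) show ?thesis by blast
qed

end

locale egarch_innovation = prob_space M for M :: "'a measure" +
  fixes X :: "'a \<Rightarrow> real" and g :: "real \<Rightarrow> real" and \<beta> \<gamma> \<delta> :: real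
  assumes params: "\<bar>\<delta>\<bar> \<le> \<gamma>" "0 < \<beta>" "\<beta> < 1"
    and density: "distributed M lborel X (\<lambda>x. ennreal (g x))" "continuous_on UNIV g"
    and second_moment: "integrable M (\<lambda>\<omega>. (X \<omega>)\<^sup>2)"
    and g_pos: "\<And>x. 0 < g x" and g_bound: "bdd_above (range (\<lambda>x. (\<bar>x\<bar> + 1) * g x))"
begin

definition shock :: "real \<Rightarrow> real" where "shock x = \<gamma> * \<bar>x\<bar> + \<delta> * x"
definition W :: "real measure" where "W = distr M borel (\<lambda>\<omega>. shock (X \<omega>))"

lemma shock_measurable [measurable]: "shock \<in> borel_measurable borel"
  unfolding shock_def[abs_def] by measurable

lemma X_measurable [measurable]: "X \<in> borel_measurable M"
  using density(1) distributed_measurable by fastforce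

lemma g_measurable [measurable]: "g \<in> borel_measurable borel"
  using density(2) by (rule borel_measurable_continuous_onI)

lemma gamma_nonneg: "0 \<le> \<gamma>"
  using params(1) by linarith

lemma shock_bounds: "0 \<le> shock x" "shock x \<le> 2 * \<gamma> * \<bar>x\<bar>"
proof -
  have "\<bar>\<delta> * x\<bar> \<le> \<gamma> * \<bar>x\<bar>" using params(1) by (simp add: abs_mult mult_right_mono)
  then show "0 \<le> shock x" "shock x \<le> 2 * \<gamma> * \<bar>x\<bar>" by (auto simp: shock_def abs_le_iff)
qed

lemma nn_integral_W:
  assumes [measurable]: "f \<in> borel_measurable borel"
  shows "(\<integral>\<^sup>+w. f w \<partial>W) = (\<integral>\<^sup>+x. ennreal (g x) * f (shock x) \<partial>lborel)"
proof -
  have "(\<integral>\<^sup>+w. f w \<partial>W) = (\<integral>\<^sup>+\<omega>. f (shock (X \<omega>)) \<partial>M)"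
    unfolding W_def by (subst nn_integral_distr) auto
  also have "\<dots> = (\<integral>\<^sup>+x. ennreal (g x) * f (shock x) \<partial>lborel)"
    by (rule distributed_nn_integral[OF density(1), symmetric]) simp
  finally show ?thesis .
qed

lemma g_lower:
  obtains m where "0 < m" "\<And>x. \<bar>x\<bar> \<le> R \<Longrightarrow> m \<le> g x"
proof (cases "0 \<le> R")
  case True
  obtain x0 where "x0 \<in> {-R..R}" "\<forall>x\<in>{-R..R}. g x0 \<le> g x"
    using continuous_attains_inf[of "{-R..R}" g] True continuous_on_subset[OF density(2)] by auto
  then show ?thesis using that[of "g x0"] g_pos by (auto simp: abs_le_iff)
next
  case False
  then show ?thesis using that[of 1] by auto
qed

lemma g_upper:
  obtains G where "0 \<le> G" "\<And>x. g x \<le> G"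
proof -
  obtain G where G: "\<And>x. (\<bar>x\<bar> + 1) * g x \<le> G" using g_bound by (auto simp: bdd_above_def)
  have "g x \<le> G" for x
  proof -
    have "1 * g x \<le> (\<bar>x\<bar> + 1) * g x" using g_pos[of x] by (intro mult_right_mono) auto
    then show ?thesis using G[of x] by simp
  qed
  moreover have "0 \<le> G" using calculation[of 0] g_pos[of 0] by linarith
  ultimately show ?thesis using that by blast
qed

lemma chain: "egarch_chain W \<beta>"
proof -
  interpret W: prob_space W unfolding W_def by (rule prob_space_distr) simp
  show ?thesis
  proof
    show "sets W = sets borel" by (simp add: W_def)
    show "AE w in W. 0 \<le> w" unfolding W_def by (subst AE_distr_iff) (auto simp: shock_bounds)
    have "integrable M (\<lambda>\<omega>. (shock (X \<omega>))\<^sup>2)"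
    proof (rule Bochner_Integration.integrable_bound)
      show "integrable M (\<lambda>\<omega>. (2 * \<gamma>)\<^sup>2 * (X \<omega>)\<^sup>2)" using second_moment by simp
      show "AE \<omega> in M. norm ((shock (X \<omega>))\<^sup>2) \<le> norm ((2 * \<gamma>)\<^sup>2 * (X \<omega>)\<^sup>2)"
      proof (rule AE_I2)
        fix \<omega>
        have "(shock (X \<omega>))\<^sup>2 \<le> (2 * \<gamma> * \<bar>X \<omega>\<bar>)\<^sup>2" using shock_bounds by (intro power_mono)
        then show "norm ((shock (X \<omega>))\<^sup>2) \<le> norm ((2 * \<gamma>)\<^sup>2 * (X \<omega>)\<^sup>2)" by (simp add: power_mult_distrib)
      qed
    qed simp
    then show "integrable W (\<lambda>w. w\<^sup>2)" unfolding W_def by (subst integrable_distr_eq) auto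
    show "0 < emeasure W {w. \<bar>w\<bar> < e}" if e: "0 < e" for e
    proof -
      define r where "r = e / (2 * \<gamma> + 1)"
      have r: "0 < r" using e gamma_nonneg by (simp add: r_def)
      obtain m where m: "0 < m" "\<And>x. \<bar>x\<bar> \<le> r \<Longrightarrow> m \<le> g x" using g_lower by blast
      have "0 < ennreal m * ennreal (r / 2)" using m r by (simp add: ennreal_zero_less_mult_iff)
      also have "ennreal (r / 2) = emeasure lborel {0..r / 2}" using r by simp
      also have "ennreal m * \<dots> = (\<integral>\<^sup>+x. ennreal m * indicator {0..r / 2} x \<partial>lborel)" by (simp add: nn_integral_cmult)
      also have "\<dots> \<le> (\<integral>\<^sup>+x. ennreal (g x) * indicator {w. \<bar>w\<bar> < e} (shock x) \<partial>lborel)"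
      proof (intro nn_integral_mono)
        fix x :: real
        have "\<bar>shock x\<bar> < e" if "0 \<le> x" "x \<le> r / 2"
        proof -
          have "shock x \<le> 2 * \<gamma> * x" using shock_bounds(2)[of x] that by simp
          also have "\<dots> \<le> (2 * \<gamma> + 1) * x" using that by (simp add: algebra_simps)
          also have "\<dots> \<le> (2 * \<gamma> + 1) * (r / 2)" using that gamma_nonneg by (intro mult_left_mono) auto
          also have "\<dots> = e / 2"
          proof -
            have "2 * \<gamma> + 1 \<noteq> 0" using gamma_nonneg by linarith
            then have "(2 * \<gamma> + 1) * r = e" by (simp add: r_def)
            then show ?thesis by simp
          qed
          finally show ?thesis using shock_bounds(1)[of x] e by simp
        qed
        then show "ennreal m * indicator {0..r / 2} x \<le> ennreal (g x) * indicator {w. \<bar>w\<bar> < e} (shock x)"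
          using m(2)[of x] r by (auto simp: indicator_def intro!: ennreal_leI)
      qed
      also have "\<dots> = (\<integral>\<^sup>+w. indicator {w. \<bar>w\<bar> < e} w \<partial>W)" by (subst nn_integral_W) auto
      also have "\<dots> = emeasure W {w. \<bar>w\<bar> < e}" by (rule nn_integral_indicator) (simp add: W_def)
      finally show ?thesis .
    qed
  qed (use params in auto)
qed

text \<open>On the half line where the slope of the shock is \<open>c = \<gamma> + \<bar>\<delta>\<bar> > 0\<close>, the shock is a linear image of the
  innovation.\<close>

lemma W_lower:
  assumes \<gamma>: "0 < \<gamma>" and L: "0 < L"
  shows "\<exists>m>0. \<forall>f\<in>borel_measurable borel.
      ennreal m * (\<integral>\<^sup>+w. f w * indicator {0..L} w \<partial>lborel) \<le> (\<integral>\<^sup>+w. f w \<partial>W)"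
proof -
  define s :: real where "s = (if 0 \<le> \<delta> then 1 else - 1)"
  define c where "c = \<gamma> + \<bar>\<delta>\<bar>"
  have c: "0 < c" using \<gamma> by (simp add: c_def)
  have s: "shock (s * y) = c * y" if "0 \<le> y" for y
    using that by (auto simp: shock_def s_def c_def abs_mult algebra_simps)
  obtain m where m: "0 < m" "\<And>x. \<bar>x\<bar> \<le> L / c \<Longrightarrow> m \<le> g x" using g_lower by blast
  have "ennreal (m / c) * (\<integral>\<^sup>+w. f w * indicator {0..L} w \<partial>lborel) \<le> (\<integral>\<^sup>+w. f w \<partial>W)"
    if f [measurable]: "f \<in> borel_measurable borel" for f
  proof -
    have "(\<integral>\<^sup>+w. f w * indicator {0..L} w \<partial>lborel)
        = ennreal \<bar>c\<bar> * (\<integral>\<^sup>+y. f (0 + c * y) * indicator {0..L} (0 + c * y) \<partial>lborel)"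
      using c by (intro nn_integral_real_affine) auto
    then have "ennreal (m / c) * (\<integral>\<^sup>+w. f w * indicator {0..L} w \<partial>lborel)
        = (ennreal (m / c) * ennreal c) * (\<integral>\<^sup>+y. f (c * y) * indicator {0..L} (c * y) \<partial>lborel)"
      using c by (simp add: mult.assoc)
    also have "ennreal (m / c) * ennreal c = ennreal m" using c m by (simp add: ennreal_mult[symmetric])
    also have "ennreal m * (\<integral>\<^sup>+y. f (c * y) * indicator {0..L} (c * y) \<partial>lborel)
        = (\<integral>\<^sup>+y. ennreal m * (f (c * y) * indicator {0..L} (c * y)) \<partial>lborel)"
      by (rule nn_integral_cmult[symmetric]) measurable
    also have "\<dots> \<le> (\<integral>\<^sup>+y. ennreal (g (0 + s * y)) * f (shock (0 + s * y)) \<partial>lborel)"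
    proof (intro nn_integral_mono)
      fix y
      show "ennreal m * (f (c * y) * indicator {0..L} (c * y)) \<le> ennreal (g (0 + s * y)) * f (shock (0 + s * y))"
      proof (cases "c * y \<in> {0..L}")
        case True
        then have y: "0 \<le> y" "y \<le> L / c" using c by (auto simp: zero_le_mult_iff field_simps)
        then have "\<bar>s * y\<bar> \<le> L / c" by (simp add: s_def abs_mult)
        then have "ennreal m \<le> ennreal (g (s * y))" using m(2) by (intro ennreal_leI)
        then show ?thesis using True s[OF y(1)] by (simp add: mult_right_mono)
      qed simp
    qed
    also have "\<dots> = (\<integral>\<^sup>+w. f w \<partial>W)"
    proof -
      have "(\<integral>\<^sup>+w. f w \<partial>W) = ennreal \<bar>s\<bar> * (\<integral>\<^sup>+y. ennreal (g (0 + s * y)) * f (shock (0 + s * y)) \<partial>lborel)"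
        unfolding nn_integral_W[OF f] by (rule nn_integral_real_affine) (auto simp: s_def)
      then show ?thesis by (simp add: s_def split: if_splits)
    qed
    finally show ?thesis .
  qed
  then show ?thesis using m c by (intro exI[of _ "m / c"]) auto
qed

text \<open>Each half line contributes a bounded density if the slope of the shock is positive there, and
  mass at \<open>0\<close> if the slope vanishes. As \<open>\<gamma> > 0\<close>, at most one slope vanishes, so that the mass at
  \<open>0\<close> is at most 1.\<close>

lemma W_upper:
  assumes \<gamma>: "0 < \<gamma>"
  obtains B where "0 \<le> B" "\<And>f. f \<in> borel_measurable borel \<Longrightarrow>
      (\<integral>\<^sup>+w. f w \<partial>W) \<le> f 0 + ennreal B * (\<integral>\<^sup>+w. f w \<partial>lborel)"
proof -
  obtain G where G: "0 \<le> G" "\<And>x. g x \<le> G" using g_upper by blast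
  define a where "a = \<gamma> + \<delta>"
  define b where "b = \<gamma> - \<delta>"
  have ab: "0 \<le> a" "0 \<le> b" "a \<noteq> 0 \<or> b \<noteq> 0" using params(1) \<gamma> by (auto simp: a_def b_def)
  have shock: "shock x = (if 0 \<le> x then a * x else - b * x)" for x
    by (simp add: shock_def a_def b_def algebra_simps)
  have gint: "(\<integral>\<^sup>+x. ennreal (g x) \<partial>lborel) = 1"
    using distributed_nn_integral[OF density(1), of "\<lambda>_. 1"] emeasure_space_1 by simp
  define ia where "ia = (if a = 0 then 0 else 1 / a)"
  define ib where "ib = (if b = 0 then 0 else 1 / b)"
  have i: "0 \<le> ia" "0 \<le> ib" using ab by (auto simp: ia_def ib_def)
  have "(\<integral>\<^sup>+w. f w \<partial>W) \<le> f 0 + ennreal (G * (ia + ib)) * (\<integral>\<^sup>+w. f w \<partial>lborel)"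
    if f [measurable]: "f \<in> borel_measurable borel" for f
  proof -
    have sc: "(\<integral>\<^sup>+x. f (c * x) \<partial>lborel) = ennreal (1 / \<bar>c\<bar>) * (\<integral>\<^sup>+w. f w \<partial>lborel)" if "c \<noteq> 0" for c :: real
    proof -
      have "ennreal (1 / \<bar>c\<bar>) * (\<integral>\<^sup>+w. f w \<partial>lborel) = ennreal (1 / \<bar>c\<bar>) * (ennreal \<bar>c\<bar> * (\<integral>\<^sup>+x. f (0 + c * x) \<partial>lborel))"
        using nn_integral_real_affine[OF f that, of 0] by simp
      also have "\<dots> = (ennreal (1 / \<bar>c\<bar>) * ennreal \<bar>c\<bar>) * (\<integral>\<^sup>+x. f (c * x) \<partial>lborel)" by (simp add: mult.assoc)
      also have "ennreal (1 / \<bar>c\<bar>) * ennreal \<bar>c\<bar> = 1" using that by (subst ennreal_mult[symmetric]) auto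
      finally show ?thesis by simp
    qed
    define A1 where "A1 x = (if a = 0 then 0 else f (a * x))" for x
    define B1 where "B1 x = (if b = 0 then 0 else f (- b * x))" for x
    have [measurable]: "A1 \<in> borel_measurable borel" "B1 \<in> borel_measurable borel"
      unfolding A1_def[abs_def] B1_def[abs_def] by measurable
    have IA: "(\<integral>\<^sup>+x. A1 x \<partial>lborel) = ennreal ia * (\<integral>\<^sup>+w. f w \<partial>lborel)"
      using sc[of a] ab by (cases "a = 0") (auto simp: A1_def ia_def)
    have IB: "(\<integral>\<^sup>+x. B1 x \<partial>lborel) = ennreal ib * (\<integral>\<^sup>+w. f w \<partial>lborel)"
      using sc[of "- b"] ab by (cases "b = 0") (auto simp: B1_def ib_def)
    have "(\<integral>\<^sup>+w. f w \<partial>W) \<le> (\<integral>\<^sup>+x. f 0 * ennreal (g x) + ennreal G * (A1 x + B1 x) \<partial>lborel)"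
      unfolding nn_integral_W[OF f]
    proof (intro nn_integral_mono)
      fix x
      have gG: "ennreal (g x) \<le> ennreal G" using G(2) by (intro ennreal_leI)
      have "f (shock x) = f 0 \<or> f (shock x) = A1 x \<or> f (shock x) = B1 x"
        by (auto simp: shock A1_def B1_def)
      then show "ennreal (g x) * f (shock x) \<le> f 0 * ennreal (g x) + ennreal G * (A1 x + B1 x)"
      proof (elim disjE)
        assume "f (shock x) = f 0"
        then show ?thesis by (simp add: mult.commute)
      next
        assume "f (shock x) = A1 x"
        then have "ennreal (g x) * f (shock x) \<le> ennreal G * (A1 x + B1 x)"
          by (simp only:) (intro mult_mono gG; simp)
        then show ?thesis by (simp add: add_increasing)
      next
        assume "f (shock x) = B1 x"
        then have "ennreal (g x) * f (shock x) \<le> ennreal G * (A1 x + B1 x)"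
          by (simp only:) (intro mult_mono gG; simp)
        then show ?thesis by (simp add: add_increasing)
      qed
    qed
    also have "\<dots> = f 0 + ennreal G * (ennreal ia * (\<integral>\<^sup>+w. f w \<partial>lborel) + ennreal ib * (\<integral>\<^sup>+w. f w \<partial>lborel))"
      by (simp add: nn_integral_add nn_integral_cmult gint IA IB)
    also have "\<dots> = f 0 + ennreal (G * (ia + ib)) * (\<integral>\<^sup>+w. f w \<partial>lborel)"
      using G i by (simp add: ennreal_mult distrib_right mult.assoc)
    finally show ?thesis .
  qed
  moreover have "0 \<le> G * (ia + ib)" using G i by simp
  ultimately show ?thesis using that by blast
qed

lemma lyapunov_exponent:
  assumes lam: "lam = ereal_expectation M (\<lambda>\<omega>. log_abs (\<beta> - 1/2 * (\<gamma> * \<bar>X \<omega>\<bar> + \<delta> * X \<omega>)))"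
  shows "lam = enn2ereal (egarch_chain.log_pos W \<beta>) - enn2ereal (egarch_chain.log_neg W \<beta>)"
proof -
  have "(\<integral>\<^sup>+\<omega>. e2ennreal (log_abs (\<beta> - 1/2 * (\<gamma> * \<bar>X \<omega>\<bar> + \<delta> * X \<omega>))) \<partial>M)
      = (\<integral>\<^sup>+\<omega>. ennreal (ln \<bar>\<beta> - shock (X \<omega>) / 2\<bar>) \<partial>M)"
  proof (intro nn_integral_cong)
    fix \<omega>
    have k: "\<beta> - 1/2 * (\<gamma> * \<bar>X \<omega>\<bar> + \<delta> * X \<omega>) = \<beta> - shock (X \<omega>) / 2" by (simp add: shock_def)
    show "e2ennreal (log_abs (\<beta> - 1/2 * (\<gamma> * \<bar>X \<omega>\<bar> + \<delta> * X \<omega>))) = ennreal (ln \<bar>\<beta> - shock (X \<omega>) / 2\<bar>)"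
      unfolding k by (cases "\<beta> - shock (X \<omega>) / 2 = 0") (simp_all only: log_abs_def, simp_all add: e2ennreal_neg e2ennreal_ereal)
  qed
  also have "\<dots> = egarch_chain.log_pos W \<beta>"
    unfolding egarch_chain.log_pos_def[OF chain] unfolding W_def by (subst nn_integral_distr) auto
  finally have 1: "(\<integral>\<^sup>+\<omega>. e2ennreal (log_abs (\<beta> - 1/2 * (\<gamma> * \<bar>X \<omega>\<bar> + \<delta> * X \<omega>))) \<partial>M) = egarch_chain.log_pos W \<beta>" .
  have "(\<integral>\<^sup>+\<omega>. e2ennreal (- log_abs (\<beta> - 1/2 * (\<gamma> * \<bar>X \<omega>\<bar> + \<delta> * X \<omega>))) \<partial>M)
      = (\<integral>\<^sup>+\<omega>. neg_log (\<beta> - shock (X \<omega>) / 2) \<partial>M)"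
    by (intro nn_integral_cong) (auto simp: log_abs_def shock_def neg_log_def e2ennreal_ereal)
  also have "\<dots> = egarch_chain.log_neg W \<beta>"
    unfolding egarch_chain.log_neg_def[OF chain] unfolding W_def by (subst nn_integral_distr) auto
  finally show ?thesis unfolding lam ereal_expectation_def 1 by simp
qed

text \<open>If \<open>\<gamma> = 0\<close>, the shock vanishes and the exponent is \<open>ln \<beta> < 0\<close>.\<close>

lemma expanding_chain:
  assumes "0 < enn2ereal (egarch_chain.log_pos W \<beta>) - enn2ereal (egarch_chain.log_neg W \<beta>)"
  obtains B l where "egarch_chain_expanding W \<beta> B l" "0 < \<gamma>"
proof -
  interpret C: egarch_chain W 0 \<beta> by (rule chain)
  obtain l where l: "0 < (l::real)" "\<And>\<tau>. 0 < \<tau> \<Longrightarrow> l \<le> (LINT w|W. ln (max \<tau> \<bar>\<beta> - w / 2\<bar>))"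
    using C.expanding_if_positive assms by blast
  have \<gamma>: "0 < \<gamma>"
  proof (rule ccontr)
    assume "\<not> 0 < \<gamma>"
    then have 0: "\<gamma> = 0" "\<delta> = 0" using gamma_nonneg params(1) by auto
    have sh: "shock x = 0" for x unfolding shock_def using 0 by simp
    have "(LINT w|W. ln (max \<beta> \<bar>\<beta> - w / 2\<bar>)) = (LINT \<omega>|M. ln (max \<beta> \<bar>\<beta> - shock (X \<omega>) / 2\<bar>))"
      unfolding W_def by (subst integral_distr) auto
    also have "\<dots> = ln \<beta>" using params by (simp add: sh prob_space)
    also have "\<dots> < 0" using params by simp
    finally show False using l(2)[of \<beta>] l(1) params by simp
  qed
  obtain B where B: "0 \<le> B" "\<And>f. f \<in> borel_measurable borel \<Longrightarrow>
      (\<integral>\<^sup>+w. f w \<partial>W) \<le> f 0 + ennreal B * (\<integral>\<^sup>+w. f w \<partial>lborel)"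
    using W_upper[OF \<gamma>] by blast
  have "egarch_chain_expanding W \<beta> B l"
    by unfold_locales (use B l W_lower[OF \<gamma>] in auto)
  with that \<gamma> show ?thesis by blast
qed

end

section \<open>The stationary EGARCH volatility\<close>

text \<open>An independent starting point and shock sequence have the product law, and Fubini's theorem
  applies.\<close>

lemma (in random_recursion) orbit_AE_transfer:
  assumes N: "prob_space N"
    and X0 [measurable]: "X0 \<in> borel_measurable N" and Y [measurable]: "Y \<in> N \<rightarrow>\<^sub>M S"
    and joint: "distr N (borel \<Otimes>\<^sub>M S) (\<lambda>\<omega>. (X0 \<omega>, Y \<omega>)) = distr N borel X0 \<Otimes>\<^sub>M S"
    and A [measurable]: "A \<in> sets paths" and one: "AE \<omega> in N. path_prob A (X0 \<omega>) = 1"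
  shows "AE \<omega> in N. orbit (X0 \<omega>) (Y \<omega>) \<in> A"
proof -
  interpret N: prob_space N by fact
  interpret D: prob_space "distr N borel X0" by (rule N.prob_space_distr) simp
  have "AE z in distr N borel X0 \<Otimes>\<^sub>M S. orbit (fst z) (snd z) \<in> A"
  proof (rule pair_sigma_finite.AE_pair_measure)
    show "pair_sigma_finite (distr N borel X0) S"
      by (intro pair_sigma_finite.intro prob_space_imp_sigma_finite D.prob_space_axioms P.prob_space_axioms)
    show "{z \<in> space (distr N borel X0 \<Otimes>\<^sub>M S). orbit (fst z) (snd z) \<in> A} \<in> sets (distr N borel X0 \<Otimes>\<^sub>M S)"
      by measurable
    have "AE x in distr N borel X0. path_prob A x = 1"
      using one by (subst AE_distr_iff) auto
    then show "AE x in distr N borel X0. AE w in S. orbit (fst (x, w)) (snd (x, w)) \<in> A"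
    proof eventually_elim
      case (elim x)
      have "1 + path_prob (- A) x = 1 + 0" using path_prob_compl[OF A, of x] elim by simp
      then have "path_prob (- A) x = 0" unfolding ennreal_add_left_cancel by simp
      then have "emeasure S {w \<in> space S. \<not> orbit x w \<in> A} = 0" by (simp add: path_prob_def)
      then show ?case by (subst AE_iff_measurable[OF _ refl]) auto
    qed
  qed
  then show ?thesis unfolding joint[symmetric] by (subst (asm) AE_distr_iff) auto
qed

lemma (in prob_space) joint_distr_indep:
  assumes X [measurable]: "X \<in> M \<rightarrow>\<^sub>M L" and Y [measurable]: "Y \<in> M \<rightarrow>\<^sub>M K"
    and indep: "indep_set (sets (vimage_algebra (space M) X L)) (sets (vimage_algebra (space M) Y K))"
  shows "distr M (L \<Otimes>\<^sub>M K) (\<lambda>\<omega>. (X \<omega>, Y \<omega>)) = distr M L X \<Otimes>\<^sub>M distr M K Y"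
proof (rule pair_measure_eqI[symmetric])
  show "sigma_finite_measure (distr M L X)" "sigma_finite_measure (distr M K Y)"
    by (intro prob_space_imp_sigma_finite prob_space_distr; simp)+
  fix A B assume A: "A \<in> sets (distr M L X)" and B: "B \<in> sets (distr M K Y)"
  then have [measurable]: "A \<in> sets L" "B \<in> sets K" by auto
  have "prob ((X -` A \<inter> space M) \<inter> (Y -` B \<inter> space M)) = prob (X -` A \<inter> space M) * prob (Y -` B \<inter> space M)"
    by (rule indep_setD[OF indep]) (use A B in \<open>auto intro: in_vimage_algebra\<close>)
  moreover have "(\<lambda>\<omega>. (X \<omega>, Y \<omega>)) -` (A \<times> B) \<inter> space M = (X -` A \<inter> space M) \<inter> (Y -` B \<inter> space M)"
    by auto
  ultimately show "emeasure (distr M L X) A * emeasure (distr M K Y) B = emeasure (distr M (L \<Otimes>\<^sub>M K) (\<lambda>\<omega>. (X \<omega>, Y \<omega>))) (A \<times> B)"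
    by (simp add: emeasure_distr emeasure_eq_measure ennreal_mult)
qed simp

lemma strictly_stationary_distr:
  fixes X :: "'t::comm_monoid_add \<Rightarrow> 'a \<Rightarrow> 's"
  assumes "strictly_stationary M S X"
  shows "distr M S (X t) = distr M S (X 0)"
proof -
  have X: "X t \<in> M \<rightarrow>\<^sub>M S" for t using assms by (simp add: strictly_stationary_def)
  let ?P = "\<Pi>\<^sub>M t\<in>UNIV. S"
  have m: "(\<lambda>w t. X (f t) w) \<in> M \<rightarrow>\<^sub>M ?P" for f
    using measurable_restrict[of UNIV "\<lambda>t. X (f t)" M "\<lambda>_. S"] X by (simp add: restrict_UNIV)
  have c: "(\<lambda>y. y 0) \<in> ?P \<rightarrow>\<^sub>M S" by (rule measurable_component_singleton) simp
  have "distr (distr M ?P (\<lambda>w s. X (s + t) w)) S (\<lambda>y. y 0) = distr (distr M ?P (\<lambda>w s. X s w)) S (\<lambda>y. y 0)"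
    using assms unfolding strictly_stationary_def by metis
  then show ?thesis
    by (simp add: distr_distr[OF c m] comp_def)
qed

locale egarch_process = egarch_innovation M "\<epsilon> 0" g \<beta> \<gamma> \<delta>
  for M :: "'a measure" and \<epsilon> :: "int \<Rightarrow> 'a \<Rightarrow> real" and g \<beta> \<gamma> \<delta> +
  fixes \<alpha> :: real and \<sigma> :: "int \<Rightarrow> 'a \<Rightarrow> real"
  assumes iid: "iid M borel \<epsilon>" and volatility: "egarch_stationary M \<alpha> \<beta> \<gamma> \<delta> \<epsilon> \<sigma>"
begin

sublocale C: egarch_chain W \<alpha> \<beta>
  by (rule chain)

lemma innovations_indep: "indep_vars (\<lambda>_. borel) \<epsilon> UNIV"
  using iid by (simp add: iid_def)

lemma eps_measurable [measurable]: "\<epsilon> t \<in> borel_measurable M"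
  using innovations_indep by (auto simp: indep_vars_def)

lemma eps_distr: "distr M borel (\<epsilon> t) = distr M borel (\<epsilon> 0)"
  using iid by (simp add: iid_def)

lemma shock_distr: "distr M borel (\<lambda>\<omega>. shock (\<epsilon> t \<omega>)) = W"
proof -
  have "distr M borel (\<lambda>\<omega>. shock (\<epsilon> t \<omega>)) = distr (distr M borel (\<epsilon> t)) borel shock" for t
    by (subst distr_distr) (auto simp: comp_def)
  then show ?thesis unfolding W_def by (simp add: eps_distr[of t])
qed

definition shocks :: "'a \<Rightarrow> nat \<Rightarrow> real" where "shocks \<omega> t = shock (\<epsilon> (int t) \<omega>)"

lemma shocks_measurable [measurable]: "shocks \<in> M \<rightarrow>\<^sub>M C.S"
proof -
  have "(\<lambda>\<omega>. \<lambda>t\<in>UNIV. shock (\<epsilon> (int t) \<omega>)) \<in> M \<rightarrow>\<^sub>M C.S"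
    by (intro measurable_restrict) (simp add: measurable_cong_sets[OF refl C.sets_W])
  then show ?thesis by (simp add: shocks_def[abs_def] restrict_UNIV)
qed

lemma shocks_distr: "distr M C.S shocks = C.S"
proof -
  let ?Pi = "\<Pi>\<^sub>M t\<in>(UNIV::int set). W"
  have "indep_vars (\<lambda>_. borel) (\<lambda>t \<omega>. shock (\<epsilon> t \<omega>)) UNIV"
    by (rule indep_vars_compose2[OF innovations_indep]) simp
  then have "distr M (\<Pi>\<^sub>M t\<in>(UNIV::int set). borel) (\<lambda>\<omega>. \<lambda>t\<in>UNIV. shock (\<epsilon> t \<omega>)) = ?Pi"
    by (subst (asm) indep_vars_iff_distr_eq_PiM') (auto simp: shock_distr)
  then have law: "distr M ?Pi (\<lambda>\<omega> t. shock (\<epsilon> t \<omega>)) = ?Pi"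
    by (simp add: restrict_UNIV distr_cong[OF refl sets_PiM_cong[OF refl C.sets_W]])
  have m: "(\<lambda>\<omega> t. shock (\<epsilon> t \<omega>)) \<in> M \<rightarrow>\<^sub>M ?Pi"
    using measurable_restrict[of UNIV "\<lambda>t \<omega>. shock (\<epsilon> t \<omega>)" M "\<lambda>_. W"]
    by (simp add: restrict_UNIV measurable_cong_sets[OF refl C.sets_W])
  have c: "(\<lambda>y n. y (int n)) \<in> ?Pi \<rightarrow>\<^sub>M C.S"
    using measurable_restrict[of UNIV "\<lambda>n y. y (int n)" ?Pi "\<lambda>_. W"] by (simp add: restrict_UNIV)
  have "C.S = distr ?Pi C.S (\<lambda>y n. y (int n))"
    using distr_PiM_reindex[of UNIV "\<lambda>_. W" int UNIV] C.prob_space_W by (simp add: restrict_UNIV)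
  also have "\<dots> = distr (distr M ?Pi (\<lambda>\<omega> t. shock (\<epsilon> t \<omega>))) C.S (\<lambda>y n. y (int n))"
    by (simp add: law)
  also have "\<dots> = distr M C.S shocks"
    by (subst distr_distr[OF c m]) (simp add: comp_def shocks_def[abs_def])
  finally show ?thesis by simp
qed

lemma sigma_measurable [measurable]: "\<sigma> t \<in> borel_measurable M"
  using volatility by (auto simp: egarch_stationary_def strictly_stationary_def)

lemma sigma_distr: "distr M borel (\<sigma> t) = distr M borel (\<sigma> 0)"
  using volatility strictly_stationary_distr by (auto simp: egarch_stationary_def)

definition level :: "int \<Rightarrow> 'a \<Rightarrow> real" where "level t \<omega> = ln ((\<sigma> t \<omega>)\<^sup>2)"

lemma level_measurable [measurable]: "level t \<in> borel_measurable M"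
  unfolding level_def[abs_def] by measurable

lemma level_step: "AE \<omega> in M. \<forall>t. \<sigma> t \<omega> > 0 \<and> level t \<omega> = \<alpha> + \<beta> * level (t - 1) \<omega> + shock (\<epsilon> (t - 1) \<omega>)"
  unfolding AE_all_countable
proof
  fix t
  have "AE \<omega> in M. \<sigma> t \<omega> > 0 \<and>
        ln ((\<sigma> t \<omega>)\<^sup>2) = \<alpha> + \<gamma> * \<bar>\<epsilon> (t - 1) \<omega>\<bar> + \<delta> * \<epsilon> (t - 1) \<omega> + \<beta> * ln ((\<sigma> (t - 1) \<omega>)\<^sup>2)"
    using volatility by (auto simp: egarch_stationary_def)
  then show "AE \<omega> in M. \<sigma> t \<omega> > 0 \<and> level t \<omega> = \<alpha> + \<beta> * level (t - 1) \<omega> + shock (\<epsilon> (t - 1) \<omega>)"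
    by eventually_elim (simp add: level_def shock_def)
qed

definition past :: "'a \<Rightarrow> int \<Rightarrow> real" where "past \<omega> = restrict (\<lambda>t. \<epsilon> t \<omega>) {..<0}"

definition past_sum :: "nat \<Rightarrow> (int \<Rightarrow> real) \<Rightarrow> real" where
  "past_sum k y = (\<Sum>j<k. \<beta> ^ j * (\<alpha> + shock (y (- int j - 1))))"

definition level_of_past :: "(int \<Rightarrow> real) \<Rightarrow> real" where
  "level_of_past y = lim (\<lambda>k. past_sum k y)"

lemma shock_coordinate_measurable:
  assumes "t \<in> I"
  shows "(\<lambda>y. shock (y t)) \<in> borel_measurable (\<Pi>\<^sub>M t\<in>I. borel)"
proof -
  have "(\<lambda>y. y t) \<in> (\<Pi>\<^sub>M t\<in>I. borel) \<rightarrow>\<^sub>M (borel :: real measure)"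
    using assms by (rule measurable_component_singleton)
  then show ?thesis by (rule measurable_compose) simp
qed

lemma past_sum_measurable: "past_sum k \<in> borel_measurable (\<Pi>\<^sub>M t\<in>{..<0}. borel)"
  unfolding past_sum_def[abs_def]
  by (intro borel_measurable_sum borel_measurable_times borel_measurable_add borel_measurable_const
      shock_coordinate_measurable) auto

lemma level_of_past_measurable: "level_of_past \<in> borel_measurable (\<Pi>\<^sub>M t\<in>{..<0}. borel)"
  unfolding level_of_past_def[abs_def] by (intro borel_measurable_lim_metric past_sum_measurable)

lemma past_measurable [measurable]: "past \<in> M \<rightarrow>\<^sub>M (\<Pi>\<^sub>M t\<in>{..<0}. borel)"
  unfolding past_def[abs_def] by (intro measurable_restrict) simp

text \<open>The innovations before time 0 and those from time 0 on are independent.\<close>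

lemma past_future_joint:
  assumes f: "f \<in> (\<Pi>\<^sub>M t\<in>{..<0::int}. borel) \<rightarrow>\<^sub>M L"
  shows "distr M (L \<Otimes>\<^sub>M C.S) (\<lambda>\<omega>. (f (past \<omega>), shocks \<omega>)) = distr M L (\<lambda>\<omega>. f (past \<omega>)) \<Otimes>\<^sub>M C.S"
proof -
  let ?past = "\<Pi>\<^sub>M t\<in>{..<0::int}. (borel :: real measure)"
    and ?fut = "\<Pi>\<^sub>M t\<in>{0::int..}. (borel :: real measure)"
  define future where "future \<omega> = restrict (\<lambda>t. \<epsilon> t \<omega>) {0..}" for \<omega>
  have [measurable]: "future \<in> M \<rightarrow>\<^sub>M ?fut"
    unfolding future_def[abs_def] by (intro measurable_restrict) simp
  define k :: "(int \<Rightarrow> real) \<Rightarrow> nat \<Rightarrow> real" where "k y n = shock (y (int n))" for y n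
  have k: "k \<in> ?fut \<rightarrow>\<^sub>M C.S"
  proof -
    have "(\<lambda>y. shock (y (int n))) \<in> ?fut \<rightarrow>\<^sub>M W" for n
      unfolding measurable_cong_sets[OF refl C.sets_W]
      by (rule shock_coordinate_measurable) auto
    then have "(\<lambda>y. \<lambda>n\<in>UNIV. shock (y (int n))) \<in> ?fut \<rightarrow>\<^sub>M C.S"
      by (intro measurable_restrict)
    then show ?thesis by (simp add: restrict_UNIV k_def[abs_def])
  qed
  have sh: "shocks = (\<lambda>\<omega>. k (future \<omega>))" by (simp add: fun_eq_iff shocks_def k_def future_def)
  have "indep_var ?past past ?fut future"
    unfolding past_def[abs_def] future_def[abs_def] by (rule indep_var_restrict[OF innovations_indep]) auto
  then have joint: "distr M ?past past \<Otimes>\<^sub>M distr M ?fut future = distr M (?past \<Otimes>\<^sub>M ?fut) (\<lambda>\<omega>. (past \<omega>, future \<omega>))"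
    unfolding indep_var_distribution_eq by blast
  have fk: "distr (distr M ?past past) L f = distr M L (\<lambda>\<omega>. f (past \<omega>))"
    "distr (distr M ?fut future) C.S k = C.S"
    using f k shocks_distr by (simp_all add: distr_distr comp_def sh)
  have "distr M L (\<lambda>\<omega>. f (past \<omega>)) \<Otimes>\<^sub>M C.S
      = distr (distr M ?past past \<Otimes>\<^sub>M distr M ?fut future) (L \<Otimes>\<^sub>M C.S) (\<lambda>(x, y). (f x, k y))"
    using f k fk by (subst pair_measure_distr[symmetric])
      (auto intro: prob_space_imp_sigma_finite C.P.prob_space_axioms)
  also have "\<dots> = distr M (L \<Otimes>\<^sub>M C.S) (\<lambda>\<omega>. (f (past \<omega>), shocks \<omega>))"
    unfolding joint using f k by (subst distr_distr) (auto simp: comp_def sh split_beta')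
  finally show ?thesis by simp
qed

lemma level_back: "AE \<omega> in M. \<forall>k. level 0 \<omega> = past_sum k (past \<omega>) + \<beta> ^ k * level (- int k) \<omega>"
  using level_step
proof eventually_elim
  case (elim \<omega>)
  show ?case
  proof
    fix k
    show "level 0 \<omega> = past_sum k (past \<omega>) + \<beta> ^ k * level (- int k) \<omega>"
    proof (induction k)
      case 0
      then show ?case by (simp add: past_sum_def)
    next
      case (Suc k)
      have "level (- int k) \<omega> = \<alpha> + \<beta> * level (- int k - 1) \<omega> + shock (\<epsilon> (- int k - 1) \<omega>)"
        using elim by blast
      moreover have "past \<omega> (- int k - 1) = \<epsilon> (- int k - 1) \<omega>" by (simp add: past_def)
      moreover have e: "- int (Suc k) = - int k - 1" by simp
      ultimately show ?case unfolding e using Suc by (simp add: past_sum_def algebra_simps)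
    qed
  qed
qed

lemma past_sum_converges: "AE \<omega> in M. convergent (\<lambda>k. past_sum k (past \<omega>))"
proof -
  have mean: "(\<integral>\<^sup>+\<omega>. ennreal (shock (\<epsilon> t \<omega>)) \<partial>M) \<le> ennreal C.shock_mean" for t
  proof -
    have "(\<integral>\<^sup>+\<omega>. ennreal (shock (\<epsilon> t \<omega>)) \<partial>M) = (\<integral>\<^sup>+w. ennreal w \<partial>W)"
      unfolding shock_distr[of t, symmetric] by (subst nn_integral_distr) auto
    also have "\<dots> \<le> ennreal (0 + 1 * C.shock_mean + 0 * C.shock_square_mean)" by (rule C.quadratic_bound) auto
    finally show ?thesis by simp
  qed
  have "(\<integral>\<^sup>+\<omega>. (\<Sum>j. ennreal (\<beta> ^ j * shock (\<epsilon> (- int j - 1) \<omega>))) \<partial>M)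
      = (\<Sum>j. ennreal (\<beta> ^ j) * (\<integral>\<^sup>+\<omega>. ennreal (shock (\<epsilon> (- int j - 1) \<omega>)) \<partial>M))"
    using params shock_bounds(1)
    by (subst nn_integral_suminf) (auto intro!: suminf_cong simp: ennreal_mult nn_integral_cmult)
  also have "\<dots> \<le> (\<Sum>j. ennreal (\<beta> ^ j * C.shock_mean))"
    using params C.shock_mean_nonneg by (intro suminf_le) (auto simp: ennreal_mult intro!: mult_left_mono mean)
  also have "\<dots> < \<infinity>"
  proof -
    have "summable (\<lambda>j. \<beta> ^ j * C.shock_mean)" using params by (intro summable_mult2 summable_geometric) auto
    then show ?thesis using params C.shock_mean_nonneg by (subst suminf_ennreal2) auto
  qed
  finally have "AE \<omega> in M. (\<Sum>j. ennreal (\<beta> ^ j * shock (\<epsilon> (- int j - 1) \<omega>))) \<noteq> \<infinity>"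
    by (intro nn_integral_noteq_infinite) auto
  then show ?thesis
  proof eventually_elim
    case (elim \<omega>)
    have "summable (\<lambda>j. \<beta> ^ j * shock (\<epsilon> (- int j - 1) \<omega>))"
      using elim params shock_bounds(1) by (intro summable_suminf_not_top) auto
    moreover have "summable (\<lambda>j. \<beta> ^ j * \<alpha>)" using params by (intro summable_mult2 summable_geometric) auto
    ultimately have "summable (\<lambda>j. \<beta> ^ j * \<alpha> + \<beta> ^ j * shock (\<epsilon> (- int j - 1) \<omega>))" by (intro summable_add)
    then show ?case
      unfolding past_sum_def summable_iff_convergent by (simp add: past_def distrib_left)
  qed
qed

lemma expectation_level:
  assumes [measurable]: "f \<in> borel_measurable borel"
  shows "expectation (\<lambda>\<omega>. f (level t \<omega>) :: real) = expectation (\<lambda>\<omega>. f (level 0 \<omega>))"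
proof -
  have "expectation (\<lambda>\<omega>. f (level t \<omega>)) = (LINT s|distr M borel (\<sigma> t). f (ln (s\<^sup>2)))" for t
    by (subst integral_distr) (auto simp: level_def)
  then show ?thesis by (simp add: sigma_distr[of t])
qed

text \<open>The recursion gives \<open>level 0 = past_sum k + \<beta>\<^sup>k level (- k)\<close>. The remainder converges almost
  surely because \<open>past_sum k\<close> does, and by stationarity it tends to \<open>0\<close> in probability. The latter is
  expressed by the mean of \<open>min 1 \<bar>x\<bar>\<close>.\<close>

lemma level_eq_past: "AE \<omega> in M. level 0 \<omega> = level_of_past (past \<omega>)"
proof -
  have [measurable]: "(\<lambda>\<omega>. level_of_past (past \<omega>)) \<in> borel_measurable M"
    "(\<lambda>\<omega>. past_sum k (past \<omega>)) \<in> borel_measurable M" for k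
    by (rule measurable_compose[OF past_measurable level_of_past_measurable],
        rule measurable_compose[OF past_measurable past_sum_measurable])
  define h :: "real \<Rightarrow> real" where "h x = min 1 \<bar>x\<bar>" for x
  have [measurable]: "h \<in> borel_measurable borel" unfolding h_def[abs_def] by measurable
  have h: "\<bar>h x\<bar> \<le> 1" "0 \<le> h x" for x by (auto simp: h_def)
  have hc: "((\<lambda>k. h (f k)) \<longlonglongrightarrow> h c)" if "f \<longlonglongrightarrow> c" for f c
    unfolding h_def using that by (intro tendsto_intros)
  let ?R = "\<lambda>\<omega>. level 0 \<omega> - level_of_past (past \<omega>)"
  have "(\<lambda>k. expectation (\<lambda>\<omega>. h (\<beta> ^ k * level (- int k) \<omega>))) \<longlonglongrightarrow> expectation (\<lambda>\<omega>. h (?R \<omega>))"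
  proof (rule integral_dominated_convergence[where w="\<lambda>_. 1"])
    show "AE \<omega> in M. (\<lambda>k. h (\<beta> ^ k * level (- int k) \<omega>)) \<longlonglongrightarrow> h (?R \<omega>)"
      using level_back past_sum_converges
    proof eventually_elim
      case (elim \<omega>)
      have "(\<lambda>k. past_sum k (past \<omega>)) \<longlonglongrightarrow> level_of_past (past \<omega>)"
        using elim(2) unfolding level_of_past_def by (simp add: convergent_LIMSEQ_iff)
      then have "(\<lambda>k. level 0 \<omega> - past_sum k (past \<omega>)) \<longlonglongrightarrow> ?R \<omega>" by (intro tendsto_intros)
      moreover have "level 0 \<omega> - past_sum k (past \<omega>) = \<beta> ^ k * level (- int k) \<omega>" for k
        using elim(1) by (simp add: diff_eq_eq add.commute)
      ultimately show ?case by (intro hc) simp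
    qed
  qed (use h in auto)
  moreover have "(\<lambda>k. expectation (\<lambda>\<omega>. h (\<beta> ^ k * level (- int k) \<omega>))) \<longlonglongrightarrow> 0"
  proof -
    have "expectation (\<lambda>\<omega>. h (\<beta> ^ k * level (- int k) \<omega>)) = expectation (\<lambda>\<omega>. h (\<beta> ^ k * level 0 \<omega>))" for k
      by (rule expectation_level) measurable
    moreover have "(\<lambda>k. expectation (\<lambda>\<omega>. h (\<beta> ^ k * level 0 \<omega>))) \<longlonglongrightarrow> expectation (\<lambda>\<omega>. 0)"
    proof (rule integral_dominated_convergence[where w="\<lambda>_. 1"])
      show "AE \<omega> in M. (\<lambda>k. h (\<beta> ^ k * level 0 \<omega>)) \<longlonglongrightarrow> 0"
      proof (rule AE_I2)
        fix \<omega>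
        have "(\<lambda>k. \<beta> ^ k * level 0 \<omega>) \<longlonglongrightarrow> 0 * level 0 \<omega>"
          using params by (intro tendsto_intros LIMSEQ_power_zero) auto
        from hc[OF this] show "(\<lambda>k. h (\<beta> ^ k * level 0 \<omega>)) \<longlonglongrightarrow> 0" by (simp add: h_def)
      qed
    qed (use h in auto)
    ultimately show ?thesis by simp
  qed
  ultimately have "expectation (\<lambda>\<omega>. h (?R \<omega>)) = 0" by (rule LIMSEQ_unique)
  moreover have "integrable M (\<lambda>\<omega>. h (?R \<omega>))"
    by (rule integrable_const_bound[where B=1]) (use h in auto)
  ultimately have "AE \<omega> in M. h (?R \<omega>) = 0"
    using h by (subst (asm) integral_nonneg_eq_0_iff_AE) auto
  then show ?thesis by eventually_elim (auto simp: h_def min_def split: if_splits)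
qed

text \<open>The shock takes no value with positive probability except possibly \<open>0\<close>, with probability \<open>q < 1\<close>. So an atom
  at \<open>c\<close> has at most \<open>q\<close> times the mass of the point \<open>(c - \<alpha>) / \<beta>\<close> one step earlier; iterate.\<close>

lemma level_no_atom:
  assumes \<gamma>: "0 < \<gamma>"
  shows "AE \<omega> in M. level 0 \<omega> \<noteq> c"
proof -
  define q where "q = measure W {0}"
  have q: "0 \<le> q" "q < 1"
  proof -
    obtain m where m: "0 < (m::real)" "\<forall>f\<in>borel_measurable borel.
      ennreal m * (\<integral>\<^sup>+w. f w * indicator {0..1} w \<partial>lborel) \<le> (\<integral>\<^sup>+w. f w \<partial>W)"
      using W_lower[OF \<gamma>, of 1] by auto
    have "ennreal m * (\<integral>\<^sup>+w. indicator (- {0::real}) w * indicator {0..1} w \<partial>lborel) \<le> (\<integral>\<^sup>+w. indicator (- {0}) w \<partial>W)"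
      using bspec[OF m(2), of "indicator (- {0})"] by simp
    moreover have "(\<integral>\<^sup>+w. indicator (- {0::real}) w * indicator {0..1} w \<partial>lborel) = (1::ennreal)"
    proof -
      have "(\<integral>\<^sup>+w. indicator (- {0::real}) w * indicator {0..1} w \<partial>lborel) = (\<integral>\<^sup>+w. indicator {0..1::real} w \<partial>lborel)"
        using AE_lborel_singleton[of "0::real"] by (intro nn_integral_cong_AE) (auto elim!: eventually_mono simp: indicator_def)
      also have "\<dots> = emeasure lborel {0..1::real}" by (rule nn_integral_indicator) simp
      also have "\<dots> = 1" by simp
      finally show ?thesis .
    qed
    moreover have "(\<integral>\<^sup>+w. indicator (- {0}) w \<partial>W) = emeasure W (- {0})"
      by (rule nn_integral_indicator) (simp add: C.sets_W)
    ultimately have "ennreal m \<le> emeasure W (- {0})" by simp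
    then have "0 < emeasure W (- {0})" using m(1) by (metis ennreal_less_zero_iff less_le_trans)
    then have pos: "0 < measure W (- {0})"
      using finite_measure.emeasure_eq_measure[OF prob_space.finite_measure[OF C.prob_space_W]] by simp
    have "measure W (space W - {0}) = 1 - measure W {0}"
      using prob_space.prob_compl[OF C.prob_space_W, of "{0}"] by (simp add: C.sets_W)
    moreover have "space W - {0} = - {0}" by (auto simp: W_def)
    ultimately show "0 \<le> q" "q < 1" using pos by (auto simp: q_def)
  qed
  have atom: "emeasure W {v} \<le> ennreal q * indicator {0} v" for v
  proof (cases "v = 0")
    case True
    then show ?thesis by (simp add: q_def finite_measure.emeasure_eq_measure[OF prob_space.finite_measure[OF C.prob_space_W]])
  next
    case False
    obtain B where B: "0 \<le> B" "\<And>f. f \<in> borel_measurable borel \<Longrightarrow>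
      (\<integral>\<^sup>+w. f w \<partial>W) \<le> f 0 + ennreal B * (\<integral>\<^sup>+w. f w \<partial>lborel)"
      using W_upper[OF \<gamma>] by blast
    have "emeasure W {v} = (\<integral>\<^sup>+w. indicator {v} w \<partial>W)" by (rule nn_integral_indicator[symmetric]) (simp add: C.sets_W)
    also have "\<dots> \<le> indicator {v} 0 + ennreal B * (\<integral>\<^sup>+w. indicator {v} w \<partial>lborel)" by (rule B(2)) simp
    also have "(\<integral>\<^sup>+w. indicator {v} w \<partial>lborel) = emeasure lborel {v}" by (rule nn_integral_indicator) simp
    finally show ?thesis using False by simp
  qed
  let ?D = "distr M borel (\<lambda>\<omega>. level_of_past (past \<omega>))"
  have pm [measurable]: "(\<lambda>\<omega>. level_of_past (past \<omega>)) \<in> borel_measurable M"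
    by (rule measurable_compose[OF past_measurable level_of_past_measurable])
  interpret D: prob_space ?D by (rule prob_space_distr) simp
  have same: "emeasure M {\<omega> \<in> space M. level t \<omega> = c} = emeasure M {\<omega> \<in> space M. level 0 \<omega> = c}" for t c
  proof -
    have "emeasure M {\<omega> \<in> space M. level t \<omega> = c} = emeasure (distr M borel (\<sigma> t)) {s. ln (s\<^sup>2) = c}" for t
      by (subst emeasure_distr) (auto simp: level_def intro!: arg_cong[where f="emeasure M"])
    then show ?thesis by (simp add: sigma_distr[of t])
  qed
  have contraction: "emeasure M {\<omega> \<in> space M. level 0 \<omega> = c} \<le> ennreal q * emeasure M {\<omega> \<in> space M. level 0 \<omega> = (c - \<alpha>) / \<beta>}" for c
  proof -
    have "emeasure M {\<omega> \<in> space M. level 0 \<omega> = c} = emeasure M {\<omega> \<in> space M. level 1 \<omega> = c}" by (rule same[symmetric])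
    also have "\<dots> = emeasure M {\<omega> \<in> space M. \<alpha> + \<beta> * level_of_past (past \<omega>) + shocks \<omega> 0 = c}"
    proof (rule emeasure_eq_AE)
      show "AE \<omega> in M. \<omega> \<in> {\<omega> \<in> space M. level 1 \<omega> = c} \<longleftrightarrow> \<omega> \<in> {\<omega> \<in> space M. \<alpha> + \<beta> * level_of_past (past \<omega>) + shocks \<omega> 0 = c}"
        using level_step level_eq_past
      proof eventually_elim
        case (elim \<omega>)
        have "level 1 \<omega> = \<alpha> + \<beta> * level (1 - 1) \<omega> + shock (\<epsilon> (1 - 1) \<omega>)" using elim(1) by blast
        then show ?case using elim(2) by (simp add: shocks_def)
      qed
    qed (auto simp: shocks_def)
    also have "\<dots> = emeasure (distr M (borel \<Otimes>\<^sub>M C.S) (\<lambda>\<omega>. (level_of_past (past \<omega>), shocks \<omega>)))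
        {z \<in> space (borel \<Otimes>\<^sub>M C.S). \<alpha> + \<beta> * fst z + snd z 0 = c}"
    proof (subst emeasure_distr)
      show "emeasure M {\<omega> \<in> space M. \<alpha> + \<beta> * level_of_past (past \<omega>) + shocks \<omega> 0 = c}
        = emeasure M ((\<lambda>\<omega>. (level_of_past (past \<omega>), shocks \<omega>)) -` {z \<in> space (borel \<Otimes>\<^sub>M C.S). \<alpha> + \<beta> * fst z + snd z 0 = c} \<inter> space M)"
        using measurable_space[OF shocks_measurable]
        by (intro arg_cong[where f="emeasure M"]) (auto simp: space_pair_measure)
    qed measurable
    also have "distr M (borel \<Otimes>\<^sub>M C.S) (\<lambda>\<omega>. (level_of_past (past \<omega>), shocks \<omega>)) = ?D \<Otimes>\<^sub>M C.S"
      by (rule past_future_joint[OF level_of_past_measurable])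
    also have "emeasure (?D \<Otimes>\<^sub>M C.S) {z \<in> space (borel \<Otimes>\<^sub>M C.S). \<alpha> + \<beta> * fst z + snd z 0 = c}
        = (\<integral>\<^sup>+a. emeasure C.S (Pair a -` {z \<in> space (borel \<Otimes>\<^sub>M C.S). \<alpha> + \<beta> * fst z + snd z 0 = c}) \<partial>?D)"
      by (subst C.P.emeasure_pair_measure_alt) auto
    also have "\<dots> \<le> (\<integral>\<^sup>+a. ennreal q * indicator {(c - \<alpha>) / \<beta>} a \<partial>?D)"
    proof (intro nn_integral_mono)
      fix a :: real
      have "emeasure C.S (Pair a -` {z \<in> space (borel \<Otimes>\<^sub>M C.S). \<alpha> + \<beta> * fst z + snd z 0 = c})
          = emeasure (distr C.S W (\<lambda>w. w 0)) {c - \<alpha> - \<beta> * a}"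
        by (subst emeasure_distr) (auto intro!: arg_cong[where f="emeasure C.S"] simp: space_pair_measure C.sets_W)
      also have "distr C.S W (\<lambda>w. w 0) = W" by (rule C.PiM_component) simp
      also have "emeasure W {c - \<alpha> - \<beta> * a} \<le> ennreal q * indicator {0} (c - \<alpha> - \<beta> * a)" by (rule atom)
      also have "indicator {0} (c - \<alpha> - \<beta> * a) = (indicator {(c - \<alpha>) / \<beta>} a :: ennreal)"
        using params by (auto simp: indicator_def field_simps)
      finally show "emeasure C.S (Pair a -` {z \<in> space (borel \<Otimes>\<^sub>M C.S). \<alpha> + \<beta> * fst z + snd z 0 = c})
        \<le> ennreal q * indicator {(c - \<alpha>) / \<beta>} a" .
    qed
    also have "\<dots> = ennreal q * emeasure ?D {(c - \<alpha>) / \<beta>}" by (subst nn_integral_cmult) auto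
    also have "emeasure ?D {(c - \<alpha>) / \<beta>} = emeasure M {\<omega> \<in> space M. level_of_past (past \<omega>) = (c - \<alpha>) / \<beta>}"
      by (subst emeasure_distr) (auto intro!: arg_cong[where f="emeasure M"])
    also have "\<dots> = emeasure M {\<omega> \<in> space M. level 0 \<omega> = (c - \<alpha>) / \<beta>}"
    proof (rule emeasure_eq_AE)
      show "AE \<omega> in M. \<omega> \<in> {\<omega> \<in> space M. level_of_past (past \<omega>) = (c - \<alpha>) / \<beta>} \<longleftrightarrow> \<omega> \<in> {\<omega> \<in> space M. level 0 \<omega> = (c - \<alpha>) / \<beta>}"
        using level_eq_past by eventually_elim auto
    qed auto
    finally show ?thesis .
  qed
  have "emeasure M {\<omega> \<in> space M. level 0 \<omega> = c} \<le> ennreal (q ^ n)" for n c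
  proof (induction n arbitrary: c)
    case 0
    show ?case using emeasure_le_1 by simp
  next
    case (Suc n)
    have "emeasure M {\<omega> \<in> space M. level 0 \<omega> = c} \<le> ennreal q * ennreal (q ^ n)"
      using contraction[of c] Suc[of "(c - \<alpha>) / \<beta>"] by (meson mult_left_mono order_trans zero_le)
    then show ?case using q by (simp add: ennreal_mult)
  qed
  then have "measure M {\<omega> \<in> space M. level 0 \<omega> = c} \<le> q ^ n" for n
    using q by (simp add: emeasure_eq_measure ennreal_le_iff)
  then have "measure M {\<omega> \<in> space M. level 0 \<omega> = c} \<le> 0"
    using q by (intro LIMSEQ_le_const[OF LIMSEQ_power_zero[of q]]) auto
  then have "emeasure M {\<omega> \<in> space M. \<not> level 0 \<omega> \<noteq> c} = 0"
    by (simp add: emeasure_eq_measure measure_le_0_iff)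
  then show ?thesis by (subst AE_iff_measurable[OF _ refl]) auto
qed

end

section \<open>The two volatilities as an orbit of the chain\<close>

definition log_pair :: "real \<times> real \<Rightarrow> real \<times> real" where
  "log_pair z = (ln (fst z), ln (snd z) - ln (fst z))"

definition exp_pair :: "real \<times> real \<Rightarrow> real \<times> real" where
  "exp_pair x = (exp (fst x), exp (fst x + snd x))"

lemma exp_log_pair: "0 < fst z \<Longrightarrow> 0 < snd z \<Longrightarrow> exp_pair (log_pair z) = z"
  by (simp add: exp_pair_def log_pair_def)

lemma log_pair_measurable [measurable]: "log_pair \<in> borel_measurable borel"
  and exp_pair_measurable [measurable]: "exp_pair \<in> borel_measurable borel"
  unfolding log_pair_def[abs_def] exp_pair_def[abs_def] borel_prod[symmetric] by measurable

lemma HE_pos: "0 < HE \<alpha> \<beta> \<gamma> \<delta> y x"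
  by (simp add: HE_def)

lemma ln_HE:
  assumes "0 < s" "0 < x"
  shows "ln (HE \<alpha> \<beta> \<gamma> \<delta> (s * e) x) = \<alpha> + \<beta> * ln x + (\<gamma> * \<bar>e\<bar> + \<delta> * e) * exp ((ln (s\<^sup>2) - ln x) / 2)"
proof -
  have "exp ((ln (s\<^sup>2) - ln x) / 2) = s * x powr (-1/2)"
  proof -
    have "(ln (s\<^sup>2) - ln x) / 2 = ln s + (-1/2) * ln x" using assms by (simp add: ln_realpow field_simps)
    then have "exp ((ln (s\<^sup>2) - ln x) / 2) = exp (ln s) * exp ((-1/2) * ln x)" by (simp only: exp_add)
    then show ?thesis using assms by (simp add: powr_def)
  qed
  then show ?thesis using assms by (simp add: HE_def abs_mult algebra_simps)
qed

context egarch_process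
begin

abbreviation hat :: "real \<Rightarrow> nat \<Rightarrow> 'a \<Rightarrow> real" where
  "hat \<equiv> sigma_hat_sq \<alpha> \<beta> \<gamma> \<delta> \<epsilon> \<sigma>"

lemma step_log_pair:
  assumes pos: "0 < s" "0 < v" and u': "ln u' = \<alpha> + \<beta> * ln (s\<^sup>2) + shock e"
  shows "log_pair (u', HE \<alpha> \<beta> \<gamma> \<delta> (s * e) v) = C.step (log_pair (s\<^sup>2, v)) (shock e)"
proof -
  have sh: "\<gamma> * \<bar>e\<bar> + \<delta> * e = shock e" by (simp add: shock_def)
  have "- (ln v - ln (s\<^sup>2)) / 2 = (ln (s\<^sup>2) - ln v) / 2" by simp
  then show ?thesis
    unfolding log_pair_def C.step_def ratio_step_def contract_def fst_conv snd_conv ln_HE[OF pos] sh u'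
    by (simp only: prod.inject) (simp add: algebra_simps)
qed

lemma observed_orbit:
  assumes s2: "0 < s2"
  shows "AE \<omega> in M. \<forall>t. 0 < \<sigma> (int t) \<omega> \<and> 0 < hat s2 t \<omega> \<and>
    log_pair ((\<sigma> (int t) \<omega>)\<^sup>2, hat s2 t \<omega>)
      = C.orbit (level 0 \<omega>, ln s2 - level 0 \<omega>) (shocks \<omega>) t"
  using level_step
proof eventually_elim
  case (elim \<omega>)
  have pos: "0 < \<sigma> (int t) \<omega>" "0 < hat s2 t \<omega>" for t
  proof -
    show "0 < \<sigma> (int t) \<omega>" using elim by blast
    show "0 < hat s2 t \<omega>" by (cases t) (simp_all add: s2 HE_pos)
  qed
  have "log_pair ((\<sigma> (int t) \<omega>)\<^sup>2, hat s2 t \<omega>)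
      = C.orbit (level 0 \<omega>, ln s2 - level 0 \<omega>) (shocks \<omega>) t" for t
  proof (induction t)
    case 0
    then show ?case by (simp add: log_pair_def level_def)
  next
    case (Suc t)
    have "level (int (Suc t)) \<omega> = \<alpha> + \<beta> * level (int (Suc t) - 1) \<omega> + shock (\<epsilon> (int (Suc t) - 1) \<omega>)"
      using elim by blast
    then have u': "ln ((\<sigma> (int (Suc t)) \<omega>)\<^sup>2) = \<alpha> + \<beta> * ln ((\<sigma> (int t) \<omega>)\<^sup>2) + shock (\<epsilon> (int t) \<omega>)"
      by (simp add: level_def)
    show ?case unfolding sigma_hat_sq.simps step_log_pair[OF pos u'] Suc C.orbit.simps
      by (simp only: shocks_def[of \<omega> t])
  qed
  then show ?case using pos by blast
qed

lemma stationary_orbit: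
  assumes sol: "stationary_pair_solution M \<alpha> \<beta> \<gamma> \<delta> \<epsilon> \<sigma> N p U V"
  shows "AE \<omega> in N. \<forall>t. 0 < U t \<omega> \<and> 0 < V t \<omega> \<and>
    log_pair (U t \<omega>, V t \<omega>) = C.orbit (log_pair (U 0 \<omega>, V 0 \<omega>)) (shocks (p \<omega>)) t"
proof -
  have "AE \<omega> in N. \<forall>t. (0 < U t \<omega> \<and> 0 < V t \<omega>) \<and>
        U (Suc t) \<omega> = HE \<alpha> \<beta> \<gamma> \<delta> (sqrt (U t \<omega>) * \<epsilon> (int t) (p \<omega>)) (U t \<omega>) \<and>
        V (Suc t) \<omega> = HE \<alpha> \<beta> \<gamma> \<delta> (sqrt (U t \<omega>) * \<epsilon> (int t) (p \<omega>)) (V t \<omega>)"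
    unfolding AE_all_countable
    using sol by (auto simp: stationary_pair_solution_def)
  then show ?thesis
  proof eventually_elim
    case (elim \<omega>)
    have "log_pair (U t \<omega>, V t \<omega>) = C.orbit (log_pair (U 0 \<omega>, V 0 \<omega>)) (shocks (p \<omega>)) t" for t
    proof (induction t)
      case (Suc t)
      have pos: "0 < sqrt (U t \<omega>)" "0 < V t \<omega>" "0 < U t \<omega>" using elim by auto
      have sq: "(sqrt (U t \<omega>))\<^sup>2 = U t \<omega>" using pos by simp
      have U': "U (Suc t) \<omega> = HE \<alpha> \<beta> \<gamma> \<delta> (sqrt (U t \<omega>) * \<epsilon> (int t) (p \<omega>)) (U t \<omega>)"
        and V': "V (Suc t) \<omega> = HE \<alpha> \<beta> \<gamma> \<delta> (sqrt (U t \<omega>) * \<epsilon> (int t) (p \<omega>)) (V t \<omega>)" using elim by auto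
      have "ln (U (Suc t) \<omega>) = \<alpha> + \<beta> * ln ((sqrt (U t \<omega>))\<^sup>2) + shock (\<epsilon> (int t) (p \<omega>))"
        unfolding U' ln_HE[OF pos(1,3)] sq by (simp add: shock_def)
      from step_log_pair[OF pos(1,2) this] show ?case
        unfolding V' sq Suc C.orbit.simps by (simp only: shocks_def[of "p \<omega>" t])
    qed simp
    then show ?case using elim by blast
  qed
qed

lemma stationary_joint:
  assumes sol: "stationary_pair_solution M \<alpha> \<beta> \<gamma> \<delta> \<epsilon> \<sigma> N p U V"
  shows "prob_space N" "(\<lambda>\<omega>. (U t \<omega>, V t \<omega>)) \<in> borel_measurable N" "(\<lambda>\<omega>. shocks (p \<omega>)) \<in> N \<rightarrow>\<^sub>M C.S"
    "distr N (borel \<Otimes>\<^sub>M C.S) (\<lambda>\<omega>. (log_pair (U 0 \<omega>, V 0 \<omega>), shocks (p \<omega>)))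
      = distr N borel (\<lambda>\<omega>. log_pair (U 0 \<omega>, V 0 \<omega>)) \<Otimes>\<^sub>M C.S"
proof -
  have ext: "prob_space N" "p \<in> N \<rightarrow>\<^sub>M M" "distr N M p = M"
    using sol by (auto simp: stationary_pair_solution_def extended_space_def)
  note [measurable] = ext(2)
  show "prob_space N" by (rule ext)
  interpret N: prob_space N by (rule ext)
  show UV [measurable]: "(\<lambda>\<omega>. (U t \<omega>, V t \<omega>)) \<in> borel_measurable N" for t
    using sol by (auto simp: stationary_pair_solution_def strictly_stationary_def)
  show sh [measurable]: "(\<lambda>\<omega>. shocks (p \<omega>)) \<in> N \<rightarrow>\<^sub>M C.S" by measurable
  let ?B = "\<Pi>\<^sub>M t\<in>(UNIV :: nat set). (borel :: real measure)"
  define e where "e \<omega> t = \<epsilon> (int t) (p \<omega>)" for \<omega> and t :: nat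
  have e [measurable]: "e \<in> N \<rightarrow>\<^sub>M ?B"
    using measurable_restrict[of UNIV "\<lambda>t \<omega>. \<epsilon> (int t) (p \<omega>)" N "\<lambda>_. borel"] by (simp add: restrict_UNIV e_def[abs_def])
  define k :: "(nat \<Rightarrow> real) \<Rightarrow> nat \<Rightarrow> real" where "k y n = shock (y n)" for y n
  have k: "k \<in> ?B \<rightarrow>\<^sub>M C.S"
    using measurable_restrict[of UNIV "\<lambda>n y. shock (y n)" ?B "\<lambda>_. W"]
    by (simp add: restrict_UNIV k_def[abs_def] measurable_cong_sets[OF refl C.sets_W] shock_coordinate_measurable)
  have sk: "shocks (p \<omega>) = k (e \<omega>)" for \<omega> by (simp add: fun_eq_iff shocks_def k_def e_def)
  have joint: "distr N (borel \<Otimes>\<^sub>M ?B) (\<lambda>\<omega>. ((U 0 \<omega>, V 0 \<omega>), e \<omega>)) = distr N borel (\<lambda>\<omega>. (U 0 \<omega>, V 0 \<omega>)) \<Otimes>\<^sub>M distr N ?B e"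
  proof (rule N.joint_distr_indep)
    show "N.indep_set (sets (vimage_algebra (space N) (\<lambda>\<omega>. (U 0 \<omega>, V 0 \<omega>)) borel)) (sets (vimage_algebra (space N) e ?B))"
      using sol by (simp add: stationary_pair_solution_def e_def[abs_def])
  qed measurable
  have lk: "distr (distr N borel (\<lambda>\<omega>. (U 0 \<omega>, V 0 \<omega>))) borel log_pair = distr N borel (\<lambda>\<omega>. log_pair (U 0 \<omega>, V 0 \<omega>))"
    by (subst distr_distr) (auto simp: comp_def)
  have law: "distr (distr N ?B e) C.S k = C.S"
  proof -
    have "distr (distr N ?B e) C.S k = distr N C.S (\<lambda>\<omega>. shocks (p \<omega>))"
      by (subst distr_distr[OF k e]) (simp add: comp_def sk)
    also have "\<dots> = distr (distr N M p) C.S shocks" by (subst distr_distr) (auto simp: comp_def)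
    finally show ?thesis by (simp add: ext shocks_distr)
  qed
  have "distr (distr N borel (\<lambda>\<omega>. (U 0 \<omega>, V 0 \<omega>))) borel log_pair \<Otimes>\<^sub>M distr (distr N ?B e) C.S k
      = distr (distr N borel (\<lambda>\<omega>. (U 0 \<omega>, V 0 \<omega>)) \<Otimes>\<^sub>M distr N ?B e) (borel \<Otimes>\<^sub>M C.S) (\<lambda>(x, y). (log_pair x, k y))"
  proof (rule pair_measure_distr)
    show "sigma_finite_measure (distr (distr N ?B e) C.S k)"
      unfolding law by (rule prob_space_imp_sigma_finite[OF C.P.prob_space_axioms])
  qed (use k in auto)
  then have "distr N borel (\<lambda>\<omega>. log_pair (U 0 \<omega>, V 0 \<omega>)) \<Otimes>\<^sub>M C.S
      = distr (distr N borel (\<lambda>\<omega>. (U 0 \<omega>, V 0 \<omega>)) \<Otimes>\<^sub>M distr N ?B e) (borel \<Otimes>\<^sub>M C.S) (\<lambda>(x, y). (log_pair x, k y))"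
    unfolding law lk .
  also have "\<dots> = distr N (borel \<Otimes>\<^sub>M C.S) (\<lambda>\<omega>. (log_pair (U 0 \<omega>, V 0 \<omega>), shocks (p \<omega>)))"
    unfolding joint[symmetric] using k by (subst distr_distr) (auto simp: comp_def sk)
  finally show "distr N (borel \<Otimes>\<^sub>M C.S) (\<lambda>\<omega>. (log_pair (U 0 \<omega>, V 0 \<omega>), shocks (p \<omega>)))
      = distr N borel (\<lambda>\<omega>. log_pair (U 0 \<omega>, V 0 \<omega>)) \<Otimes>\<^sub>M C.S" by simp
qed

lemma observed_AE_transfer:
  assumes A: "A \<in> sets C.paths" and one: "AE \<omega> in M. C.path_prob A (level 0 \<omega>, b - level 0 \<omega>) = 1"
  shows "AE \<omega> in M. C.orbit (level 0 \<omega>, b - level 0 \<omega>) (shocks \<omega>) \<in> A"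
proof -
  let ?f = "\<lambda>y. (level_of_past y, b - level_of_past y)"
  have f: "?f \<in> (\<Pi>\<^sub>M t\<in>{..<0::int}. borel) \<rightarrow>\<^sub>M borel"
    unfolding borel_prod[symmetric] using level_of_past_measurable by measurable
  have "AE \<omega> in M. C.orbit (?f (past \<omega>)) (shocks \<omega>) \<in> A"
  proof (rule C.orbit_AE_transfer[OF prob_space_axioms _ shocks_measurable past_future_joint[OF f] A])
    show "(\<lambda>\<omega>. ?f (past \<omega>)) \<in> borel_measurable M" by (rule measurable_compose[OF past_measurable f])
    show "AE \<omega> in M. C.path_prob A (?f (past \<omega>)) = 1"
      using one level_eq_past by eventually_elim simp
  qed
  then show ?thesis using level_eq_past by eventually_elim simp
qed

lemma sigma_hat_sq_measurable [measurable]: "hat s2 t \<in> borel_measurable M"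
proof (induction t)
  case 0
  have "hat s2 0 = (\<lambda>_. s2)" by (simp add: fun_eq_iff)
  then show ?case by simp
next
  case (Suc t)
  note [measurable] = Suc
  have "hat s2 (Suc t) =
     (\<lambda>\<omega>. HE \<alpha> \<beta> \<gamma> \<delta> (\<sigma> (int t) \<omega> * \<epsilon> (int t) \<omega>) (hat s2 t \<omega>))" by (simp add: fun_eq_iff)
  then show ?case unfolding HE_def by simp
qed

text \<open>The ratio of the two volatilities tends to 1 almost surely, and \<open>\<sigma>\<^sub>t\<^sup>2\<close> is bounded by a large
  constant with a probability that is close to 1 uniformly in \<open>t\<close>.\<close>

theorem hat_converges_in_probability:
  assumes \<tau>: "0 < \<tau>" and neg: "(LINT w|W. ln (max \<tau> \<bar>\<beta> - w / 2\<bar>)) < 0" and s2: "0 < s2" and \<mu>: "0 < \<mu>"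
  shows "(\<lambda>t. prob {\<omega> \<in> space M. \<mu> \<le> \<bar>(\<sigma> (int t) \<omega>)\<^sup>2 - hat s2 t \<omega>\<bar>}) \<longlonglongrightarrow> 0"
proof -
  let ?h = "hat s2"
  have "AE \<omega> in M. C.orbit (level 0 \<omega>, ln s2 - level 0 \<omega>) (shocks \<omega>) \<in> C.ratio_to_0"
    by (rule observed_AE_transfer[OF C.ratio_to_0_sets]) (simp add: C.ratio_vanishes[OF \<tau> neg])
  then have ratio: "AE \<omega> in M. (\<lambda>t. ?h t \<omega> / (\<sigma> (int t) \<omega>)\<^sup>2) \<longlonglongrightarrow> 1"
    using observed_orbit[OF s2]
  proof eventually_elim
    case (elim \<omega>)
    have "ln (?h t \<omega>) - ln ((\<sigma> (int t) \<omega>)\<^sup>2) = snd (C.orbit (level 0 \<omega>, ln s2 - level 0 \<omega>) (shocks \<omega>) t)" for t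
      using elim(2) by (metis log_pair_def fst_conv snd_conv)
    then have "(\<lambda>t. ln (?h t \<omega>) - ln ((\<sigma> (int t) \<omega>)\<^sup>2)) \<longlonglongrightarrow> 0"
      using elim(1) by (simp add: C.ratio_to_0_def)
    from tendsto_exp[OF this] have "(\<lambda>t. exp (ln (?h t \<omega>) - ln ((\<sigma> (int t) \<omega>)\<^sup>2))) \<longlonglongrightarrow> 1" by simp
    moreover have "exp (ln (?h t \<omega>) - ln ((\<sigma> (int t) \<omega>)\<^sup>2)) = ?h t \<omega> / (\<sigma> (int t) \<omega>)\<^sup>2" for t
    proof -
      have "0 < \<sigma> (int t) \<omega>" "0 < ?h t \<omega>" using elim(2) by auto
      then show ?thesis by (simp add: exp_diff)
    qed
    ultimately show ?case by simp
  qed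
  have far: "(\<lambda>t. prob {\<omega> \<in> space M. e \<le> \<bar>?h t \<omega> / (\<sigma> (int t) \<omega>)\<^sup>2 - 1\<bar>}) \<longlonglongrightarrow> 0" if "0 < e" for e
  proof -
    have "(\<lambda>t. expectation (indicator {\<omega> \<in> space M. e \<le> \<bar>?h t \<omega> / (\<sigma> (int t) \<omega>)\<^sup>2 - 1\<bar>} :: _ \<Rightarrow> real)) \<longlonglongrightarrow> expectation (\<lambda>_. 0)"
    proof (rule integral_dominated_convergence[where w="\<lambda>_. 1"])
      show "AE \<omega> in M. (\<lambda>t. indicator {\<omega> \<in> space M. e \<le> \<bar>?h t \<omega> / (\<sigma> (int t) \<omega>)\<^sup>2 - 1\<bar>} \<omega> :: real) \<longlonglongrightarrow> 0"
        using ratio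
      proof eventually_elim
        case (elim \<omega>)
        from tendstoD[OF elim that]
        have "\<forall>\<^sub>F t in sequentially. indicator {\<omega> \<in> space M. e \<le> \<bar>?h t \<omega> / (\<sigma> (int t) \<omega>)\<^sup>2 - 1\<bar>} \<omega> = (0::real)"
          by eventually_elim (auto simp: dist_real_def indicator_def)
        then show ?case by (rule tendsto_eventually)
      qed
    qed (auto simp: indicator_def)
    then show ?thesis by simp
  qed
  have tight: "(\<lambda>n. prob {\<omega> \<in> space M. real n < (\<sigma> 0 \<omega>)\<^sup>2}) \<longlonglongrightarrow> 0"
  proof -
    have "(\<lambda>n. expectation (indicator {\<omega> \<in> space M. real n < (\<sigma> 0 \<omega>)\<^sup>2} :: _ \<Rightarrow> real)) \<longlonglongrightarrow> expectation (\<lambda>_. 0)"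
    proof (rule integral_dominated_convergence[where w="\<lambda>_. 1"])
      show "AE \<omega> in M. (\<lambda>n. indicator {\<omega> \<in> space M. real n < (\<sigma> 0 \<omega>)\<^sup>2} \<omega> :: real) \<longlonglongrightarrow> 0"
      proof (rule AE_I2)
        fix \<omega>
        obtain n0 :: nat where n0: "(\<sigma> 0 \<omega>)\<^sup>2 \<le> real n0" using real_arch_simple by blast
        have "\<forall>\<^sub>F n in sequentially. indicator {\<omega> \<in> space M. real n < (\<sigma> 0 \<omega>)\<^sup>2} \<omega> = (0::real)"
          using eventually_ge_at_top[of n0]
        proof eventually_elim
          case (elim n)
          then have "real n0 \<le> real n" by simp
          with n0 have "\<not> real n < (\<sigma> 0 \<omega>)\<^sup>2" by linarith
          then show ?case by simp
        qed
        then show "(\<lambda>n. indicator {\<omega> \<in> space M. real n < (\<sigma> 0 \<omega>)\<^sup>2} \<omega> :: real) \<longlonglongrightarrow> 0" by (rule tendsto_eventually)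
      qed
    qed (auto simp: indicator_def)
    then show ?thesis by simp
  qed
  have same: "prob {\<omega> \<in> space M. x < (\<sigma> t \<omega>)\<^sup>2} = prob {\<omega> \<in> space M. x < (\<sigma> 0 \<omega>)\<^sup>2}" for x t
  proof -
    have "prob {\<omega> \<in> space M. x < (\<sigma> t \<omega>)\<^sup>2} = measure (distr M borel (\<sigma> t)) {s. x < s\<^sup>2}" for t
      by (subst measure_distr) (auto intro!: arg_cong[where f=prob])
    then show ?thesis by (simp add: sigma_distr[of t])
  qed
  show ?thesis
  proof (rule LIMSEQ_I)
    fix r :: real assume r: "0 < r"
    have "\<forall>\<^sub>F n in sequentially. prob {\<omega> \<in> space M. real n < (\<sigma> 0 \<omega>)\<^sup>2} < r / 2"
      using tight r by (intro order_tendstoD) auto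
    then have "\<forall>\<^sub>F n in sequentially. prob {\<omega> \<in> space M. real n < (\<sigma> 0 \<omega>)\<^sup>2} < r / 2 \<and> 1 \<le> n"
      using eventually_ge_at_top[of 1] by eventually_elim auto
    then obtain n :: nat where n: "prob {\<omega> \<in> space M. real n < (\<sigma> 0 \<omega>)\<^sup>2} < r / 2" "1 \<le> n"
      by (auto simp: eventually_sequentially)
    have "\<forall>\<^sub>F t in sequentially. prob {\<omega> \<in> space M. \<mu> / real n \<le> \<bar>?h t \<omega> / (\<sigma> (int t) \<omega>)\<^sup>2 - 1\<bar>} < r / 2"
    proof (rule order_tendstoD(2)[OF far])
      show "0 < \<mu> / real n" "0 < r / 2" using r \<mu> n(2) by simp_all
    qed
    then obtain T where T: "\<And>t. T \<le> t \<Longrightarrow> prob {\<omega> \<in> space M. \<mu> / real n \<le> \<bar>?h t \<omega> / (\<sigma> (int t) \<omega>)\<^sup>2 - 1\<bar>} < r / 2"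
      unfolding eventually_sequentially by blast
    show "\<exists>no. \<forall>t\<ge>no. norm (prob {\<omega> \<in> space M. \<mu> \<le> \<bar>(\<sigma> (int t) \<omega>)\<^sup>2 - ?h t \<omega>\<bar>} - 0) < r"
    proof (intro exI allI impI)
      fix t assume t: "T \<le> t"
      let ?P = "{\<omega> \<in> space M. real n < (\<sigma> (int t) \<omega>)\<^sup>2}"
        and ?Q = "{\<omega> \<in> space M. \<mu> / real n \<le> \<bar>?h t \<omega> / (\<sigma> (int t) \<omega>)\<^sup>2 - 1\<bar>}"
      have "prob {\<omega> \<in> space M. \<mu> \<le> \<bar>(\<sigma> (int t) \<omega>)\<^sup>2 - ?h t \<omega>\<bar>} \<le> prob (?P \<union> ?Q)"
      proof (rule finite_measure_mono_AE)
        show "AE \<omega> in M. \<omega> \<in> {\<omega> \<in> space M. \<mu> \<le> \<bar>(\<sigma> (int t) \<omega>)\<^sup>2 - ?h t \<omega>\<bar>} \<longrightarrow> \<omega> \<in> ?P \<union> ?Q"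
          using level_step
        proof eventually_elim
          case (elim \<omega>)
          have "0 < \<sigma> (int t) \<omega>" using elim by blast
          then have s: "0 < (\<sigma> (int t) \<omega>)\<^sup>2" by simp
          show ?case
          proof (intro impI)
            assume mu: "\<omega> \<in> {\<omega> \<in> space M. \<mu> \<le> \<bar>(\<sigma> (int t) \<omega>)\<^sup>2 - ?h t \<omega>\<bar>}"
            show "\<omega> \<in> ?P \<union> ?Q"
            proof (cases "real n < (\<sigma> (int t) \<omega>)\<^sup>2")
              case False
              have "\<bar>(\<sigma> (int t) \<omega>)\<^sup>2 - ?h t \<omega>\<bar> = (\<sigma> (int t) \<omega>)\<^sup>2 * \<bar>?h t \<omega> / (\<sigma> (int t) \<omega>)\<^sup>2 - 1\<bar>"
              proof -
                have "(\<sigma> (int t) \<omega>)\<^sup>2 * (?h t \<omega> / (\<sigma> (int t) \<omega>)\<^sup>2 - 1) = - ((\<sigma> (int t) \<omega>)\<^sup>2 - ?h t \<omega>)"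
                  using s by (simp add: right_diff_distrib)
                then show ?thesis using s by (metis abs_minus_cancel abs_mult abs_of_pos)
              qed
              also have "\<dots> \<le> real n * \<bar>?h t \<omega> / (\<sigma> (int t) \<omega>)\<^sup>2 - 1\<bar>"
                using False by (intro mult_right_mono) auto
              finally have "\<mu> / real n \<le> \<bar>?h t \<omega> / (\<sigma> (int t) \<omega>)\<^sup>2 - 1\<bar>"
                using mu n(2) by (simp add: pos_divide_le_eq mult.commute)
              then show ?thesis using mu by simp
            qed (use mu in simp)
          qed
        qed
      qed measurable
      also have "\<dots> \<le> prob ?P + prob ?Q" by (intro measure_Un_le) auto
      also have "\<dots> < r" using T[OF t] n(1) same[of "real n" "int t"] by linarith
      finally show "norm (prob {\<omega> \<in> space M. \<mu> \<le> \<bar>(\<sigma> (int t) \<omega>)\<^sup>2 - ?h t \<omega>\<bar>} - 0) < r" by simp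
    qed
  qed
qed

text \<open>Both processes are orbits of the same chain, started off the diagonal independently of the
  shocks, so an invariant event has the same probability, 0 or 1, for both.\<close>

theorem expanding_ergodic:
  assumes exp: "egarch_chain_expanding W \<beta> B l" and \<gamma>: "0 < \<gamma>"
    and sol: "stationary_pair_solution M \<alpha> \<beta> \<gamma> \<delta> \<epsilon> \<sigma> N p U V"
    and off: "measure N {\<omega> \<in> space N. U 0 \<omega> = V 0 \<omega>} = 0"
  shows "ergodic_process N borel (\<lambda>t \<omega>. (U t \<omega>, V t \<omega>))"
    and "Q \<in> sets (borel :: (real \<times> real) measure) \<Longrightarrow> 0 < s2 \<Longrightarrow>
      AE \<omega> in M. (\<lambda>n. (\<Sum>t<n. indicator Q ((\<sigma> (int t) \<omega>)\<^sup>2, hat s2 t \<omega>)) / real n)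
        \<longlonglongrightarrow> measure N {\<omega> \<in> space N. (U 0 \<omega>, V 0 \<omega>) \<in> Q}"
proof -
  interpret E: egarch_chain_expanding W \<alpha> \<beta> B l by (rule exp)
  interpret N: prob_space N by (rule stationary_joint[OF sol])
  note UV [measurable] = stationary_joint(2)[OF sol]
  let ?X0 = "\<lambda>\<omega>. log_pair (U 0 \<omega>, V 0 \<omega>)"
  have X0 [measurable]: "?X0 \<in> borel_measurable N"
    by (rule measurable_compose[OF UV log_pair_measurable])
  have nonzero: "AE \<omega> in N. snd (?X0 \<omega>) \<noteq> 0"
  proof -
    have "{\<omega> \<in> space N. U 0 \<omega> = V 0 \<omega>} = {\<omega> \<in> space N. fst (U 0 \<omega>, V 0 \<omega>) = snd (U 0 \<omega>, V 0 \<omega>)}" by simp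
    also have "\<dots> \<in> sets N" by measurable
    finally have m: "{\<omega> \<in> space N. U 0 \<omega> = V 0 \<omega>} \<in> sets N" .
    have "AE \<omega> in N. \<not> U 0 \<omega> = V 0 \<omega>"
      using off m by (subst AE_iff_measurable[OF _ refl]) (auto simp: N.emeasure_eq_measure)
    then show ?thesis using stationary_orbit[OF sol]
    proof eventually_elim
      case (elim \<omega>)
      have "0 < U 0 \<omega>" "0 < V 0 \<omega>" using elim(2) by blast+
      with elim(1) show ?case by (simp add: log_pair_def)
    qed
  qed
  have transfer: "AE \<omega> in N. (\<lambda>t. log_pair (U t \<omega>, V t \<omega>)) \<in> A"
    if A: "A \<in> sets C.paths" and one: "\<And>x. snd x \<noteq> 0 \<Longrightarrow> C.path_prob A x = 1" for A
  proof -
    have "AE \<omega> in N. C.path_prob A (?X0 \<omega>) = 1" using nonzero by eventually_elim (rule one)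
    then have "AE \<omega> in N. C.orbit (?X0 \<omega>) (shocks (p \<omega>)) \<in> A"
      by (rule C.orbit_AE_transfer[OF N.prob_space_axioms X0 stationary_joint(3,4)[OF sol] A])
    then show ?thesis using stationary_orbit[OF sol]
    proof eventually_elim
      case (elim \<omega>)
      have "(\<lambda>t. log_pair (U t \<omega>, V t \<omega>)) = C.orbit (?X0 \<omega>) (shocks (p \<omega>))"
        using elim(2) by (intro ext) blast
      then show ?case using elim(1) by simp
    qed
  qed
  have dichotomy: "(\<forall>x. snd x \<noteq> 0 \<longrightarrow> C.path_prob A x = 1) \<and> (AE \<omega> in N. (\<lambda>t. log_pair (U t \<omega>, V t \<omega>)) \<in> A)
      \<or> (AE \<omega> in N. (\<lambda>t. log_pair (U t \<omega>, V t \<omega>)) \<notin> A)"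
    if A: "A \<in> sets C.paths" and inv: "C.shift_invariant A" for A
    using E.invariant_dichotomy[OF A inv]
  proof
    assume "\<forall>x. snd x \<noteq> 0 \<longrightarrow> C.path_prob A x = 1"
    then show ?thesis using transfer[OF A] by blast
  next
    assume 0: "\<forall>x. snd x \<noteq> 0 \<longrightarrow> C.path_prob A x = 0"
    have mA: "- A \<in> sets C.paths"
      using sets.compl_sets[OF A] by (simp add: space_PiM PiE_def Compl_eq_Diff_UNIV)
    have "C.path_prob (- A) x = 1" if "snd x \<noteq> 0" for x
      using C.path_prob_compl[OF A, of x] 0 that by simp
    from transfer[OF mA this] show ?thesis by auto
  qed
  have exp_path: "(\<lambda>y t. exp_pair (y t)) \<in> C.paths \<rightarrow>\<^sub>M C.paths"
  proof -
    have "(\<lambda>y. exp_pair (y t)) \<in> C.paths \<rightarrow>\<^sub>M borel" for t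
      by (rule measurable_compose[OF _ exp_pair_measurable]) simp
    then have "(\<lambda>y. \<lambda>t\<in>UNIV. exp_pair (y t)) \<in> C.paths \<rightarrow>\<^sub>M C.paths"
      by (intro measurable_restrict)
    then show ?thesis by (simp add: restrict_UNIV)
  qed
  have path_UV: "(\<lambda>\<omega> t. (U t \<omega>, V t \<omega>)) \<in> N \<rightarrow>\<^sub>M C.paths"
    using measurable_restrict[of UNIV "\<lambda>t \<omega>. (U t \<omega>, V t \<omega>)" N "\<lambda>_. borel"] UV by (simp add: restrict_UNIV)
  have exp_log_AE: "AE \<omega> in N. (\<lambda>t. exp_pair (log_pair (U t \<omega>, V t \<omega>))) = (\<lambda>t. (U t \<omega>, V t \<omega>))"
    using stationary_orbit[OF sol]
  proof eventually_elim
    case (elim \<omega>)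
    show ?case
    proof
      fix t
      have "0 < U t \<omega>" "0 < V t \<omega>" using elim by blast+
      then show "exp_pair (log_pair (U t \<omega>, V t \<omega>)) = (U t \<omega>, V t \<omega>)" by (simp add: exp_log_pair)
    qed
  qed
  show erg: "ergodic_process N borel (\<lambda>t \<omega>. (U t \<omega>, V t \<omega>))"
    unfolding ergodic_process_def
  proof (intro conjI ballI impI)
    show "strictly_stationary N borel (\<lambda>t \<omega>. (U t \<omega>, V t \<omega>))"
      using sol by (simp add: stationary_pair_solution_def)
    fix A assume A: "A \<in> sets C.paths" and inv: "{x \<in> space C.paths. (\<lambda>t. x (t + 1)) \<in> A} = A"
    define A' where "A' = {y. (\<lambda>t. exp_pair (y t)) \<in> A}"
    have "A' = (\<lambda>y t. exp_pair (y t)) -` A \<inter> space C.paths" by (auto simp: A'_def space_PiM PiE_def)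
    then have A'm: "A' \<in> sets C.paths" using measurable_sets[OF exp_path A] by simp
    have shift: "(\<lambda>t. y (Suc t)) \<in> A \<longleftrightarrow> y \<in> A" for y
    proof -
      have "y \<in> A \<longleftrightarrow> y \<in> {x \<in> space C.paths. (\<lambda>t. x (t + 1)) \<in> A}" by (simp only: inv)
      also have "\<dots> \<longleftrightarrow> (\<lambda>t. y (Suc t)) \<in> A" by (simp add: space_PiM PiE_def)
      finally show ?thesis by (rule sym)
    qed
    have A'i: "C.shift_invariant A'"
      unfolding C.shift_invariant_def A'_def mem_Collect_eq by (rule allI) (rule shift)
    have meas: "{\<omega> \<in> space N. (\<lambda>t. (U t \<omega>, V t \<omega>)) \<in> A} \<in> sets N"
      using measurable_sets[OF path_UV A] by (simp add: vimage_def Int_def conj_commute)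
    from dichotomy[OF A'm A'i]
    show "measure N {\<omega> \<in> space N. (\<lambda>t. (U t \<omega>, V t \<omega>)) \<in> A} \<in> {0, 1}"
    proof
      assume "(\<forall>x. snd x \<noteq> 0 \<longrightarrow> C.path_prob A' x = 1) \<and> (AE \<omega> in N. (\<lambda>t. log_pair (U t \<omega>, V t \<omega>)) \<in> A')"
      then have "AE \<omega> in N. (\<lambda>t. log_pair (U t \<omega>, V t \<omega>)) \<in> A'" by (rule conjunct2)
      then have "AE \<omega> in N. (\<lambda>t. (U t \<omega>, V t \<omega>)) \<in> A"
        using exp_log_AE by eventually_elim (simp add: A'_def)
      then show ?thesis using N.prob_Collect_eq_1[OF meas] by simp
    next
      assume "AE \<omega> in N. (\<lambda>t. log_pair (U t \<omega>, V t \<omega>)) \<notin> A'"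
      then have "AE \<omega> in N. (\<lambda>t. (U t \<omega>, V t \<omega>)) \<notin> A"
        using exp_log_AE by eventually_elim (simp add: A'_def)
      then show ?thesis using N.prob_Collect_eq_0[OF meas] by simp
    qed
  qed
  show "AE \<omega> in M. (\<lambda>n. (\<Sum>t<n. indicator Q ((\<sigma> (int t) \<omega>)\<^sup>2, hat s2 t \<omega>)) / real n)
        \<longlonglongrightarrow> measure N {\<omega> \<in> space N. (U 0 \<omega>, V 0 \<omega>) \<in> Q}"
    if Q [measurable]: "Q \<in> sets (borel :: (real \<times> real) measure)" and s2: "0 < s2"
  proof -
    define f :: "real \<times> real \<Rightarrow> real" where "f = indicator Q"
    have [measurable]: "f \<in> borel_measurable borel" unfolding f_def by simp
    have f1: "\<bar>f z\<bar> \<le> 1" for z by (simp add: f_def indicator_def)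
    define m where "m = measure N {\<omega> \<in> space N. (U 0 \<omega>, V 0 \<omega>) \<in> Q}"
    have "N.expectation (\<lambda>\<omega>. f (U 0 \<omega>, V 0 \<omega>)) = m"
    proof -
      have "N.expectation (\<lambda>\<omega>. f (U 0 \<omega>, V 0 \<omega>)) = N.expectation (indicator {\<omega> \<in> space N. (U 0 \<omega>, V 0 \<omega>) \<in> Q})"
        by (intro Bochner_Integration.integral_cong) (auto simp: f_def indicator_def)
      also have "\<dots> = m" unfolding m_def
        using measurable_sets[OF UV[of 0] Q] by (simp add: vimage_def Int_def conj_commute)
      finally show ?thesis .
    qed
    then have lln: "AE \<omega> in N. (\<lambda>n. (\<Sum>t<n. f (U t \<omega>, V t \<omega>)) / real n) \<longlonglongrightarrow> m"
      using ergodic_theorem[OF N.prob_space_axioms erg, of f 1] f1 by simp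
    define G where "G = {y :: nat \<Rightarrow> real \<times> real. (\<lambda>n. (\<Sum>t<n. f (exp_pair (y t))) / real n) \<longlonglongrightarrow> m}"
    have G: "G \<in> sets C.paths"
    proof -
      have "G = {y \<in> space C.paths. (\<lambda>n. (\<Sum>t<n. f (exp_pair (y t))) / real n) \<longlonglongrightarrow> m}"
        by (auto simp: G_def space_PiM PiE_def)
      also have "\<dots> \<in> sets C.paths" by (rule sets_Collect_tendsto) measurable
      finally show ?thesis .
    qed
    have Gi: "C.shift_invariant G"
      unfolding C.shift_invariant_def G_def mem_Collect_eq
    proof
      fix y :: "nat \<Rightarrow> real \<times> real"
      have d: "(\<lambda>n. (\<Sum>t<n. f (exp_pair (y (Suc t)))) / real n - (\<Sum>t<n. f (exp_pair (y t))) / real n) \<longlonglongrightarrow> 0"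
        by (rule average_shift[of "\<lambda>t. f (exp_pair (y t))" 1, OF f1])
      show "((\<lambda>n. (\<Sum>t<n. f (exp_pair (y (Suc t)))) / real n) \<longlonglongrightarrow> m) \<longleftrightarrow> ((\<lambda>n. (\<Sum>t<n. f (exp_pair (y t))) / real n) \<longlonglongrightarrow> m)"
      proof
        assume "(\<lambda>n. (\<Sum>t<n. f (exp_pair (y (Suc t)))) / real n) \<longlonglongrightarrow> m"
        from tendsto_diff[OF this d] show "(\<lambda>n. (\<Sum>t<n. f (exp_pair (y t))) / real n) \<longlonglongrightarrow> m" by simp
      next
        assume "(\<lambda>n. (\<Sum>t<n. f (exp_pair (y t))) / real n) \<longlonglongrightarrow> m"
        from tendsto_add[OF d this] show "(\<lambda>n. (\<Sum>t<n. f (exp_pair (y (Suc t)))) / real n) \<longlonglongrightarrow> m" by simp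
      qed
    qed
    have inG: "AE \<omega> in N. (\<lambda>t. log_pair (U t \<omega>, V t \<omega>)) \<in> G"
      using lln exp_log_AE unfolding G_def by eventually_elim (simp add: fun_eq_iff)
    have "\<forall>x. snd x \<noteq> 0 \<longrightarrow> C.path_prob G x = 1"
      using dichotomy[OF G Gi]
    proof
      assume "AE \<omega> in N. (\<lambda>t. log_pair (U t \<omega>, V t \<omega>)) \<notin> G"
      with inG have "AE \<omega> in N. False" by eventually_elim simp
      then show ?thesis using N.AE_False by blast
    qed blast
    then have one: "C.path_prob G x = 1" if "snd x \<noteq> 0" for x using that by blast
    have "AE \<omega> in M. C.path_prob G (level 0 \<omega>, ln s2 - level 0 \<omega>) = 1"
      using level_no_atom[OF \<gamma>, of "ln s2"]
    proof eventually_elim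
      case (elim \<omega>)
      then show ?case by (intro one) simp
    qed
    from observed_AE_transfer[OF G this] observed_orbit[OF s2]
    show ?thesis
    proof eventually_elim
      case (elim \<omega>)
      have "exp_pair (C.orbit (level 0 \<omega>, ln s2 - level 0 \<omega>) (shocks \<omega>) t)
          = ((\<sigma> (int t) \<omega>)\<^sup>2, hat s2 t \<omega>)" for t
      proof -
        have "0 < \<sigma> (int t) \<omega>" "0 < hat s2 t \<omega>"
          "log_pair ((\<sigma> (int t) \<omega>)\<^sup>2, hat s2 t \<omega>) = C.orbit (level 0 \<omega>, ln s2 - level 0 \<omega>) (shocks \<omega>) t"
          using elim(2) by blast+
        then show ?thesis using exp_log_pair[of "((\<sigma> (int t) \<omega>)\<^sup>2, hat s2 t \<omega>)"] by simp
      qed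
      then show ?case using elim(1) unfolding G_def f_def m_def mem_Collect_eq by simp
    qed
  qed
qed

end

theorem theorem3p3:
  fixes M :: "'a measure"
    and \<epsilon> \<sigma> :: "int \<Rightarrow> 'a \<Rightarrow> real"
    and \<alpha> \<beta> \<gamma> \<delta> :: real
    and g :: "real \<Rightarrow> real"
    and lam :: ereal
  assumes M: "prob_space M"
    and params: "\<gamma> \<ge> \<bar>\<delta>\<bar>" "\<beta> > 0"
    and iid: "iid M borel \<epsilon>"
    and stationarity:
      "ereal_expectation M (\<lambda>\<omega>. log_abs (\<alpha> + \<gamma> * \<bar>\<epsilon> 0 \<omega>\<bar> + \<delta> * \<epsilon> 0 \<omega>)) < \<infinity>" "\<beta> < 1"
    and density: "distributed M lborel (\<epsilon> 0) (\<lambda>x. ennreal (g x))" "continuous_on UNIV g"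
    and mean: "integrable M (\<epsilon> 0)" "integral\<^sup>L M (\<epsilon> 0) = 0"
    and variance: "integrable M (\<lambda>\<omega>. (\<epsilon> 0 \<omega>)\<^sup>2)" "integral\<^sup>L M (\<lambda>\<omega>. (\<epsilon> 0 \<omega>)\<^sup>2) = 1"
    and g_pos: "\<And>x. g x > 0"
    and g_bound: "bdd_above (range (\<lambda>x. (\<bar>x\<bar> + 1) * g x))"
    and volatility: "egarch_stationary M \<alpha> \<beta> \<gamma> \<delta> \<epsilon> \<sigma>"
    and lam: "lam = ereal_expectation M (\<lambda>\<omega>. log_abs (\<beta> - 1/2 * (\<gamma> * \<bar>\<epsilon> 0 \<omega>\<bar> + \<delta> * \<epsilon> 0 \<omega>)))"
  shows
    "(lam > 0 \<longrightarrow>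
       (\<forall>(N :: 'b measure) p U V.
          stationary_pair_solution M \<alpha> \<beta> \<gamma> \<delta> \<epsilon> \<sigma> N p U V \<and>
          measure N {\<omega> \<in> space N. U 0 \<omega> = V 0 \<omega>} = 0 \<longrightarrow>
          ergodic_process N borel (\<lambda>t \<omega>. (U t \<omega>, V t \<omega>)) \<and>
          (\<forall>B \<in> sets (borel :: (real \<times> real) measure). \<forall>s2 > 0.
             AE \<omega> in M.
               (\<lambda>n. (\<Sum>t<n. indicator B ((\<sigma> (int t) \<omega>)\<^sup>2, sigma_hat_sq \<alpha> \<beta> \<gamma> \<delta> \<epsilon> \<sigma> s2 t \<omega>)) / real n)
                 \<longlonglongrightarrow> measure N {\<omega> \<in> space N. (U 0 \<omega>, V 0 \<omega>) \<in> B}))) \<and>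
     (lam < 0 \<longrightarrow>
       (\<forall>s2 > 0. \<forall>\<mu> > 0.
          (\<lambda>t. measure M {\<omega> \<in> space M.
                 \<bar>(\<sigma> (int t) \<omega>)\<^sup>2 - sigma_hat_sq \<alpha> \<beta> \<gamma> \<delta> \<epsilon> \<sigma> s2 t \<omega>\<bar> \<ge> \<mu>})
            \<longlonglongrightarrow> 0))"
proof -
  interpret egarch_innovation M "\<epsilon> 0" g \<beta> \<gamma> \<delta>
    using M params stationarity density variance g_pos g_bound
    by (intro egarch_innovation.intro egarch_innovation_axioms.intro) auto
  interpret P: egarch_process M \<epsilon> g \<beta> \<gamma> \<delta> \<alpha> \<sigma>
    by unfold_locales (use iid volatility in auto)
  have lam': "lam = enn2ereal (egarch_chain.log_pos W \<beta>) - enn2ereal (egarch_chain.log_neg W \<beta>)"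
    by (rule lyapunov_exponent[OF lam])
  show ?thesis
  proof (intro conjI impI)
    assume "0 < lam"
    then obtain B l where exp: "egarch_chain_expanding W \<beta> B l" "0 < \<gamma>"
      using expanding_chain unfolding lam' by blast
    show "\<forall>(N :: 'b measure) p U V.
          stationary_pair_solution M \<alpha> \<beta> \<gamma> \<delta> \<epsilon> \<sigma> N p U V \<and>
          measure N {\<omega> \<in> space N. U 0 \<omega> = V 0 \<omega>} = 0 \<longrightarrow>
          ergodic_process N borel (\<lambda>t \<omega>. (U t \<omega>, V t \<omega>)) \<and>
          (\<forall>B \<in> sets (borel :: (real \<times> real) measure). \<forall>s2 > 0.
             AE \<omega> in M.
               (\<lambda>n. (\<Sum>t<n. indicator B ((\<sigma> (int t) \<omega>)\<^sup>2, sigma_hat_sq \<alpha> \<beta> \<gamma> \<delta> \<epsilon> \<sigma> s2 t \<omega>)) / real n)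
                 \<longlonglongrightarrow> measure N {\<omega> \<in> space N. (U 0 \<omega>, V 0 \<omega>) \<in> B})"
      using P.expanding_ergodic[OF exp] by blast
  next
    assume "lam < 0"
    then obtain \<tau> where "0 < (\<tau>::real)" "(LINT w|W. ln (max \<tau> \<bar>\<beta> - w / 2\<bar>)) < 0"
      using egarch_chain.contracting_if_negative[OF chain] unfolding lam' by blast
    then show "\<forall>s2 > 0. \<forall>\<mu> > 0.
          (\<lambda>t. measure M {\<omega> \<in> space M.
                 \<bar>(\<sigma> (int t) \<omega>)\<^sup>2 - sigma_hat_sq \<alpha> \<beta> \<gamma> \<delta> \<epsilon> \<sigma> s2 t \<omega>\<bar> \<ge> \<mu>})
            \<longlonglongrightarrow> 0"
      using P.hat_converges_in_probability by blast
  qed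
qed

end
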